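(* Let $k\ge 1$ be an integer, fix $s>1/2$ and initial data $u_0\in\mathcal{H}^s$. Let $u$ be a solution of the nonlinear Schrödinger equation with harmonic trapping $$ i u_t - \Delta u + x^2 u = |u|^{2k}u ,$$ and let $w$ be a solution of the resonant equation $$ i w_t(t) = \frac{2}{\pi}\int_{-\pi/4}^{\pi/4} e^{-irH}\left( |e^{irH}w(t)|^{2k}\, e^{irH}w(t)\right) dr, $$ both corresponding to the same initial data $u(0)=w(0)=u_0$. Suppose that the bounds $\|u(t)\|_{\mathcal{H}^s}\le \epsilon$ and $\|w(t)\|_{\mathcal{H}^s}\le\epsilon$ hold for all $t\in[0,T]$. Then for all $t\in[0,T]$, $$ \| u(t) - e^{itH}w(t)\|_{\mathcal{H}^s} \le \left( t(2k+1)\epsilon^{4k+1}+\epsilon^{2k+1}\right)\exp\left( (2k+1)t\epsilon^{2k}\right). $$ In particular, if $t\lesssim \epsilon^{-2k}$ then $\|u(t)-e^{itH}w(t)\|_{\mathcal{H}^s}\lesssim \epsilon^{2k+1}$.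
   Context: The spatial variable is $x\in\mathbb{R}$ and functions are complex valued. $H=-\Delta+x^2$ is the quantum harmonic oscillator on $L^2(\mathbb{R})$; its eigenfunctions are the $L^2$-normalized Hermite functions $\phi_n$, $n\ge0$, with $H\phi_n=(2n+1)\phi_n$. $e^{itH}$ is the propagator of the linear equation $iu_t+Hu=0$, i.e. $e^{itH}\phi_n=e^{it(2n+1)}\phi_n$. The space $\mathcal{H}^s=\{u\in L^2: H^{s/2}u\in L^2\}$ has the norm $\|u\|_{\mathcal{H}^s}=\|H^{s/2}u\|_{L^2}$. $A\lesssim B$ means there is an absolute constant $C$ such that $A\le CB$.
   Formalization: The displayed bound fails literally (e.g. k=1, s=4, small multiples of φ_0); it is proved with ε^{4k+1}, ε^{2k+1}, ε^{2k} multiplied by A^{4k}, A^{2k}, A^{2k}, for any A with ‖fg‖≤A‖f‖‖g‖ in H^s (such A is shown to exist; A=1 gives the original). *)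

theory Defs
  imports "HOL-Analysis.Analysis"
begin

section \<open>The Hilbert space of complex square-integrable functions on the line\<close>

definition sq_int :: "(real \<Rightarrow> complex) \<Rightarrow> bool" where
  "sq_int f \<longleftrightarrow> f \<in> borel_measurable lborel \<and> integrable lborel (\<lambda>x. (cmod (f x))\<^sup>2)"

lemma sq_int_0 [simp]: "sq_int (\<lambda>x. 0)"
  by (simp add: sq_int_def)

lemma sq_int_mult:
  assumes "sq_int f" and "sq_int g"
  shows "integrable lborel (\<lambda>x. f x * g x)"
proof -
  have i: "integrable lborel (\<lambda>x. (cmod (f x))\<^sup>2 + (cmod (g x))\<^sup>2)"
    using assms by (auto simp: sq_int_def)
  have m: "(\<lambda>x. f x * g x) \<in> borel_measurable lborel"
    using assms by (auto simp: sq_int_def)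
  have b: "norm (f x * g x) \<le> norm ((cmod (f x))\<^sup>2 + (cmod (g x))\<^sup>2)" for x
  proof -
    have "2 * cmod (f x) * cmod (g x) \<le> (cmod (f x))\<^sup>2 + (cmod (g x))\<^sup>2"
      by (rule sum_squares_bound)
    moreover have "0 \<le> cmod (f x) * cmod (g x)" by simp
    ultimately have "cmod (f x) * cmod (g x) \<le> (cmod (f x))\<^sup>2 + (cmod (g x))\<^sup>2" by linarith
    then show ?thesis by (simp add: norm_mult)
  qed
  show ?thesis
    by (rule Bochner_Integration.integrable_bound[OF i m]) (use b in auto)
qed

lemma sq_int_cnj: "sq_int f \<Longrightarrow> sq_int (\<lambda>x. cnj (f x))"
  unfolding sq_int_def
  using measurable_compose[of f lborel borel cnj borel]
    borel_measurable_continuous_onI[OF continuous_on_cnj[OF continuous_on_id]]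
  by auto

lemma sq_int_inner:
  assumes "sq_int f" and "sq_int g"
  shows "integrable lborel (\<lambda>x. f x \<bullet> g x)"
proof -
  have "integrable lborel (\<lambda>x. Re (f x * cnj (g x)))"
    by (rule integrable_bounded_linear[OF bounded_linear_Re
          sq_int_mult[OF assms(1) sq_int_cnj[OF assms(2)]]])
  then show ?thesis by (simp add: inner_complex_def)
qed

lemma sq_int_add:
  assumes "sq_int f" and "sq_int g"
  shows "sq_int (\<lambda>x. f x + g x)"
proof -
  have "integrable lborel (\<lambda>x. (cmod (f x))\<^sup>2 + 2 * (f x \<bullet> g x) + (cmod (g x))\<^sup>2)"
    using assms sq_int_inner[OF assms] by (auto simp: sq_int_def)
  moreover have "(cmod (f x + g x))\<^sup>2 = (cmod (f x))\<^sup>2 + 2 * (f x \<bullet> g x) + (cmod (g x))\<^sup>2" for x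
    by (simp add: power2_norm_eq_inner inner_add_left inner_add_right inner_commute)
  ultimately show ?thesis using assms by (auto simp: sq_int_def)
qed

lemma sq_int_cmult: "sq_int f \<Longrightarrow> sq_int (\<lambda>x. c * f x)"
  by (auto simp: sq_int_def norm_mult power_mult_distrib)

lemma sq_int_scaleR: "sq_int f \<Longrightarrow> sq_int (\<lambda>x. r *\<^sub>R f x)"
  using sq_int_cmult[of f "of_real r"] by (simp add: scaleR_conv_of_real)

lemma sq_int_uminus: "sq_int f \<Longrightarrow> sq_int (\<lambda>x. - f x)"
  using sq_int_cmult[of f "- 1"] by simp

definition L2_rel :: "(real \<Rightarrow> complex) \<Rightarrow> (real \<Rightarrow> complex) \<Rightarrow> bool" where
  "L2_rel f g \<longleftrightarrow> sq_int f \<and> sq_int g \<and> (AE x in lborel. f x = g x)"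

lemma part_equivp_L2_rel: "part_equivp L2_rel"
proof (rule part_equivpI)
  show "\<exists>f. L2_rel f f" by (rule exI[of _ "\<lambda>x. 0"]) (simp add: L2_rel_def)
  show "symp L2_rel" by (rule sympI) (auto simp: L2_rel_def elim: AE_mp)
  show "transp L2_rel"
  proof (rule transpI)
    fix f g h assume "L2_rel f g" "L2_rel g h"
    moreover from this have "AE x in lborel. f x = g x" "AE x in lborel. g x = h x"
      by (auto simp: L2_rel_def)
    then have "AE x in lborel. f x = h x" by eventually_elim simp
    ultimately show "L2_rel f h" by (simp add: L2_rel_def)
  qed
qed

quotient_type L2 = "real \<Rightarrow> complex" / partial: "L2_rel"
  by (rule part_equivp_L2_rel)

instantiation L2 :: real_inner
begin

lift_definition zero_L2 :: L2 is "\<lambda>x. 0" by (simp add: L2_rel_def)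

lift_definition plus_L2 :: "L2 \<Rightarrow> L2 \<Rightarrow> L2" is "\<lambda>f g x. f x + g x"
  unfolding L2_rel_def by (auto intro: sq_int_add)

lift_definition uminus_L2 :: "L2 \<Rightarrow> L2" is "\<lambda>f x. - f x"
  unfolding L2_rel_def by (auto intro: sq_int_uminus)

definition minus_L2 :: "L2 \<Rightarrow> L2 \<Rightarrow> L2" where "minus_L2 a b = a + - b"

lift_definition scaleR_L2 :: "real \<Rightarrow> L2 \<Rightarrow> L2" is "\<lambda>r f x. r *\<^sub>R f x"
  unfolding L2_rel_def by (auto intro: sq_int_scaleR)

lift_definition inner_L2 :: "L2 \<Rightarrow> L2 \<Rightarrow> real" is "\<lambda>f g. LBINT x. f x \<bullet> g x"
proof -
  fix f f' g g' assume *: "L2_rel f f'" "L2_rel g g'"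
  then have "AE x in lborel. f x = f' x" "AE x in lborel. g x = g' x"
    by (auto simp: L2_rel_def)
  then have "AE x in lborel. f x \<bullet> g x = f' x \<bullet> g' x" by eventually_elim simp
  then show "(LBINT x. f x \<bullet> g x) = (LBINT x. f' x \<bullet> g' x)"
    using * by (intro integral_cong_AE borel_measurable_integrable sq_int_inner)
      (auto simp: L2_rel_def)
qed

definition norm_L2 :: "L2 \<Rightarrow> real" where "norm_L2 a = sqrt (a \<bullet> a)"
definition sgn_L2 :: "L2 \<Rightarrow> L2" where "sgn_L2 a = scaleR (inverse (norm a)) a"
definition dist_L2 :: "L2 \<Rightarrow> L2 \<Rightarrow> real" where "dist_L2 a b = norm (a - b)"
definition uniformity_L2 :: "(L2 \<times> L2) filter" where
  "uniformity_L2 = (INF e\<in>{0<..}. principal {(x, y). dist x y < e})"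
definition open_L2 :: "L2 set \<Rightarrow> bool" where
  "open_L2 U \<longleftrightarrow> (\<forall>x\<in>U. eventually (\<lambda>(x', y). x' = x \<longrightarrow> y \<in> U) uniformity)"

instance
proof
  fix a b c :: L2 and r q :: real
  show "a + b + c = a + (b + c)"
    by transfer (auto simp: L2_rel_def add.assoc intro!: sq_int_add)
  show "a + b = b + a"
    by transfer (auto simp: L2_rel_def add.commute intro!: sq_int_add)
  show "0 + a = a" by transfer (auto simp: L2_rel_def)
  show "- a + a = 0" by transfer (auto simp: L2_rel_def)
  show "a - b = a + - b" by (rule minus_L2_def)
  show "r *\<^sub>R (a + b) = r *\<^sub>R a + r *\<^sub>R b"
    by transfer (auto simp: L2_rel_def scaleR_add_right intro!: sq_int_add sq_int_scaleR)
  show "(r + q) *\<^sub>R a = r *\<^sub>R a + q *\<^sub>R a"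
    by transfer (auto simp: L2_rel_def scaleR_add_left intro!: sq_int_add sq_int_scaleR)
  show "r *\<^sub>R q *\<^sub>R a = (r * q) *\<^sub>R a"
    by transfer (auto simp: L2_rel_def intro!: sq_int_scaleR)
  show "1 *\<^sub>R a = a" by transfer (auto simp: L2_rel_def)
  show "a \<bullet> b = b \<bullet> a" by transfer (simp add: inner_commute)
  show "(a + b) \<bullet> c = a \<bullet> c + b \<bullet> c"
    by transfer (auto simp: L2_rel_def inner_add_left sq_int_inner)
  show "r *\<^sub>R a \<bullet> b = r * (a \<bullet> b)" by transfer simp
  show "0 \<le> a \<bullet> a" by transfer (auto intro: integral_nonneg_AE)
  show "a \<bullet> a = 0 \<longleftrightarrow> a = 0"
  proof transfer
    fix f assume "L2_rel f f"
    then have f: "sq_int f" by (simp add: L2_rel_def)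
    have "(LBINT x. f x \<bullet> f x) = 0 \<longleftrightarrow> (AE x in lborel. f x \<bullet> f x = 0)"
      by (rule integral_nonneg_eq_0_iff_AE[OF sq_int_inner[OF f f]]) auto
    then show "(LBINT x. f x \<bullet> f x) = 0 \<longleftrightarrow> L2_rel f (\<lambda>x. 0)"
      using f by (simp add: L2_rel_def)
  qed
  show "norm a = sqrt (a \<bullet> a)" by (rule norm_L2_def)
  show "sgn a = scaleR (inverse (norm a)) a" by (rule sgn_L2_def)
  show "dist a b = norm (a - b)" by (rule dist_L2_def)
  show "(uniformity :: (L2 \<times> L2) filter) = (INF e\<in>{0<..}. principal {(x, y). dist x y < e})"
    by (rule uniformity_L2_def)
  show "open U \<longleftrightarrow> (\<forall>x\<in>U. eventually (\<lambda>(x', y). x' = x \<longrightarrow> y \<in> U) uniformity)" for U :: "L2 set"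
    by (rule open_L2_def)
qed

end

lift_definition scaleC :: "complex \<Rightarrow> L2 \<Rightarrow> L2" (infixr "*\<^sub>C" 75) is "\<lambda>c f x. c * f x"
  unfolding L2_rel_def by (auto intro: sq_int_cmult)

text \<open>The class of a function; the value is the junk value 0 if the function is not square
  integrable. Below it is applied to Hermite functions and to products of functions
  in the Sobolev space of order above 1/2, which are bounded.\<close>

definition L2_of :: "(real \<Rightarrow> complex) \<Rightarrow> L2" where
  "L2_of f = (if sq_int f then abs_L2 f else 0)"

text \<open>Bilinear pairing (no conjugation) with a real-valued function.\<close>

definition pairing :: "L2 \<Rightarrow> (real \<Rightarrow> real) \<Rightarrow> complex" where
  "pairing v \<psi> = (LBINT x. rep_L2 v x * complex_of_real (\<psi> x))"

section \<open>The quantum harmonic oscillator\<close>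

fun hermite_poly :: "nat \<Rightarrow> real \<Rightarrow> real" where
  "hermite_poly 0 x = 1"
| "hermite_poly (Suc 0) x = 2 * x"
| "hermite_poly (Suc (Suc n)) x =
     2 * x * hermite_poly (Suc n) x - 2 * real (Suc n) * hermite_poly n x"

definition hermite_fun :: "nat \<Rightarrow> real \<Rightarrow> real" where
  "hermite_fun n x = hermite_poly n x * exp (- x\<^sup>2 / 2) / sqrt (2 ^ n * fact n * sqrt pi)"

definition harm_osc :: "(real \<Rightarrow> real) \<Rightarrow> real \<Rightarrow> real" where
  "harm_osc \<psi> x = - deriv (deriv \<psi>) x + x\<^sup>2 * \<psi> x"

lemma hermite_poly_deriv:
  "(hermite_poly n has_field_derivative 2 * real n * hermite_poly (n - 1) x) (at x)"
proof (induction n arbitrary: x rule: induct_nat_012)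
  case 0
  then show ?case by simp
next
  case 1
  have "hermite_poly (Suc 0) = (\<lambda>x. 2 * x)" by auto
  then show ?case by (auto intro!: derivative_eq_intros)
next
  case (ge2 n)
  have e: "hermite_poly (Suc (Suc n)) =
      (\<lambda>x. 2 * x * hermite_poly (Suc n) x - 2 * real (Suc n) * hermite_poly n x)" by auto
  have "((\<lambda>x. 2 * x * hermite_poly (Suc n) x - 2 * real (Suc n) * hermite_poly n x)
      has_field_derivative
      2 * hermite_poly (Suc n) x + 2 * x * (2 * real (Suc n) * hermite_poly n x)
      - 2 * real (Suc n) * (2 * real n * hermite_poly (n - 1) x)) (at x)"
    using ge2[of x] by (auto intro!: derivative_eq_intros)
  moreover have "2 * x * (2 * real (Suc n) * hermite_poly n x)
      - 2 * real (Suc n) * (2 * real n * hermite_poly (n - 1) x)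
      = 2 * real (Suc n) * hermite_poly (Suc n) x"
    by (cases n) (simp_all add: algebra_simps)
  ultimately show ?case by (simp add: e algebra_simps)
qed

lemma harm_osc_hermite_fun: "harm_osc (hermite_fun n) x = (2 * real n + 1) * hermite_fun n x"
proof -
  define c where "c = 1 / sqrt (2 ^ n * fact n * sqrt pi)"
  have f: "hermite_fun n = (\<lambda>x. c * (hermite_poly n x * exp (- x\<^sup>2 / 2)))"
    by (auto simp: hermite_fun_def c_def)
  have E: "((\<lambda>x. exp (- x\<^sup>2 / 2)) has_field_derivative - x * exp (- x\<^sup>2 / 2)) (at x)" for x :: real
    by (auto intro!: derivative_eq_intros)
  define g where "g = (\<lambda>x. c * ((2 * real n * hermite_poly (n - 1) x - x * hermite_poly n x)
      * exp (- x\<^sup>2 / 2)))"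
  have d1: "deriv (hermite_fun n) = g"
  proof
    fix x
    have "(hermite_fun n has_field_derivative g x) (at x)"
      unfolding f g_def
      by (rule DERIV_cong, (rule E hermite_poly_deriv derivative_intros)+) (simp add: algebra_simps)
    then show "deriv (hermite_fun n) x = g x" by (rule DERIV_imp_deriv)
  qed
  define h where "h = 2 * real n * (2 * real (n - 1) * hermite_poly (n - 1 - 1) x)"
  have "(g has_field_derivative c * ((h - hermite_poly n x
      - 2 * x * (2 * real n * hermite_poly (n - 1) x) + x\<^sup>2 * hermite_poly n x)
      * exp (- x\<^sup>2 / 2))) (at x)"
    unfolding g_def h_def
    by (rule DERIV_cong, (rule E hermite_poly_deriv derivative_intros)+)
      (simp add: algebra_simps power2_eq_square)
  then have d2: "deriv (deriv (hermite_fun n)) x = c * ((h - hermite_poly n x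
      - 2 * x * (2 * real n * hermite_poly (n - 1) x) + x\<^sup>2 * hermite_poly n x)
      * exp (- x\<^sup>2 / 2))"
    unfolding d1 by (rule DERIV_imp_deriv)
  have h: "h = 2 * x * (2 * real n * hermite_poly (n - 1) x) - 2 * real n * hermite_poly n x"
  proof (cases n)
    case (Suc m)
    then show ?thesis by (cases m) (simp_all add: h_def algebra_simps)
  qed (simp add: h_def)
  show ?thesis
    unfolding harm_osc_def d2 unfolding f h by (simp add: algebra_simps)
qed

definition hermite_L2 :: "nat \<Rightarrow> L2" where
  "hermite_L2 n = L2_of (\<lambda>x. complex_of_real (hermite_fun n x))"

text \<open>Spectral calculus: \<open>m(H) v\<close> is the \<open>L\<^sup>2\<close>-limit of the Hermite expansion of \<open>v\<close> with
  coefficients multiplied by \<open>m n\<close>, where \<open>m n\<close> is the value at the eigenvalue \<open>2n + 1\<close>;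
  the domain consists of the \<open>v\<close> for which this series converges in \<open>L\<^sup>2\<close>.\<close>

definition spectral_term :: "(nat \<Rightarrow> complex) \<Rightarrow> L2 \<Rightarrow> nat \<Rightarrow> L2" where
  "spectral_term m v n = (m n * pairing v (hermite_fun n)) *\<^sub>C hermite_L2 n"

definition spectral_domain :: "(nat \<Rightarrow> complex) \<Rightarrow> L2 set" where
  "spectral_domain m = {v. summable (spectral_term m v)}"

definition spectral_op :: "(nat \<Rightarrow> complex) \<Rightarrow> L2 \<Rightarrow> L2" where
  "spectral_op m v = suminf (spectral_term m v)"

definition propagator :: "real \<Rightarrow> L2 \<Rightarrow> L2" where
  "propagator t = spectral_op (\<lambda>n. exp (\<i> * of_real (t * (2 * real n + 1))))"

definition sobolev_mult :: "real \<Rightarrow> nat \<Rightarrow> complex" where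
  "sobolev_mult s n = of_real ((2 * real n + 1) powr (s / 2))"

definition sobolev :: "real \<Rightarrow> L2 set" where
  "sobolev s = spectral_domain (sobolev_mult s)"

definition sobolev_norm :: "real \<Rightarrow> L2 \<Rightarrow> real" where
  "sobolev_norm s v = norm (spectral_op (sobolev_mult s) v)"

definition sobolev_continuous :: "real \<Rightarrow> real set \<Rightarrow> (real \<Rightarrow> L2) \<Rightarrow> bool" where
  "sobolev_continuous s I u \<longleftrightarrow> (\<forall>t\<in>I. u t \<in> sobolev s) \<and>
     (\<forall>t\<in>I. ((\<lambda>\<tau>. sobolev_norm s (u \<tau> - u t)) \<longlongrightarrow> 0) (at t within I))"

text \<open>\<open>A\<close> is an admissible constant in the algebra property of the Sobolev space of order \<open>s\<close>.
  With the norm \<open>\<parallel>H\<^sup>s\<^sup>/\<^sup>2 u\<parallel>\<close> this constant cannot be normalised to 1 for all \<open>s\<close>, and explicit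
  estimates for the nonlinearity carry one factor \<open>A\<close> per multiplication; \<open>A = 1\<close> gives
  the form in which the constant is suppressed.\<close>

definition algebra_const :: "real \<Rightarrow> real \<Rightarrow> bool" where
  "algebra_const s A \<longleftrightarrow> (\<forall>f\<in>sobolev s. \<forall>g\<in>sobolev s.
     sq_int (\<lambda>x. rep_L2 f x * rep_L2 g x) \<and>
     L2_of (\<lambda>x. rep_L2 f x * rep_L2 g x) \<in> sobolev s \<and>
     sobolev_norm s (L2_of (\<lambda>x. rep_L2 f x * rep_L2 g x)) \<le> A * sobolev_norm s f * sobolev_norm s g)"

section \<open>The two evolution equations\<close>

definition nonlin :: "nat \<Rightarrow> L2 \<Rightarrow> L2" where
  "nonlin k v = L2_of (\<lambda>x. of_real (cmod (rep_L2 v x) ^ (2 * k)) * rep_L2 v x)"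

definition schwartz :: "(real \<Rightarrow> real) \<Rightarrow> bool" where
  "schwartz \<psi> \<longleftrightarrow> (\<forall>n x. (deriv ^^ n) \<psi> differentiable (at x)) \<and>
     (\<forall>m n. bounded (range (\<lambda>x. x ^ m * (deriv ^^ n) \<psi> x)))"

text \<open>\<open>i u\<^sub>t - u\<^sub>x\<^sub>x + x\<^sup>2 u = |u|\<^sup>2\<^sup>k u\<close> on \<open>[0, T]\<close>, for a curve that is continuous into
  the Sobolev space; since the terms \<open>u\<^sub>x\<^sub>x\<close> and \<open>x\<^sup>2 u\<close> need not lie in \<open>L\<^sup>2\<close>, the equation is
  read in the tempered distributions. Real test functions suffice, as the pairing is bilinear.\<close>

definition nls_solution :: "nat \<Rightarrow> real \<Rightarrow> real \<Rightarrow> (real \<Rightarrow> L2) \<Rightarrow> bool" where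
  "nls_solution k s T u \<longleftrightarrow> sobolev_continuous s {0..T} u \<and>
     (\<forall>\<psi>. schwartz \<psi> \<longrightarrow> (\<forall>t\<in>{0..T}. \<exists>d.
        ((\<lambda>\<tau>. pairing (u \<tau>) \<psi>) has_vector_derivative d) (at t within {0..T}) \<and>
        \<i> * d + pairing (u t) (harm_osc \<psi>) = pairing (nonlin k (u t)) \<psi>))"

text \<open>For the resonant equation every term lies in \<open>L\<^sup>2\<close>: the time derivative and the
  vector-valued integral are those of the normed space \<open>L\<^sup>2\<close>.\<close>

definition resonant_solution :: "nat \<Rightarrow> real \<Rightarrow> real \<Rightarrow> (real \<Rightarrow> L2) \<Rightarrow> bool" where
  "resonant_solution k s T w \<longleftrightarrow> sobolev_continuous s {0..T} w \<and>
     (\<forall>t\<in>{0..T}. \<exists>d J.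
        (w has_vector_derivative d) (at t within {0..T}) \<and>
        ((\<lambda>r. propagator (- r) (nonlin k (propagator r (w t)))) has_integral J) {- pi / 4..pi / 4} \<and>
        \<i> *\<^sub>C d = (2 / pi) *\<^sub>R J)"

end

theory Submission
  imports Defs "HOL-Probability.Probability"
begin

text \<open>In the interaction picture \<open>v(t) = exp(-itH) u(t)\<close> the trapped equation becomes \<open>i v\<^sub>t = F(t, v)\<close>, and
  \<open>F\<close> has period \<open>\<pi>/2\<close> in \<open>t\<close> because \<open>exp(i\<pi>H/2)\<close> is \<open>i\<close> times the reflection \<open>x \<mapsto> - x\<close>, which the
  nonlinearity respects. The resonant equation is its time average, so the difference is controlled
  by averaging over periods and Gronwall's inequality, given Lipschitz bounds for the nonlinearity.
  These come from the algebra property. There, a product of two dyadic Hermite blocks is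
  concentrated on the modes below the higher block: the annihilation operator \<open>x + d/dx\<close> acts on
  products by the Leibniz rule and shifts Hermite coefficients. Square-summing the blocks needs
  only \<open>s > 1/2\<close>, through the sup norm of the lower block.\<close>

section \<open>The space of square-integrable functions\<close>

text \<open>The factor 1 in front of both error terms dictates how the averaging is done: the
  accumulated oscillation may cost no more than half a period times the obvious norms, and half of
  \<open>pi / 2\<close> is below 1. A cruder estimate over the last incomplete period would already
  spoil that constant.

  The Sobolev space is not a type of its own, so \<open>H^(s/2)\<close> transports both equations to
  \<open>L2\<close>, where the propagator is isometric and a theorem about Banach spaces applies.
  Two obstacles arise: the lift need not be bounded, and the trapped equation holds only against
  test functions. Both disappear in Hermite coefficients. Hermite functions are Schwartz functions,
  testing with them gives one scalar differential equation per mode, the lift is multiplication by a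
  number on each mode, and completeness of the Hermite functions reassembles the modes into one
  vector-valued integral equation.

  For the algebra property no description of the fractional norm by derivatives is used: the tail
  estimate for products holds to every order \<open>N\<close>, and \<open>N \<ge> s + 1\<close>
  beats the weight of the norm.\<close>

lemma sq_int_diff: "sq_int f \<Longrightarrow> sq_int g \<Longrightarrow> sq_int (\<lambda>x. f x - g x)"
  using sq_int_add[of f "\<lambda>x. - g x"] sq_int_uminus[of g] by simp

lemma sq_int_measurable: "sq_int f \<Longrightarrow> f \<in> borel_measurable lborel"
  by (simp add: sq_int_def)

lemma L2_rel_refl: "L2_rel f f \<longleftrightarrow> sq_int f"
  by (auto simp: L2_rel_def)

lemma sq_int_rep: "sq_int (rep_L2 v)"
  using Quotient_rep_reflp[OF Quotient_L2, of v] by (simp add: L2_rel_refl)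

lemma L2_of_rep: "L2_of (rep_L2 v) = v"
  using Quotient_abs_rep[OF Quotient_L2, of v] by (simp add: L2_of_def sq_int_rep)

lemma L2_of_cong:
  assumes "sq_int f" "sq_int g" "AE x in lborel. f x = g x"
  shows "L2_of f = L2_of g"
  using Quotient_rel_abs[OF Quotient_L2, of f g] assms by (simp add: L2_of_def L2_rel_def)

lemma rep_L2_of:
  assumes "sq_int f"
  shows "AE x in lborel. rep_L2 (L2_of f) x = f x"
proof -
  have "L2_rel (rep_L2 (abs_L2 f)) f"
    using Quotient_rep_abs[OF Quotient_L2, of f] assms by (simp add: L2_rel_refl)
  then show ?thesis using assms by (auto simp: L2_of_def L2_rel_def)
qed

lemma L2_eqI: "(AE x in lborel. rep_L2 v x = rep_L2 w x) \<Longrightarrow> v = w"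
  using L2_of_cong[of "rep_L2 v" "rep_L2 w"] by (simp add: L2_of_rep sq_int_rep)

lemma L2_of_zero: "L2_of (\<lambda>x. 0) = 0"
  by (simp add: L2_of_def zero_L2_def)

lemma L2_of_add: "sq_int f \<Longrightarrow> sq_int g \<Longrightarrow> L2_of (\<lambda>x. f x + g x) = L2_of f + L2_of g"
  by (simp add: L2_of_def plus_L2.abs_eq L2_rel_refl sq_int_add)

lemma L2_of_uminus: "sq_int f \<Longrightarrow> L2_of (\<lambda>x. - f x) = - L2_of f"
  by (simp add: L2_of_def uminus_L2.abs_eq L2_rel_refl sq_int_uminus)

lemma L2_of_diff: "sq_int f \<Longrightarrow> sq_int g \<Longrightarrow> L2_of (\<lambda>x. f x - g x) = L2_of f - L2_of g"
  using L2_of_add[of f "\<lambda>x. - g x"] by (simp add: sq_int_uminus L2_of_uminus)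

lemma L2_of_scaleC: "sq_int f \<Longrightarrow> L2_of (\<lambda>x. c * f x) = c *\<^sub>C L2_of f"
  by (simp add: L2_of_def scaleC.abs_eq L2_rel_refl sq_int_cmult)

lemma rep_0: "AE x in lborel. rep_L2 0 x = 0"
  using rep_L2_of[of "\<lambda>x. 0"] by (simp add: L2_of_zero)

lemma rep_diff: "AE x in lborel. rep_L2 (v - w) x = rep_L2 v x - rep_L2 w x"
  using rep_L2_of[OF sq_int_diff[OF sq_int_rep sq_int_rep], of v w]
  by (simp add: L2_of_diff sq_int_rep L2_of_rep)

lemma rep_scaleC: "AE x in lborel. rep_L2 (c *\<^sub>C v) x = c * rep_L2 v x"
  using rep_L2_of[OF sq_int_cmult[OF sq_int_rep], of c v]
  by (simp add: L2_of_scaleC sq_int_rep L2_of_rep)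

lemma scaleC_of_real: "of_real r *\<^sub>C v = r *\<^sub>R v"
  by transfer (auto simp: L2_rel_def scaleR_conv_of_real intro!: sq_int_cmult)

lemma scaleC_add_right: "c *\<^sub>C (v + w) = c *\<^sub>C v + c *\<^sub>C w"
  by transfer (auto simp: L2_rel_def distrib_left intro!: sq_int_add sq_int_cmult)

lemma scaleC_add_left: "(b + c) *\<^sub>C v = b *\<^sub>C v + c *\<^sub>C v"
  by transfer (auto simp: L2_rel_def distrib_right intro!: sq_int_add sq_int_cmult)

lemma scaleC_scaleC: "b *\<^sub>C c *\<^sub>C v = (b * c) *\<^sub>C v"
  by transfer (auto simp: L2_rel_def mult.assoc intro!: sq_int_cmult)

lemma scaleC_one [simp]: "1 *\<^sub>C v = v"
  using scaleC_of_real[of 1 v] by simp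

lemma norm_L2_of:
  assumes "sq_int f"
  shows "(norm (L2_of f))\<^sup>2 = (LBINT x. (cmod (f x))\<^sup>2)"
  using assms by (simp add: power2_norm_eq_inner L2_of_def inner_L2.abs_eq L2_rel_refl)

lemma norm_rep: "(norm v)\<^sup>2 = (LBINT x. (cmod (rep_L2 v x))\<^sup>2)"
  using norm_L2_of[OF sq_int_rep, of v] by (simp add: L2_of_rep)

lemma norm_scaleC: "norm (c *\<^sub>C v) = cmod c * norm v"
proof -
  have "(norm (c *\<^sub>C v))\<^sup>2 = (LBINT x. (cmod (c * rep_L2 v x))\<^sup>2)"
    using norm_L2_of[OF sq_int_cmult[OF sq_int_rep], of c v]
    by (simp add: L2_of_scaleC sq_int_rep L2_of_rep)
  also have "\<dots> = (cmod c * norm v)\<^sup>2"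
    by (simp add: norm_mult power_mult_distrib norm_rep)
  finally show ?thesis by (rule power2_eq_imp_eq) simp_all
qed

lemma inner_L2_of:
  assumes "sq_int f" "sq_int g"
  shows "L2_of f \<bullet> L2_of g = (LBINT x. f x \<bullet> g x)"
  using assms by (simp add: L2_of_def inner_L2.abs_eq L2_rel_refl)

lemma bounded_linear_scaleC: "bounded_linear ((*\<^sub>C) c)"
proof
  show "c *\<^sub>C (v + w) = c *\<^sub>C v + c *\<^sub>C w" for v w by (rule scaleC_add_right)
  show "c *\<^sub>C r *\<^sub>R v = r *\<^sub>R c *\<^sub>C v" for r v
    by (simp add: scaleC_of_real[symmetric] scaleC_scaleC mult.commute)
  show "\<exists>K. \<forall>v. norm (c *\<^sub>C v) \<le> norm v * K"
    by (rule exI[of _ "cmod c"]) (simp add: norm_scaleC)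
qed

lemma scaleC_diff_right: "c *\<^sub>C (v - w) = c *\<^sub>C v - c *\<^sub>C w"
  using bounded_linear_scaleC[THEN bounded_linear.linear] by (rule linear_diff)

lemma bounded_linear_scaleC_left: "bounded_linear (\<lambda>c. c *\<^sub>C v)"
proof
  show "(b + c) *\<^sub>C v = b *\<^sub>C v + c *\<^sub>C v" for b c by (rule scaleC_add_left)
  show "(r *\<^sub>R c) *\<^sub>C v = r *\<^sub>R c *\<^sub>C v" for r c
    by (simp add: scaleC_of_real[symmetric] scaleC_scaleC scaleR_conv_of_real)
  show "\<exists>K. \<forall>c. norm (c *\<^sub>C v) \<le> norm c * K"
    by (rule exI[of _ "norm v"]) (simp add: norm_scaleC)
qed

lemma sq_int_cmod: "sq_int f \<Longrightarrow> sq_int (\<lambda>x. of_real (cmod (f x)))"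
  by (auto simp: sq_int_def)

lemma norm_L2_of_cmod:
  assumes "sq_int f"
  shows "norm (L2_of (\<lambda>x. of_real (cmod (f x)))) = norm (L2_of f)"
  by (rule power2_eq_imp_eq[OF _ norm_ge_zero norm_ge_zero])
    (simp add: norm_L2_of[OF sq_int_cmod[OF assms]] norm_L2_of[OF assms])

text \<open>Moduli are real, so the integral of their product is an inner product in
  \<open>L2\<close>, and Cauchy-Schwarz there gives the bound.\<close>

lemma LBINT_cmod_mult_le:
  assumes f: "sq_int f" and g: "sq_int g"
  shows "integrable lborel (\<lambda>x. cmod (f x) * cmod (g x))"
    "(LBINT x. cmod (f x) * cmod (g x)) \<le> norm (L2_of f) * norm (L2_of g)"
proof -
  have e: "cmod z * cmod w = complex_of_real (cmod z) \<bullet> complex_of_real (cmod w)" for z w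
    by (simp add: inner_complex_def)
  show "integrable lborel (\<lambda>x. cmod (f x) * cmod (g x))"
    unfolding e by (intro sq_int_inner sq_int_cmod f g)
  have "(LBINT x. cmod (f x) * cmod (g x))
      = L2_of (\<lambda>x. of_real (cmod (f x))) \<bullet> L2_of (\<lambda>x. of_real (cmod (g x)))"
    unfolding e by (simp add: inner_L2_of sq_int_cmod f g)
  also have "\<dots> \<le> norm (L2_of f) * norm (L2_of g)"
    unfolding norm_L2_of_cmod[OF f, symmetric] norm_L2_of_cmod[OF g, symmetric]
    by (rule norm_cauchy_schwarz)
  finally show "(LBINT x. cmod (f x) * cmod (g x)) \<le> norm (L2_of f) * norm (L2_of g)" .
qed

lemma cmod_LBINT_mult_le:
  assumes "sq_int f" "sq_int g"
  shows "cmod (LBINT x. f x * g x) \<le> norm (L2_of f) * norm (L2_of g)"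
  by (rule order_trans[OF integral_norm_bound])
    (use LBINT_cmod_mult_le(2)[OF assms] in \<open>simp add: norm_mult\<close>)

lemma sq_int_dominated:
  assumes f: "f \<in> borel_measurable lborel" and g: "sq_int g"
    and le: "AE x in lborel. cmod (f x) \<le> B * cmod (g x)"
  shows "sq_int f" "B \<ge> 0 \<Longrightarrow> norm (L2_of f) \<le> B * norm (L2_of g)"
proof -
  have le2: "AE x in lborel. (cmod (f x))\<^sup>2 \<le> B\<^sup>2 * (cmod (g x))\<^sup>2"
    using le
  proof eventually_elim
    case (elim x)
    from power_mono[OF elim, of 2] show ?case by (simp add: power_mult_distrib)
  qed
  have ig: "integrable lborel (\<lambda>x. B\<^sup>2 * (cmod (g x))\<^sup>2)" using g by (simp add: sq_int_def)
  have i: "integrable lborel (\<lambda>x. (cmod (f x))\<^sup>2)"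
    by (rule Bochner_Integration.integrable_bound[OF ig]) (use f le2 in simp_all)
  then show sq: "sq_int f" using f by (simp add: sq_int_def)
  have "(norm (L2_of f))\<^sup>2 \<le> (LBINT x. B\<^sup>2 * (cmod (g x))\<^sup>2)"
    unfolding norm_L2_of[OF sq] by (rule integral_mono_AE[OF i ig le2])
  then have "(norm (L2_of f))\<^sup>2 \<le> (B * norm (L2_of g))\<^sup>2"
    by (simp add: norm_L2_of[OF g] power_mult_distrib)
  then show "B \<ge> 0 \<Longrightarrow> norm (L2_of f) \<le> B * norm (L2_of g)"
    by (rule power2_le_imp_le) simp
qed

lemma
  assumes f: "f \<in> borel_measurable lborel" and g: "sq_int g" and B: "AE x in lborel. cmod (f x) \<le> B"
  shows sq_int_bounded_mult: "sq_int (\<lambda>x. f x * g x)"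
    and norm_L2_bounded_mult: "B \<ge> 0 \<Longrightarrow> norm (L2_of (\<lambda>x. f x * g x)) \<le> B * norm (L2_of g)"
proof -
  have m: "(\<lambda>x. f x * g x) \<in> borel_measurable lborel" using f g by (auto simp: sq_int_def)
  have le: "AE x in lborel. cmod (f x * g x) \<le> B * cmod (g x)"
    using B by eventually_elim (simp add: norm_mult mult_right_mono)
  note d = sq_int_dominated[OF m g le]
  show "sq_int (\<lambda>x. f x * g x)" by (rule d)
  show "B \<ge> 0 \<Longrightarrow> norm (L2_of (\<lambda>x. f x * g x)) \<le> B * norm (L2_of g)" by (rule d)
qed

text \<open>Squaring turns convergence in \<open>L2\<close> into convergence of integrals of moduli,
  which has an a.e. convergent subsequence. This is how pointwise bounds on truncated expansions
  reach the limit.\<close>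

lemma L2_tendsto_AE_subseq:
  assumes "(\<lambda>n. L2_of (f n)) \<longlonglongrightarrow> v" and f: "\<And>n. sq_int (f n)"
  obtains r where "strict_mono r" "AE x in lborel. (\<lambda>n. f (r n) x) \<longlonglongrightarrow> rep_L2 v x"
proof -
  define d where "d = (\<lambda>n x. (cmod (f n x - rep_L2 v x))\<^sup>2)"
  have sq: "sq_int (\<lambda>x. f n x - rep_L2 v x)" for n by (intro sq_int_diff f sq_int_rep)
  have "(\<lambda>n. (norm (L2_of (f n) - v))\<^sup>2) \<longlonglongrightarrow> 0\<^sup>2"
    using assms(1) by (intro tendsto_power) (simp add: LIM_zero tendsto_norm_zero)
  moreover have "(norm (L2_of (f n) - v))\<^sup>2 = (LBINT x. norm (d n x))" for n
    using norm_L2_of[OF sq, of n] by (simp add: L2_of_diff f sq_int_rep L2_of_rep d_def)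
  ultimately have "(\<lambda>n. LBINT x. norm (d n x)) \<longlonglongrightarrow> 0" by simp
  moreover have "integrable lborel (d n)" for n using sq[of n] by (simp add: sq_int_def d_def)
  ultimately obtain r where r: "strict_mono r" "AE x in lborel. (\<lambda>n. d (r n) x) \<longlonglongrightarrow> 0"
    using tendsto_L1_AE_subseq[of lborel d] by auto
  have "AE x in lborel. (\<lambda>n. f (r n) x) \<longlonglongrightarrow> rep_L2 v x"
    using r(2)
  proof eventually_elim
    case (elim x)
    then have "(\<lambda>n. sqrt (d (r n) x)) \<longlonglongrightarrow> sqrt 0" by (rule tendsto_real_sqrt)
    then have "(\<lambda>n. cmod (f (r n) x - rep_L2 v x)) \<longlonglongrightarrow> 0" by (simp add: d_def)
    then show ?case by (rule LIM_zero_cancel[OF tendsto_norm_zero_cancel])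
  qed
  then show ?thesis using r(1) that by blast
qed


section \<open>Completeness of \<open>L2\<close>\<close>

lemma sq_intI_nn:
  assumes m: "f \<in> borel_measurable lborel"
    and le: "(\<integral>\<^sup>+x. ennreal ((cmod (f x))\<^sup>2) \<partial>lborel) \<le> ennreal (B\<^sup>2)" and "B \<ge> 0"
  shows "sq_int f" "norm (L2_of f) \<le> B"
proof -
  have i: "integrable lborel (\<lambda>x. (cmod (f x))\<^sup>2)"
  proof (rule integrableI_bounded)
    show "(\<lambda>x. (cmod (f x))\<^sup>2) \<in> borel_measurable lborel" using m by measurable
    have "(\<integral>\<^sup>+x. ennreal (norm ((cmod (f x))\<^sup>2)) \<partial>lborel) \<le> ennreal (B\<^sup>2)" using le by simp
    then show "(\<integral>\<^sup>+x. ennreal (norm ((cmod (f x))\<^sup>2)) \<partial>lborel) < \<infinity>"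
      by (simp add: order_le_less_trans)
  qed
  then show f: "sq_int f" using m by (simp add: sq_int_def)
  have "ennreal ((norm (L2_of f))\<^sup>2) \<le> ennreal (B\<^sup>2)"
    using le nn_integral_eq_integral[OF i] by (simp add: norm_L2_of[OF f])
  then have "(norm (L2_of f))\<^sup>2 \<le> B\<^sup>2" by simp
  then show "norm (L2_of f) \<le> B" using assms(3) by (simp add: power2_le_iff_abs_le)
qed

text \<open>Riesz-Fischer: a subsequence with geometrically small increments converges a.e., and its
  pointwise limit is the limit in norm. Completeness makes integrals of continuous curves and
  orthogonal series in \<open>L2\<close> available.\<close>

instance L2 :: banach
proof
  fix X :: "nat \<Rightarrow> L2"
  assume C: "Cauchy X"
  have "\<exists>M. \<forall>m\<ge>M. \<forall>n\<ge>M. norm (X m - X n) < (1 / 2) ^ k" for k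
    using CauchyD[OF C, of "(1 / 2) ^ k"] by simp
  then obtain M where M: "\<And>k m n. m \<ge> M k \<Longrightarrow> n \<ge> M k \<Longrightarrow> norm (X m - X n) < (1 / 2) ^ k"
    by metis
  \<comment> \<open>Summing the thresholds puts \<open>r n\<close> above every \<open>M m\<close>
    with \<open>m \<le> n\<close>; the summand \<open>n\<close> makes \<open>r\<close> strictly
    increasing.\<close>
  define r where "r = (\<lambda>n. (\<Sum>i\<le>n. M i) + n)"
  have r: "strict_mono r" unfolding strict_mono_Suc_iff by (simp add: r_def)
  have rM: "r n \<ge> M m" if "m \<le> n" for m n
    unfolding r_def using member_le_sum[of m "{..n}" M] that by simp
  define f where "f = (\<lambda>n. rep_L2 (X (r n)))"
  have f: "sq_int (f n)" and Lf: "L2_of (f n) = X (r n)" for n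
    by (simp_all add: f_def sq_int_rep L2_of_rep)
  have sqd: "sq_int (\<lambda>x. f n x - f m x)" for n m by (intro sq_int_diff f)
  have close: "norm (L2_of (\<lambda>x. f n x - f m x)) < (1 / 2) ^ m" if "m \<le> n" for m n
    using M[OF rM[OF that] rM[of m m]] by (simp add: L2_of_diff f Lf)
  \<comment> \<open>Any strictly positive square-integrable weight would do: it reduces the a.e. convergence
    of the telescoping series to an \<open>L\<^sup>1\<close> bound.\<close>
  define w where "w = (\<lambda>x. sqrt (std_normal_density x))"
  have w_pos: "w x > 0" for x by (simp add: w_def normal_density_pos)
  have w: "sq_int (\<lambda>x. of_real (w x))"
    unfolding sq_int_def by (auto simp: w_def)
  let ?W = "norm (L2_of (\<lambda>x. of_real (w x)))"
  define d where "d = (\<lambda>n x. cmod (f (Suc n) x - f n x) * w x)"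
  have d_nn: "0 \<le> d n x" for n x using w_pos[of x] by (simp add: d_def)
  have fm [measurable]: "f n \<in> borel_measurable borel" for n
    using sq_int_measurable[OF f, of n] by simp
  have d_int: "integrable lborel (d n)" and d_le: "(LBINT x. d n x) \<le> (1 / 2) ^ n * ?W" for n
  proof -
    have e: "d n = (\<lambda>x. cmod (f (Suc n) x - f n x) * cmod (complex_of_real (w x)))"
      using w_pos by (simp add: d_def fun_eq_iff abs_of_pos)
    show "integrable lborel (d n)" unfolding e by (rule LBINT_cmod_mult_le[OF sqd w])
    have "(LBINT x. d n x) \<le> norm (L2_of (\<lambda>x. f (Suc n) x - f n x)) * ?W"
      unfolding e by (rule LBINT_cmod_mult_le[OF sqd w])
    also have "\<dots> \<le> (1 / 2) ^ n * ?W"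
      using close[of n "Suc n"] by (intro mult_right_mono) simp_all
    finally show "(LBINT x. d n x) \<le> (1 / 2) ^ n * ?W" .
  qed
  have "(\<integral>\<^sup>+x. (\<Sum>n. ennreal (d n x)) \<partial>lborel) = (\<Sum>n. \<integral>\<^sup>+x. ennreal (d n x) \<partial>lborel)"
    by (rule nn_integral_suminf) (use d_int in auto)
  also have "\<dots> = (\<Sum>n. ennreal (LBINT x. d n x))"
    by (intro suminf_cong nn_integral_eq_integral d_int) (simp add: d_nn)
  also have "\<dots> \<le> (\<Sum>n. ennreal ((1 / 2) ^ n * ?W))"
    by (intro suminf_le ennreal_leI d_le) auto
  also have "\<dots> < \<infinity>"
    by (subst suminf_ennreal2) (auto intro!: summable_mult2 summable_geometric)
  finally have "(\<integral>\<^sup>+x. (\<Sum>n. ennreal (d n x)) \<partial>lborel) \<noteq> \<infinity>" by simp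
  then have "AE x in lborel. (\<Sum>n. ennreal (d n x)) \<noteq> \<infinity>"
    by (intro nn_integral_PInf_AE) (use d_int in auto)
  then have conv: "AE x in lborel. convergent (\<lambda>n. f n x)"
  proof eventually_elim
    case (elim x)
    then have "summable (\<lambda>n. d n x)"
      by (intro summable_suminf_not_top) (simp_all add: d_nn)
    then have "summable (\<lambda>n. d n x * inverse (w x))" by (rule summable_mult2)
    then have "summable (\<lambda>n. norm (f (Suc n) x - f n x))"
      using w_pos[of x] by (simp add: d_def mult.assoc)
    then have "summable (\<lambda>n. f (Suc n) x - f n x)" by (rule summable_norm_cancel)
    then have "convergent (\<lambda>n. f n x - f 0 x)"
      using sum_lessThan_telescope[of "\<lambda>n. f n x"] by (simp add: summable_iff_convergent)
    then have "convergent (\<lambda>n. f n x - f 0 x + f 0 x)"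
      by (intro convergent_add convergent_const)
    then show ?case by simp
  qed
  define F where "F = (\<lambda>x. lim (\<lambda>n. f n x))"
  have Fm [measurable]: "F \<in> borel_measurable borel" unfolding F_def by measurable
  \<comment> \<open>Fatou's lemma bounds the distance from the a.e. limit to \<open>f m\<close> and
    shows in the same stroke that the difference is square integrable.\<close>
  have Fc: "sq_int (\<lambda>x. F x - f m x) \<and> norm (L2_of (\<lambda>x. F x - f m x)) \<le> (1 / 2) ^ m" for m
  proof -
    have "(\<integral>\<^sup>+x. ennreal ((cmod (F x - f m x))\<^sup>2) \<partial>lborel)
        \<le> (\<integral>\<^sup>+x. liminf (\<lambda>n. ennreal ((cmod (f n x - f m x))\<^sup>2)) \<partial>lborel)"
    proof (rule nn_integral_mono_AE)
      show "AE x in lborel. ennreal ((cmod (F x - f m x))\<^sup>2)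
          \<le> liminf (\<lambda>n. ennreal ((cmod (f n x - f m x))\<^sup>2))"
        using conv
      proof eventually_elim
        case (elim x)
        then have "(\<lambda>n. f n x) \<longlonglongrightarrow> F x" by (simp add: F_def convergent_LIMSEQ_iff)
        then have "(\<lambda>n. ennreal ((cmod (f n x - f m x))\<^sup>2)) \<longlonglongrightarrow> ennreal ((cmod (F x - f m x))\<^sup>2)"
          by (intro tendsto_ennrealI tendsto_intros)
        from lim_imp_Liminf[OF sequentially_bot this] show ?case by simp
      qed
    qed
    also have "\<dots> \<le> liminf (\<lambda>n. \<integral>\<^sup>+x. ennreal ((cmod (f n x - f m x))\<^sup>2) \<partial>lborel)"
      by (rule nn_integral_liminf) measurable
    also have "\<dots> \<le> ennreal (((1 / 2) ^ m)\<^sup>2)"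
    proof (rule Liminf_le)
      show "\<forall>\<^sub>F n in sequentially. (\<integral>\<^sup>+x. ennreal ((cmod (f n x - f m x))\<^sup>2) \<partial>lborel)
          \<le> ennreal (((1 / 2) ^ m)\<^sup>2)"
        using eventually_ge_at_top[of m]
      proof eventually_elim
        case (elim n)
        have "(\<integral>\<^sup>+x. ennreal ((cmod (f n x - f m x))\<^sup>2) \<partial>lborel)
            = ennreal ((norm (L2_of (\<lambda>x. f n x - f m x)))\<^sup>2)"
          unfolding norm_L2_of[OF sqd]
          by (rule nn_integral_eq_integral) (use sqd[of n m] in \<open>auto simp: sq_int_def\<close>)
        also have "\<dots> \<le> ennreal (((1 / 2) ^ m)\<^sup>2)"
          by (intro ennreal_leI power_mono less_imp_le[OF close[OF elim]]) simp
        finally show ?case .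
      qed
    qed simp
    finally have le: "(\<integral>\<^sup>+x. ennreal ((cmod (F x - f m x))\<^sup>2) \<partial>lborel)
        \<le> ennreal (((1 / 2) ^ m)\<^sup>2)" .
    have "(\<lambda>x. F x - f m x) \<in> borel_measurable lborel" by simp
    from sq_intI_nn[OF this le] show ?thesis by simp
  qed
  have F: "sq_int F" using sq_int_add[OF Fc[THEN conjunct1, of 0] f[of 0]] by simp
  have "(\<lambda>m. X (r m)) \<longlonglongrightarrow> L2_of F"
  proof (rule tendsto_dist_iff[THEN iffD2], rule tendsto_sandwich[OF _ _ tendsto_const])
    show "(\<lambda>m. (1 / 2) ^ m :: real) \<longlonglongrightarrow> 0" by (rule LIMSEQ_power_zero) simp
    have "dist (X (r m)) (L2_of F) \<le> (1 / 2) ^ m" for m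
      using Fc[THEN conjunct2, of m]
      by (simp add: L2_of_diff F f Lf dist_norm norm_minus_commute)
    then show "\<forall>\<^sub>F m in sequentially. dist (X (r m)) (L2_of F) \<le> (1 / 2) ^ m" by simp
  qed simp
  then show "convergent X"
    using Cauchy_converges_subseq[OF C r, of "L2_of F"] by (auto simp: comp_def convergent_def)
qed

lemma pairing_L2_of:
  assumes f: "sq_int f" and g: "sq_int (\<lambda>x. of_real (\<psi> x))"
  shows "pairing (L2_of f) \<psi> = (LBINT x. f x * of_real (\<psi> x))"
  unfolding pairing_def
proof (rule integral_cong_AE)
  show "AE x in lborel. rep_L2 (L2_of f) x * of_real (\<psi> x) = f x * of_real (\<psi> x)"
    using rep_L2_of[OF f] by eventually_elim simp
  show "(\<lambda>x. rep_L2 (L2_of f) x * complex_of_real (\<psi> x)) \<in> borel_measurable lborel"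
    "(\<lambda>x. f x * complex_of_real (\<psi> x)) \<in> borel_measurable lborel"
    using sq_int_measurable[OF f] sq_int_measurable[OF g] sq_int_measurable[OF sq_int_rep]
    by (auto intro!: borel_measurable_times)
qed

lemma pairing_add:
  assumes g: "sq_int (\<lambda>x. of_real (\<psi> x))"
  shows "pairing (v + w) \<psi> = pairing v \<psi> + pairing w \<psi>"
proof -
  have "pairing (v + w) \<psi> = (LBINT x. (rep_L2 v x + rep_L2 w x) * of_real (\<psi> x))"
    using pairing_L2_of[OF sq_int_add[OF sq_int_rep sq_int_rep] g, of v w]
    by (simp add: L2_of_add sq_int_rep L2_of_rep)
  then show ?thesis
    by (simp add: pairing_def ring_distribs sq_int_mult[OF sq_int_rep g])
qed

lemma pairing_scaleC:
  assumes g: "sq_int (\<lambda>x. of_real (\<psi> x))"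
  shows "pairing (c *\<^sub>C v) \<psi> = c * pairing v \<psi>"
proof -
  have "pairing (c *\<^sub>C v) \<psi> = (LBINT x. (c * rep_L2 v x) * of_real (\<psi> x))"
    using pairing_L2_of[OF sq_int_cmult[OF sq_int_rep] g, of c v]
    by (simp add: L2_of_scaleC sq_int_rep L2_of_rep)
  then show ?thesis by (simp add: pairing_def mult.assoc)
qed

lemma pairing_le:
  assumes g: "sq_int (\<lambda>x. of_real (\<psi> x))"
  shows "cmod (pairing v \<psi>) \<le> norm v * norm (L2_of (\<lambda>x. of_real (\<psi> x)))"
  unfolding pairing_def using cmod_LBINT_mult_le[OF sq_int_rep g, of v] by (simp add: L2_of_rep)

lemma bounded_linear_pairing:
  assumes g: "sq_int (\<lambda>x. of_real (\<psi> x))"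
  shows "bounded_linear (\<lambda>v. pairing v \<psi>)"
proof
  show "pairing (v + w) \<psi> = pairing v \<psi> + pairing w \<psi>" for v w by (rule pairing_add[OF g])
  show "pairing (r *\<^sub>R v) \<psi> = r *\<^sub>R pairing v \<psi>" for r v
    using pairing_scaleC[OF g, of "of_real r" v] by (simp add: scaleC_of_real scaleR_conv_of_real)
  show "\<exists>K. \<forall>v. norm (pairing v \<psi>) \<le> norm v * K"
    using pairing_le[OF g] by blast
qed

section \<open>Rapidly decaying functions and Hermite functions\<close>

text \<open>Schwartz decay without a condition on derivatives: the derivatives that occur are
  explicit combinations of Hermite functions and are rapid again.\<close>

definition rapid :: "(real \<Rightarrow> complex) \<Rightarrow> bool" where
  "rapid f \<longleftrightarrow> continuous_on UNIV f \<and> (\<forall>k. \<exists>B. \<forall>x. cmod (f x) * \<bar>x\<bar> ^ k \<le> B)"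

lemma rapidE:
  assumes "rapid f"
  obtains B where "\<And>x. cmod (f x) * \<bar>x\<bar> ^ k \<le> B"
  using assms unfolding rapid_def by metis

lemma rapid_measurable: "rapid f \<Longrightarrow> f \<in> borel_measurable borel"
  unfolding rapid_def by (simp add: borel_measurable_continuous_onI)

lemma rapid_0: "rapid (\<lambda>x. 0)"
  by (auto simp: rapid_def)

lemma rapid_add:
  assumes "rapid f" "rapid g"
  shows "rapid (\<lambda>x. f x + g x)"
  unfolding rapid_def
proof safe
  show "continuous_on UNIV (\<lambda>x. f x + g x)"
    using assms by (auto simp: rapid_def intro: continuous_intros)
  fix k
  obtain B C where B: "\<And>x. cmod (f x) * \<bar>x\<bar> ^ k \<le> B" "\<And>x. cmod (g x) * \<bar>x\<bar> ^ k \<le> C"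
    using assms rapidE by metis
  have "cmod (f x + g x) * \<bar>x\<bar> ^ k \<le> B + C" for x
  proof -
    have "cmod (f x + g x) * \<bar>x\<bar> ^ k \<le> (cmod (f x) + cmod (g x)) * \<bar>x\<bar> ^ k"
      by (intro mult_right_mono norm_triangle_ineq) simp
    then show ?thesis using B[of x] by (simp add: ring_distribs)
  qed
  then show "\<exists>B. \<forall>x. cmod (f x + g x) * \<bar>x\<bar> ^ k \<le> B" by blast
qed

lemma rapid_mult:
  assumes "rapid f" "rapid g"
  shows "rapid (\<lambda>x. f x * g x)"
  unfolding rapid_def
proof safe
  show "continuous_on UNIV (\<lambda>x. f x * g x)"
    using assms by (auto simp: rapid_def intro: continuous_intros)
  fix k
  obtain B C where B: "\<And>x. cmod (f x) * \<bar>x\<bar> ^ k \<le> B" "\<And>x. cmod (g x) * \<bar>x\<bar> ^ 0 \<le> C"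
    using assms rapidE by metis
  have "cmod (f x * g x) * \<bar>x\<bar> ^ k \<le> B * C" for x
    using mult_mono[OF B(1)[of x] B(2)[of x]] order_trans[OF _ B(1)[of x]]
    by (simp add: norm_mult mult_ac)
  then show "\<exists>B. \<forall>x. cmod (f x * g x) * \<bar>x\<bar> ^ k \<le> B" by blast
qed

lemma rapid_cmult: "rapid f \<Longrightarrow> rapid (\<lambda>x. c * f x)"
  unfolding rapid_def
proof safe
  assume c: "continuous_on UNIV f" and b: "\<forall>k. \<exists>B. \<forall>x. cmod (f x) * \<bar>x\<bar> ^ k \<le> B"
  show "continuous_on UNIV (\<lambda>x. c * f x)" by (intro continuous_intros c)
  fix k
  obtain B where "\<And>x. cmod (f x) * \<bar>x\<bar> ^ k \<le> B" using b by blast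
  then have "cmod (c * f x) * \<bar>x\<bar> ^ k \<le> cmod c * B" for x
    using mult_left_mono[of "cmod (f x) * \<bar>x\<bar> ^ k" B "cmod c"] by (simp add: norm_mult mult.assoc)
  then show "\<exists>B. \<forall>x. cmod (c * f x) * \<bar>x\<bar> ^ k \<le> B" by blast
qed

lemma rapid_diff: "rapid f \<Longrightarrow> rapid g \<Longrightarrow> rapid (\<lambda>x. f x - g x)"
  using rapid_add[of f "\<lambda>x. - 1 * g x"] rapid_cmult[of g "- 1"] by simp

lemma rapid_x_mult:
  assumes "rapid f"
  shows "rapid (\<lambda>x. of_real x * f x)"
  unfolding rapid_def
proof safe
  show "continuous_on UNIV (\<lambda>x. of_real x * f x)"
    using assms by (auto simp: rapid_def intro!: continuous_intros)
  fix k
  show "\<exists>B. \<forall>x. cmod (of_real x * f x) * \<bar>x\<bar> ^ k \<le> B"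
    using rapidE[OF assms, of "Suc k"] by (auto simp: norm_mult mult_ac)
qed

lemma rapid_cnj: "rapid f \<Longrightarrow> rapid (\<lambda>x. cnj (f x))"
  by (auto simp: rapid_def intro: continuous_intros)

lemma rapid_sum: "(\<And>i. i \<in> I \<Longrightarrow> rapid (f i)) \<Longrightarrow> rapid (\<lambda>x. \<Sum>i\<in>I. f i x)"
  by (induction I rule: infinite_finite_induct) (auto intro: rapid_0 rapid_add)

lemma rapid_integrable:
  assumes "rapid f"
  shows "integrable lborel f"
proof -
  obtain B C where B: "\<And>x. cmod (f x) * \<bar>x\<bar> ^ 0 \<le> B" "\<And>x. cmod (f x) * \<bar>x\<bar> ^ 2 \<le> C"
    using assms rapidE by metis
  show ?thesis
  proof (rule Bochner_Integration.integrable_bound)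
    have "integrable lborel (\<lambda>x::real. inverse (1 + x\<^sup>2))"
      using integrable_inverse_1_plus_square by (simp add: set_integrable_def)
    then show "integrable lborel (\<lambda>x::real. (B + C) * inverse (1 + x\<^sup>2))" by simp
    have "cmod (f x) \<le> norm ((B + C) * inverse (1 + x\<^sup>2))" for x
    proof -
      have "cmod (f x) * (1 + x\<^sup>2) \<le> B + C"
        using B[of x] by (simp add: ring_distribs)
      then have "cmod (f x) \<le> (B + C) * inverse (1 + x\<^sup>2)"
        by (simp add: field_simps add_pos_nonneg)
      then show ?thesis by simp
    qed
    then show "AE x in lborel. cmod (f x) \<le> norm ((B + C) * inverse (1 + x\<^sup>2))" by simp
  qed (use rapid_measurable[OF assms] in simp)
qed

lemma rapid_sq_int:
  assumes "rapid f"
  shows "sq_int f"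
proof -
  have "integrable lborel (\<lambda>x. f x * cnj (f x))"
    by (intro rapid_integrable rapid_mult rapid_cnj assms)
  then show ?thesis
    using rapid_measurable[OF assms]
    by (simp add: sq_int_def complex_norm_square[symmetric] complex_of_real_integrable_eq
        del: of_real_power)
qed

lemma rapid_tendsto:
  assumes "rapid f"
  shows "(f \<longlongrightarrow> 0) at_top" "(f \<longlongrightarrow> 0) at_bot"
proof -
  obtain B where B: "\<And>x. cmod (f x) * \<bar>x\<bar> ^ 1 \<le> B" using assms rapidE by metis
  have le: "cmod (f x) \<le> B / \<bar>x\<bar>" if "x \<noteq> 0" for x
    using B[of x] that by (simp add: field_simps)
  have "((\<lambda>x::real. B / \<bar>x\<bar>) \<longlongrightarrow> 0) at_top" "((\<lambda>x::real. B / \<bar>x\<bar>) \<longlongrightarrow> 0) at_bot"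
    by real_asymp+
  then show "(f \<longlongrightarrow> 0) at_top" "(f \<longlongrightarrow> 0) at_bot"
    by (auto intro!: Lim_null_comparison[where g = "\<lambda>x. B / \<bar>x\<bar>"]
        eventually_mono[OF eventually_gt_at_top[of 0]] eventually_mono[OF eventually_gt_at_bot[of 0]] le)
qed

text \<open>Integration by parts on the whole line: the boundary terms vanish because
  \<open>F\<close> decays. All adjointness relations below are instances.\<close>

lemma rapid_FTC:
  assumes F: "rapid F" and F': "rapid F'" and d: "\<And>x. (F has_vector_derivative F' x) (at x)"
  shows "(LBINT x. F' x) = 0"
proof -
  have "(LBINT x=-\<infinity>..\<infinity>. F' x) = 0 - 0"
  proof (rule interval_integral_FTC_integrable)
    show "((F \<circ> real_of_ereal) \<longlongrightarrow> 0) (at_right (- \<infinity>))" "((F \<circ> real_of_ereal) \<longlongrightarrow> 0) (at_left \<infinity>)"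
      using rapid_tendsto[OF F] by (simp_all add: ereal_tendsto_simps)
    show "set_integrable lborel (einterval (-\<infinity>) \<infinity>) F'"
      using rapid_integrable[OF F'] by (simp add: set_integrable_def)
    show "isCont F' x" for x
      using F' by (simp add: rapid_def continuous_on_eq_continuous_at)
  qed (use d in auto)
  then show ?thesis by (simp add: interval_lebesgue_integral_def set_lebesgue_integral_def)
qed

text \<open>Integrating from minus infinity, where \<open>F\<close> vanishes. Applied to a squared
  modulus it bounds a supremum by \<open>L2\<close> norms.\<close>

lemma rapid_norm_le_integral:
  assumes F: "rapid F" and F': "rapid F'" and d: "\<And>x. (F has_vector_derivative F' x) (at x)"
  shows "cmod (F a) \<le> (LBINT x. cmod (F' x))"
proof -
  have int: "integrable lborel F'" by (rule rapid_integrable[OF F'])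
  have si: "set_integrable lborel (einterval (-\<infinity>) a) F'"
    unfolding set_integrable_def by (rule integrable_mult_indicator[OF _ int]) simp
  have "(LBINT x=-\<infinity>..a. F' x) = F a - 0"
  proof (rule interval_integral_FTC_integrable)
    show "((F \<circ> real_of_ereal) \<longlongrightarrow> 0) (at_right (- \<infinity>))"
      using rapid_tendsto[OF F] by (simp add: ereal_tendsto_simps)
    have "isCont F a"
      using F by (simp add: rapid_def continuous_on_eq_continuous_at)
    then have "(F \<longlongrightarrow> F a) (at_left a)"
      using isContD tendsto_within_subset by blast
    then show "((F \<circ> real_of_ereal) \<longlongrightarrow> F a) (at_left (ereal a))"
      by (simp add: ereal_tendsto_simps)
    show "isCont F' x" for x
      using F' by (simp add: rapid_def continuous_on_eq_continuous_at)
  qed (use d si in auto)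
  then have "F a = (LBINT x:einterval (-\<infinity>) a. F' x)"
    by (simp add: interval_lebesgue_integral_def)
  also have "cmod \<dots> \<le> (LBINT x. norm (indicator (einterval (-\<infinity>) a) x *\<^sub>R F' x))"
    unfolding set_lebesgue_integral_def by (rule integral_norm_bound)
  also have "\<dots> \<le> (LBINT x. cmod (F' x))"
  proof (rule integral_mono)
    show "integrable lborel (\<lambda>x. norm (indicator (einterval (-\<infinity>) a) x *\<^sub>R F' x))"
      using si unfolding set_integrable_def by (rule integrable_norm)
    show "integrable lborel (\<lambda>x. norm (F' x))" using int by (rule integrable_norm)
  qed (simp add: indicator_def)
  finally show ?thesis .
qed

lemma power_le_fact_exp:
  fixes y :: real
  assumes "y \<ge> 0"
  shows "y ^ k \<le> fact k * exp y"
proof -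
  have "(\<Sum>n\<in>{k}. y ^ n /\<^sub>R fact n) \<le> (\<Sum>n. y ^ n /\<^sub>R fact n)"
    using assms by (intro sum_le_suminf summable_exp_generic) auto
  then show ?thesis by (simp add: exp_def field_simps)
qed

lemma rapid_gaussian: "rapid (\<lambda>x. of_real (exp (- x\<^sup>2 / 2)))"
  unfolding rapid_def
proof safe
  show "continuous_on UNIV (\<lambda>x. complex_of_real (exp (- x\<^sup>2 / 2)))"
    by (intro continuous_intros) auto
  fix k
  have "cmod (of_real (exp (- x\<^sup>2 / 2))) * \<bar>x\<bar> ^ k \<le> 1 + 2 ^ k * fact k" for x :: real
  proof -
    \<comment> \<open>The even power allows \<open>power_le_fact_exp\<close> at
      \<open>x\<^sup>2 / 2\<close>, whose exponential cancels the Gaussian.\<close>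
    have "\<bar>x\<bar> ^ k \<le> 1 + (x\<^sup>2) ^ k"
    proof (cases "\<bar>x\<bar> \<le> 1")
      case True
      then have "\<bar>x\<bar> ^ k \<le> 1" by (simp add: power_le_one)
      then show ?thesis by (simp add: add_increasing2)
    next
      case False
      then have "\<bar>x\<bar> ^ k \<le> \<bar>x\<bar> ^ (2 * k)" by (intro power_increasing) auto
      then show ?thesis by (simp add: power_mult)
    qed
    then have "exp (- x\<^sup>2 / 2) * \<bar>x\<bar> ^ k \<le> exp (- x\<^sup>2 / 2) * (1 + 2 ^ k * (x\<^sup>2 / 2) ^ k)"
      by (simp add: power_divide)
    also have "\<dots> \<le> exp (- x\<^sup>2 / 2) * (1 + 2 ^ k * (fact k * exp (x\<^sup>2 / 2)))"
      by (intro mult_left_mono add_left_mono power_le_fact_exp) auto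
    also have "\<dots> = exp (- x\<^sup>2 / 2) + 2 ^ k * fact k * (exp (- x\<^sup>2 / 2) * exp (x\<^sup>2 / 2))"
      by (simp add: algebra_simps)
    also have "exp (- x\<^sup>2 / 2) * exp (x\<^sup>2 / 2) = 1" by (simp flip: exp_add)
    finally show ?thesis by (smt (verit) norm_of_real exp_le_one_iff abs_exp_cancel divide_nonpos_nonneg mult_1_right zero_le_power2)
  qed
  then show "\<exists>B. \<forall>x. cmod (of_real (exp (- x\<^sup>2 / 2))) * \<bar>x\<bar> ^ k \<le> B" by blast
qed

section \<open>Ladder relations and orthonormality of the Hermite functions\<close>

definition hermite_norm :: "nat \<Rightarrow> real" where
  "hermite_norm n = sqrt (2 ^ n * fact n * sqrt pi)"

lemma hermite_norm_pos: "hermite_norm n > 0"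
  by (simp add: hermite_norm_def)

lemma hermite_norm_Suc: "hermite_norm (Suc n) = sqrt (2 * (real n + 1)) * hermite_norm n"
  by (simp add: hermite_norm_def real_sqrt_mult[symmetric] algebra_simps)

lemma hermite_fun_eq: "hermite_fun n x = hermite_poly n x * exp (- x\<^sup>2 / 2) / hermite_norm n"
  by (simp add: hermite_fun_def hermite_norm_def)

abbreviation hermite_c :: "nat \<Rightarrow> real \<Rightarrow> complex" where
  "hermite_c n \<equiv> \<lambda>x. of_real (hermite_fun n x)"

lemma rapid_hermite: "rapid (hermite_c n)"
proof -
  have "rapid (\<lambda>x. of_real (hermite_poly n x * exp (- x\<^sup>2 / 2)))"
  proof (induction n rule: induct_nat_012)
    case 0
    then show ?case using rapid_gaussian by simp
  next
    case 1
    then show ?case using rapid_cmult[OF rapid_x_mult[OF rapid_gaussian], of 2]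
      by (simp add: mult_ac)
  next
    case (ge2 n)
    show ?case
      using rapid_diff[OF rapid_cmult[OF rapid_x_mult[OF ge2(2)], of 2]
          rapid_cmult[OF ge2(1), of "2 * of_nat (Suc n)"]]
      by (simp add: algebra_simps)
  qed
  from rapid_cmult[OF this, of "of_real (1 / hermite_norm n)"] show ?thesis
    by (simp add: hermite_fun_eq)
qed

text \<open>\<open>hdown n\<close> and \<open>hup n\<close> are the images of
  \<open>hermite_fun n\<close> under \<open>x + d/dx\<close> and \<open>x - d/dx\<close>. For
  \<open>n = 0\<close> the truncated index \<open>n - 1\<close> is harmless, since its coefficient
  is zero.\<close>

abbreviation hdown :: "nat \<Rightarrow> real \<Rightarrow> real" where
  "hdown n x \<equiv> sqrt (2 * real n) * hermite_fun (n - 1) x"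

abbreviation hup :: "nat \<Rightarrow> real \<Rightarrow> real" where
  "hup n x \<equiv> sqrt (2 * (real n + 1)) * hermite_fun (Suc n) x"

lemma hermite_up:
  "hup n x =
    hermite_poly (Suc n) x * exp (- x\<^sup>2 / 2) / hermite_norm n"
proof -
  have c: "s * (a / (s * b)) = a / b" if "s \<noteq> 0" for s a b :: real using that by simp
  show ?thesis unfolding hermite_fun_eq hermite_norm_Suc by (rule c) simp
qed

lemma hermite_down:
  "hdown n x =
    2 * real n * hermite_poly (n - 1) x * exp (- x\<^sup>2 / 2) / hermite_norm n"
proof (cases n)
  case (Suc m)
  have c: "s * (a / b) = s * s * a / (s * b)" if "s \<noteq> 0" for s a b :: real using that by simp
  have "sqrt (2 * (real m + 1)) * hermite_fun m x
      = sqrt (2 * (real m + 1)) * sqrt (2 * (real m + 1)) * (hermite_poly m x * exp (- x\<^sup>2 / 2))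
        / (sqrt (2 * (real m + 1)) * hermite_norm m)"
    unfolding hermite_fun_eq by (rule c) simp
  then show ?thesis
    by (simp add: Suc hermite_norm_Suc mult.assoc add.commute)
qed simp

lemma hermite_poly_x: "2 * x * hermite_poly n x = hermite_poly (Suc n) x + 2 * real n * hermite_poly (n - 1) x"
  by (cases n) auto

lemma hermite_fun_x:
  "x * hermite_fun n x =
    (hdown n x + hup n x) / 2"
proof -
  have "x * hermite_fun n x = (2 * x * hermite_poly n x) * exp (- x\<^sup>2 / 2) / hermite_norm n / 2"
    by (simp add: hermite_fun_eq)
  then show ?thesis
    unfolding hermite_up hermite_down hermite_poly_x by (simp add: add_divide_distrib ring_distribs)
qed

lemma hermite_fun_deriv:
  "(hermite_fun n has_field_derivative
    (hdown n x - hup n x) / 2) (at x)"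
proof -
  have E: "((\<lambda>x. exp (- x\<^sup>2 / 2)) has_field_derivative - x * exp (- x\<^sup>2 / 2)) (at x)"
    by (auto intro!: derivative_eq_intros)
  have "((\<lambda>x. hermite_poly n x * exp (- x\<^sup>2 / 2) / hermite_norm n) has_field_derivative
      (2 * real n * hermite_poly (n - 1) x * exp (- x\<^sup>2 / 2) + (- x * exp (- x\<^sup>2 / 2)) * hermite_poly n x)
      / hermite_norm n) (at x)"
    by (intro DERIV_cdivide DERIV_mult hermite_poly_deriv E)
  moreover have "(2 * real n * hermite_poly (n - 1) x * exp (- x\<^sup>2 / 2) + (- x * exp (- x\<^sup>2 / 2)) * hermite_poly n x)
      / hermite_norm n = hdown n x - x * hermite_fun n x"
    unfolding hermite_down by (simp add: hermite_fun_eq diff_divide_distrib mult_ac)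
  moreover have "(\<lambda>x. hermite_poly n x * exp (- x\<^sup>2 / 2) / hermite_norm n) = hermite_fun n"
    by (simp add: hermite_fun_eq fun_eq_iff)
  moreover have "hdown n x - x * hermite_fun n x =
      (hdown n x - hup n x) / 2"
    unfolding hermite_fun_x by (simp add: field_simps)
  ultimately show ?thesis by (simp only:)
qed

lemma hermite_fun_reflect: "hermite_fun n (- x) = (- 1) ^ n * hermite_fun n x"
proof -
  have "hermite_poly n (- x) = (- 1) ^ n * hermite_poly n x"
    by (induction n rule: induct_nat_012) (auto simp: algebra_simps)
  then show ?thesis by (simp add: hermite_fun_eq)
qed

abbreviation cdown :: "nat \<Rightarrow> real \<Rightarrow> complex" where
  "cdown n x \<equiv> of_real (sqrt (2 * real n)) * hermite_c (n - 1) x"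

abbreviation cup :: "nat \<Rightarrow> real \<Rightarrow> complex" where
  "cup n x \<equiv> of_real (sqrt (2 * (real n + 1))) * hermite_c (Suc n) x"

lemma hermite_c_deriv:
  "(hermite_c n has_vector_derivative
    (cdown n x - cup n x) / 2) (at x)"
  using has_vector_derivative_of_real[OF hermite_fun_deriv[of n x], where ?'a = complex] by simp

text \<open>The operators \<open>x + d/dx\<close> and \<open>x - d/dx\<close> are adjoint, which
  relates the integral for \<open>(m, Suc n)\<close> to the one for \<open>(m - 1, n)\<close>; the
  descent ends at the Gaussian integral.\<close>

lemma hermite_orthonormal: "(LBINT x. hermite_fun m x * hermite_fun n x) = (if m = n then 1 else 0)"
proof -
  define I where "I = (\<lambda>m n. LBINT x. hermite_fun m x * hermite_fun n x)"
  have r: "rapid (\<lambda>x. hermite_c m x * hermite_c n x)" for m n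
    by (intro rapid_mult rapid_hermite)
  have int: "integrable lborel (\<lambda>x. hermite_fun m x * hermite_fun n x)" for m n
    using rapid_integrable[OF r, of m n] by (simp flip: of_real_mult add: complex_of_real_integrable_eq)
  have step: "sqrt (2 * (real n + 1)) * I m (Suc n) = sqrt (2 * real m) * I (m - 1) n" for m n
  proof -
    let ?F' = "\<lambda>x. sqrt (2 * real m) * (hermite_fun (m - 1) x * hermite_fun n x)
        - sqrt (2 * (real n + 1)) * (hermite_fun m x * hermite_fun (Suc n) x)"
    have "(LBINT x. complex_of_real (?F' x)) = 0"
    proof (rule rapid_FTC[OF r[of m n]])
      show "rapid (\<lambda>x. complex_of_real (?F' x))"
        by (simp only: of_real_diff of_real_mult) (intro rapid_diff rapid_cmult rapid_mult rapid_hermite)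
      fix x
      have "((\<lambda>x. hermite_fun m x * hermite_fun n x) has_field_derivative ?F' x) (at x)"
      proof (rule DERIV_cong[OF DERIV_mult[OF hermite_fun_deriv hermite_fun_deriv]])
        define a b c d where "a = hdown m x"
          and "b = hup m x"
          and "c = hdown n x"
          and "d = hup n x"
        have "x * hermite_fun m x = (a + b) / 2" "x * hermite_fun n x = (c + d) / 2"
          unfolding a_def b_def c_def d_def by (rule hermite_fun_x)+
        \<comment> \<open>Expressing the raised \<open>m\<close> term and the lowered
          \<open>n\<close> term through \<open>x\<close> makes the two copies of \<open>x\<close>
          times the product cancel and leaves one lowering and one raising.\<close>
        then have b: "b = 2 * x * hermite_fun m x - a" and c: "c = 2 * x * hermite_fun n x - d" by auto
        have "(a - b) / 2 * hermite_fun n x + (c - d) / 2 * hermite_fun m x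
            = a * hermite_fun n x - hermite_fun m x * d"
          unfolding b c by (simp add: field_simps)
        then show "(hdown m x - hup m x) / 2
            * hermite_fun n x
          + (hdown n x - hup n x) / 2
            * hermite_fun m x = ?F' x"
          unfolding a_def b_def c_def d_def by (simp add: mult_ac)
      qed
      from has_vector_derivative_of_real[OF this, where ?'a = complex]
      show "((\<lambda>x. hermite_c m x * hermite_c n x) has_vector_derivative complex_of_real (?F' x)) (at x)"
        by simp
    qed
    then have "(LBINT x. ?F' x) = 0" by (simp only: integral_complex_of_real of_real_eq_0_iff)
    then show ?thesis by (simp add: I_def int Bochner_Integration.integral_diff)
  qed
  have sym: "I m n = I n m" for m n by (simp add: I_def mult.commute)
  have "I 0 0 = 1"
  proof -
    have e: "hermite_fun 0 x * hermite_fun 0 x = exp (- x\<^sup>2) / sqrt pi" for x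
    proof -
      have "exp (- x\<^sup>2 / 2) * exp (- x\<^sup>2 / 2) = exp (- x\<^sup>2)" by (simp flip: exp_add)
      then show ?thesis by (simp add: hermite_fun_def)
    qed
    have "has_bochner_integral lborel (\<lambda>x::real. exp (- x\<^sup>2)) (2 *\<^sub>R (sqrt pi / 2))"
      by (rule has_bochner_integral_even_function[OF gaussian_moment_0]) simp
    then have "(LBINT x::real. exp (- x\<^sup>2)) = sqrt pi"
      by (simp add: has_bochner_integral_integral_eq)
    then show ?thesis by (simp add: I_def e)
  qed
  have "I m n = (if m = n then 1 else 0)" for m n
  proof (induction n arbitrary: m)
    case 0
    have "sqrt (2 * (real m + 1)) * I 0 (Suc m) = 0" for m using step[of m 0] by simp
    then have "I 0 (Suc m) = 0" for m by (metis mult_eq_0_iff real_sqrt_eq_zero_cancel_iff of_nat_Suc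
        of_nat_eq_0_iff nat.distinct(2) zero_neq_numeral add.commute)
    then show ?case using \<open>I 0 0 = 1\<close> sym by (cases m) auto
  next
    case (Suc n)
    have s: "sqrt (2 * (real n + 1)) \<noteq> 0" by simp
    show ?case
    proof (cases m)
      case 0
      then show ?thesis using step[of n 0] s by simp
    next
      case (Suc k)
      have "sqrt (2 * (real n + 1)) * I m (Suc n) = sqrt (2 * (real k + 1)) * (if k = n then 1 else 0)"
        using step[of n m] Suc.IH[of k] by (simp add: Suc add.commute)
      then show ?thesis using s Suc by (cases "k = n") simp_all
    qed
  qed
  then show ?thesis by (simp add: I_def)
qed

section \<open>Hermite functions as Schwartz test functions\<close>

inductive hermite_span :: "(real \<Rightarrow> real) \<Rightarrow> bool" where
  hermite: "hermite_span (hermite_fun n)"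
| lin: "hermite_span f \<Longrightarrow> hermite_span g \<Longrightarrow> hermite_span (\<lambda>x. a * f x + b * g x)"

text \<open>The ladder relations keep derivatives inside the span, so decay of all derivatives
  reduces to decay of the Hermite functions themselves.\<close>

lemma hermite_span_deriv:
  "hermite_span f \<Longrightarrow> \<exists>f'. hermite_span f' \<and> (\<forall>x. (f has_field_derivative f' x) (at x))"
proof (induction rule: hermite_span.induct)
  case (hermite n)
  show ?case
  proof (intro exI conjI allI)
    fix x
    show "(hermite_fun n has_field_derivative
        (sqrt (2 * real n) / 2) * hermite_fun (n - 1) x + (- sqrt (2 * (real n + 1)) / 2) * hermite_fun (Suc n) x) (at x)"
      using hermite_fun_deriv[of n x] by (simp add: diff_divide_distrib)
  qed (intro hermite_span.intros)
next
  case (lin f g a b)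
  then obtain f' g' where "hermite_span f'" "hermite_span g'"
    "\<And>x. (f has_field_derivative f' x) (at x)" "\<And>x. (g has_field_derivative g' x) (at x)"
    by blast
  then show ?case
    by (intro exI[of _ "\<lambda>x. a * f' x + b * g' x"])
      (auto intro!: hermite_span.intros derivative_eq_intros)
qed

lemma hermite_span_rapid: "hermite_span f \<Longrightarrow> rapid (\<lambda>x. of_real (f x))"
proof (induction rule: hermite_span.induct)
  case (lin f g a b)
  then show ?case by (simp add: rapid_add rapid_cmult)
qed (rule rapid_hermite)

text \<open>Licenses the Hermite functions as test functions in \<open>nls_solution\<close>.\<close>

lemma schwartz_hermite: "schwartz (hermite_fun n)"
proof -
  have s: "hermite_span ((deriv ^^ j) (hermite_fun n))" for j
  proof (induction j)
    case (Suc j)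
    then obtain f' where "hermite_span f'"
      "\<And>x. ((deriv ^^ j) (hermite_fun n) has_field_derivative f' x) (at x)"
      using hermite_span_deriv by blast
    moreover from this have "deriv ((deriv ^^ j) (hermite_fun n)) = f'"
      by (auto intro: DERIV_imp_deriv)
    ultimately show ?case by simp
  qed (simp add: hermite_span.intros)
  show ?thesis
    unfolding schwartz_def
  proof (intro conjI allI)
    fix j x
    show "(deriv ^^ j) (hermite_fun n) differentiable at x"
      using hermite_span_deriv[OF s[of j]] by (auto simp: real_differentiable_def)
  next
    fix m j
    obtain B where "\<And>x. cmod (of_real ((deriv ^^ j) (hermite_fun n) x)) * \<bar>x\<bar> ^ m \<le> B"
      using rapidE[OF hermite_span_rapid[OF s[of j]]] by metis
    then have "norm (x ^ m * (deriv ^^ j) (hermite_fun n) x) \<le> B" for x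
      by (simp add: abs_mult power_abs mult.commute)
    then show "bounded (range (\<lambda>x. x ^ m * (deriv ^^ j) (hermite_fun n) x))"
      unfolding bounded_iff by blast
  qed
qed

section \<open>Completeness of the Hermite functions\<close>

lemma sq_int_mult_real:
  assumes "sq_int (\<lambda>x. of_real (f x))" and "sq_int (\<lambda>x. of_real (g x))"
  shows "integrable lborel (\<lambda>x. f x * g x :: real)"
  using sq_int_mult[OF assms] by (simp flip: of_real_mult add: complex_of_real_integrable_eq)

lemma sq_int_gaussian: "sq_int (\<lambda>x. of_real (exp (- x\<^sup>2 / 4)))"
proof -
  have "(exp (- x\<^sup>2 / 4))\<^sup>2 = exp (- x\<^sup>2 / 2)" for x :: real
    by (simp add: power2_eq_square flip: exp_add)
  then show ?thesis
    using rapid_integrable[OF rapid_gaussian] by (simp add: sq_int_def complex_of_real_integrable_eq)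
qed

text \<open>Integrability against every \<open>exp (c * \<bar>x\<bar>)\<close> lets the exponential
  series be integrated term by term, so vanishing moments force a vanishing Fourier transform.
  Injectivity of the transform comes from Levy's uniqueness theorem.\<close>

lemma integrable_eq_0_of_moments:
  fixes h :: "real \<Rightarrow> real"
  assumes hm: "h \<in> borel_measurable borel"
    and dom: "\<And>c. integrable lborel (\<lambda>x. exp (c * \<bar>x\<bar>) * h x)"
    and mom: "\<And>j. (LBINT x. x ^ j * h x) = 0"
  shows "AE x in lborel. h x = 0"
proof -
  note [measurable] = hm
  have h_int: "integrable lborel h" using dom[of 0] by simp
  have mom_int: "integrable lborel (\<lambda>x. x ^ j * h x)" for j
  proof (rule Bochner_Integration.integrable_bound)
    show "integrable lborel (\<lambda>x. fact j * (exp (1 * \<bar>x\<bar>) * h x))" by (intro integrable_mult_right dom)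
    show "AE x in lborel. norm (x ^ j * h x) \<le> norm (fact j * (exp (1 * \<bar>x\<bar>) * h x))"
      using power_le_fact_exp[of "\<bar>x\<bar>" j for x]
      by (auto simp: abs_mult power_abs mult.assoc[symmetric] intro!: mult_right_mono)
  qed simp
  have fourier: "(LBINT x. iexp (t * x) * of_real (h x)) = 0" for t
  proof -
    let ?s = "\<lambda>N x. (\<Sum>j<N. (\<i> * of_real (t * x)) ^ j /\<^sub>R fact j) * of_real (h x)"
    have "(\<lambda>N. LBINT x. ?s N x) \<longlonglongrightarrow> (LBINT x. iexp (t * x) * of_real (h x))"
    proof (rule integral_dominated_convergence)
      show "integrable lborel (\<lambda>x. norm (exp (\<bar>t\<bar> * \<bar>x\<bar>) * h x))" by (intro integrable_norm dom)
      show "AE x in lborel. (\<lambda>N. ?s N x) \<longlonglongrightarrow> iexp (t * x) * of_real (h x)"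
        using exp_converges by (intro AE_I2 tendsto_intros) (auto simp: sums_def)
      show "AE x in lborel. cmod (?s N x) \<le> norm (exp (\<bar>t\<bar> * \<bar>x\<bar>) * h x)" for N
      proof (rule AE_I2)
        fix x
        have "cmod (\<Sum>j<N. (\<i> * of_real (t * x)) ^ j /\<^sub>R fact j) \<le> (\<Sum>j<N. \<bar>t * x\<bar> ^ j /\<^sub>R fact j)"
          by (rule order_trans[OF norm_sum]) (simp add: norm_power norm_mult abs_mult)
        also have "\<dots> \<le> exp \<bar>t * x\<bar>"
          unfolding exp_def by (intro sum_le_suminf summable_exp_generic) auto
        finally show "cmod (?s N x) \<le> norm (exp (\<bar>t\<bar> * \<bar>x\<bar>) * h x)"
          by (simp add: norm_mult abs_mult mult_right_mono)
      qed
    qed measurable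
    moreover have "(LBINT x. ?s N x) = 0" for N
    proof -
      have eq: "?s N x = (\<Sum>j<N. ((\<i> * of_real t) ^ j / fact j) * of_real (x ^ j * h x))" for x
        unfolding sum_distrib_right
        by (intro sum.cong refl) (simp add: power_mult_distrib scaleR_conv_of_real field_simps)
      have "(LBINT x. ?s N x) = (\<Sum>j<N. LBINT x. ((\<i> * of_real t) ^ j / fact j) * of_real (x ^ j * h x))"
        unfolding eq
        by (intro Bochner_Integration.integral_sum integrable_mult_right integrable_of_real mom_int)
      also have "\<dots> = 0"
        by (simp only: integral_mult_right_zero integral_complex_of_real mom) simp
      finally show ?thesis .
    qed
    ultimately show ?thesis using LIMSEQ_unique[OF _ tendsto_const] by auto
  qed
  \<comment> \<open>Levy's theorem speaks of probability measures, hence positive and negative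
    parts. Their masses agree because the moment of order 0 vanishes, so one constant
    \<open>m\<close> normalises both.\<close>
  define p q where "p = (\<lambda>x. max (h x) 0)" and "q = (\<lambda>x. max (- h x) 0)"
  have pq: "h x = p x - q x" "p x \<ge> 0" "q x \<ge> 0" for x by (auto simp: p_def q_def)
  have [measurable]: "p \<in> borel_measurable borel" "q \<in> borel_measurable borel"
    unfolding p_def q_def by measurable
  have int: "integrable lborel p" "integrable lborel q"
    unfolding p_def q_def using h_int by (auto intro!: integrable_max)
  define m where "m = (LBINT x. p x)"
  have mq: "(LBINT x. q x) = m"
  proof -
    have "(LBINT x. p x - q x) = 0" using mom[of 0] by (simp add: pq(1))
    then show ?thesis using int by (simp add: m_def Bochner_Integration.integral_diff)
  qed
  show ?thesis
  proof (cases "m = 0")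
    case True
    have "AE x in lborel. p x = 0" "AE x in lborel. q x = 0"
      using integral_nonneg_eq_0_iff_AE[of lborel p] integral_nonneg_eq_0_iff_AE[of lborel q]
        int pq m_def mq True by auto
    then show ?thesis by eventually_elim (simp add: pq)
  next
    case False
    have "m \<ge> 0" unfolding m_def by (intro integral_nonneg_AE) (simp add: pq)
    with False have m: "m > 0" by simp
    let ?M = "\<lambda>g. density lborel (\<lambda>x. ennreal (g x / m))"
    have distr: "real_distribution (?M g)"
      if g: "g \<in> borel_measurable borel" "integrable lborel g" "\<And>x. g x \<ge> 0" "(LBINT x. g x) = m" for g
    proof -
      have "(\<integral>\<^sup>+x. ennreal (g x / m) \<partial>lborel) = ennreal (LBINT x. g x / m)"
        by (rule nn_integral_eq_integral) (use g m in auto)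
      also have "\<dots> = 1" using g m by simp
      finally have "prob_space (?M g)"
        by (intro prob_spaceI) (use g in \<open>simp add: emeasure_density\<close>)
      then show ?thesis by (intro real_distribution.intro real_distribution_axioms.intro) simp_all
    qed
    have char: "char (?M g) t = (LBINT x. of_real (g x / m) * iexp (t * x))"
      if g: "g \<in> borel_measurable borel" "\<And>x. g x \<ge> 0" for g t
      unfolding char_def
      by (subst integral_density) (use g m in \<open>auto simp: scaleR_conv_of_real\<close>)
    have gi: "integrable lborel (\<lambda>x. of_real (g x / m) * iexp (t * x))" if g: "integrable lborel g" for g t
    proof (rule Bochner_Integration.integrable_bound)
      show "integrable lborel (\<lambda>x. g x / m)" using g by simp
      show "(\<lambda>x. of_real (g x / m) * iexp (t * x)) \<in> borel_measurable lborel"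
        using borel_measurable_integrable[OF g] by measurable
      show "AE x in lborel. cmod (of_real (g x / m) * iexp (t * x)) \<le> norm (g x / m)"
        by (intro AE_I2) (simp add: norm_mult norm_divide)
    qed
    have "?M p = ?M q"
    proof (rule Levy_uniqueness)
      show "char (?M p) = char (?M q)"
      proof
        fix t
        have "(LBINT x. of_real (p x / m) * iexp (t * x)) - (LBINT x. of_real (q x / m) * iexp (t * x))
            = (LBINT x. of_real (p x / m) * iexp (t * x) - of_real (q x / m) * iexp (t * x))"
          by (intro Bochner_Integration.integral_diff[symmetric] gi int)
        also have "\<dots> = (LBINT x. of_real (1 / m) * (iexp (t * x) * of_real (h x)))"
          by (intro Bochner_Integration.integral_cong) (simp_all add: pq(1) ring_distribs diff_divide_distrib mult_ac)
        also have "\<dots> = 0" by (simp only: integral_mult_right_zero fourier) simp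
        finally show "char (?M p) t
            = char (?M q) t"
          by (simp add: char pq)
      qed
    qed (use distr int mq m_def pq in simp_all)
    then have "AE x in lborel. ennreal (p x / m) = ennreal (q x / m)"
      by (subst (asm) sigma_finite_measure.density_unique_iff[OF sigma_finite_lborel]) simp_all
    then show ?thesis
    proof eventually_elim
      case (elim x)
      then have "p x = q x" using m pq[of x] by simp
      then show ?case by (simp add: pq(1))
    qed
  qed
qed

lemma hermite_complete_real:
  fixes u :: "real \<Rightarrow> real"
  assumes u: "sq_int (\<lambda>x. of_real (u x))" and 0: "\<And>n. (LBINT x. u x * hermite_fun n x) = 0"
  shows "AE x in lborel. u x = 0"
proof -
  have um: "u \<in> borel_measurable borel"
    using sq_int_measurable[OF u] by (simp add: borel_measurable_complex_iff)
  have int: "integrable lborel (\<lambda>x. u x * (x ^ j * hermite_fun n x))" for j n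
  proof -
    have "rapid (\<lambda>x. of_real (x ^ j * hermite_fun n x))"
    proof (induction j)
      case (Suc j)
      then show ?case using rapid_x_mult[OF Suc] by (simp add: mult.assoc)
    qed (simp add: rapid_hermite)
    then show ?thesis by (intro sq_int_mult_real u rapid_sq_int)
  qed
  \<comment> \<open>Multiplication by \<open>x\<close> combines raising and lowering, so
    orthogonality to all Hermite functions survives it; \<open>n = 0\<close> then gives all moments
    against the Gaussian.\<close>
  have z: "(LBINT x. u x * (x ^ j * hermite_fun n x)) = 0" for j n
  proof (induction j arbitrary: n)
    case (Suc j)
    have "u x * (x ^ Suc j * hermite_fun n x)
        = sqrt (2 * real n) / 2 * (u x * (x ^ j * hermite_fun (n - 1) x))
          + sqrt (2 * (real n + 1)) / 2 * (u x * (x ^ j * hermite_fun (Suc n) x))" for x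
    proof -
      have "u x * (x ^ Suc j * hermite_fun n x) = u x * x ^ j * (x * hermite_fun n x)" by simp
      then show ?thesis unfolding hermite_fun_x by (simp add: add_divide_distrib ring_distribs mult_ac)
    qed
    then show ?case using Suc int by simp
  qed (simp add: 0)
  have "AE x in lborel. u x * exp (- x\<^sup>2 / 2) = 0"
  proof (rule integrable_eq_0_of_moments)
    show "(\<lambda>x. u x * exp (- x\<^sup>2 / 2)) \<in> borel_measurable borel" using um by measurable
    show "(LBINT x. x ^ j * (u x * exp (- x\<^sup>2 / 2))) = 0" for j
    proof -
      have "x ^ j * (u x * exp (- x\<^sup>2 / 2)) = hermite_norm 0 * (u x * (x ^ j * hermite_fun 0 x))" for x
        using hermite_norm_pos[of 0] by (simp add: hermite_fun_eq)
      then have "(LBINT x. x ^ j * (u x * exp (- x\<^sup>2 / 2)))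
          = (LBINT x. hermite_norm 0 * (u x * (x ^ j * hermite_fun 0 x)))"
        by (intro Bochner_Integration.integral_cong refl)
      then show ?thesis by (simp only: integral_mult_right_zero z mult_zero_right)
    qed
    fix c
    show "integrable lborel (\<lambda>x. exp (c * \<bar>x\<bar>) * (u x * exp (- x\<^sup>2 / 2)))"
    proof (rule Bochner_Integration.integrable_bound)
      show "integrable lborel (\<lambda>x. exp (c\<^sup>2) * (u x * exp (- x\<^sup>2 / 4)))"
        by (intro integrable_mult_right sq_int_mult_real u sq_int_gaussian)
      show "(\<lambda>x. exp (c * \<bar>x\<bar>) * (u x * exp (- x\<^sup>2 / 2))) \<in> borel_measurable lborel"
        using um by measurable
      have "norm (exp (c * \<bar>x\<bar>) * (u x * exp (- x\<^sup>2 / 2))) \<le> norm (exp (c\<^sup>2) * (u x * exp (- x\<^sup>2 / 4)))" for x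
      proof -
        \<comment> \<open>Completing the square spends half of the Gaussian on the exponential; the
          other half remains as a square-integrable partner for \<open>u\<close>.\<close>
        have "0 \<le> (c - \<bar>x\<bar> / 2)\<^sup>2" by simp
        then have "c * \<bar>x\<bar> + - x\<^sup>2 / 2 \<le> c\<^sup>2 + - x\<^sup>2 / 4"
          by (simp add: power2_eq_square algebra_simps)
        then have "exp (c * \<bar>x\<bar>) * exp (- x\<^sup>2 / 2) \<le> exp (c\<^sup>2) * exp (- x\<^sup>2 / 4)"
          by (simp only: exp_add[symmetric] exp_le_cancel_iff)
        from mult_left_mono[OF this, of "\<bar>u x\<bar>"] show ?thesis by (simp add: abs_mult mult_ac)
      qed
      then show "AE x in lborel. norm (exp (c * \<bar>x\<bar>) * (u x * exp (- x\<^sup>2 / 2)))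
          \<le> norm (exp (c\<^sup>2) * (u x * exp (- x\<^sup>2 / 4)))" by simp
    qed
  qed
  then show ?thesis by eventually_elim simp
qed

text \<open>Hermite functions are real, so the bilinear pairing splits into the real statements for
  the real and the imaginary part.\<close>

lemma hermite_complete:
  assumes 0: "\<And>n. pairing v (hermite_fun n) = 0"
  shows "v = 0"
proof -
  define f where "f = rep_L2 v"
  have f: "sq_int f" by (simp add: f_def sq_int_rep)
  have [measurable]: "f \<in> borel_measurable borel" using sq_int_measurable[OF f] by simp
  have bnd: "sq_int (\<lambda>x. complex_of_real (g (f x)))"
    if "\<And>z. \<bar>g z\<bar> \<le> cmod z" "g \<in> borel_measurable borel" for g
    by (rule sq_int_dominated[OF _ f, of _ 1]) (use that in simp_all)
  have int: "integrable lborel (\<lambda>x. f x * of_real (hermite_fun n x))" for n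
    by (rule sq_int_mult[OF f rapid_sq_int[OF rapid_hermite]])
  have zero: "(LBINT x. f x * of_real (hermite_fun n x)) = 0" for n
    using 0[of n] by (simp add: pairing_def f_def)
  have "(LBINT x. Re (f x) * hermite_fun n x) = 0" for n
    using integral_Re[OF int[of n]] zero[of n] by simp
  then have "AE x in lborel. Re (f x) = 0"
    by (intro hermite_complete_real bnd) (simp_all add: abs_Re_le_cmod)
  moreover have "(LBINT x. Im (f x) * hermite_fun n x) = 0" for n
    using integral_Im[OF int[of n]] zero[of n] by simp
  then have "AE x in lborel. Im (f x) = 0"
    by (intro hermite_complete_real bnd) (simp_all add: abs_Im_le_cmod)
  ultimately have "AE x in lborel. rep_L2 v x = rep_L2 0 x"
    using rep_0 by eventually_elim (simp add: f_def complex_eq_iff)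
  then show ?thesis by (rule L2_eqI)
qed

section \<open>Hermite coefficients and spectral calculus\<close>

definition hcoeff :: "L2 \<Rightarrow> nat \<Rightarrow> complex" where
  "hcoeff v n = pairing v (hermite_fun n)"

lemma sq_int_hermite: "sq_int (hermite_c n)"
  by (rule rapid_sq_int[OF rapid_hermite])

lemma bounded_linear_hcoeff: "bounded_linear (\<lambda>v. hcoeff v n)"
  unfolding hcoeff_def by (rule bounded_linear_pairing[OF sq_int_hermite])

lemma hcoeff_0 [simp]: "hcoeff 0 n = 0"
  using bounded_linear_hcoeff by (rule linear_simps)

lemma hcoeff_add [simp]: "hcoeff (v + w) n = hcoeff v n + hcoeff w n"
  using bounded_linear_hcoeff by (rule linear_simps)

lemma hcoeff_diff [simp]: "hcoeff (v - w) n = hcoeff v n - hcoeff w n"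
  using bounded_linear_hcoeff by (rule linear_simps)

lemma hcoeff_scaleR [simp]: "hcoeff (r *\<^sub>R v) n = r *\<^sub>R hcoeff v n"
  using bounded_linear_hcoeff by (rule linear_simps)

lemma hcoeff_sum: "hcoeff (\<Sum>i\<in>I. f i) n = (\<Sum>i\<in>I. hcoeff (f i) n)"
  by (induction I rule: infinite_finite_induct) simp_all

lemma hcoeff_scaleC [simp]: "hcoeff (c *\<^sub>C v) n = c * hcoeff v n"
  unfolding hcoeff_def by (rule pairing_scaleC[OF sq_int_hermite])

lemma hcoeff_L2_of: "sq_int f \<Longrightarrow> hcoeff (L2_of f) n = (LBINT x. f x * hermite_c n x)"
  unfolding hcoeff_def by (rule pairing_L2_of[OF _ sq_int_hermite])

text \<open>Completeness in its working form: from here on, identities between operators on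
  \<open>L2\<close> are checked mode by mode.\<close>

lemma hcoeff_eqI: "(\<And>n. hcoeff v n = hcoeff w n) \<Longrightarrow> v = w"
  using hermite_complete[of "v - w"] by (simp add: hcoeff_def[symmetric])

lemma hcoeff_hermite_L2: "hcoeff (hermite_L2 m) n = of_bool (m = n)"
proof -
  have "hcoeff (hermite_L2 m) n = (LBINT x. complex_of_real (hermite_fun m x * hermite_fun n x))"
    by (simp add: hermite_L2_def hcoeff_L2_of sq_int_hermite)
  then show ?thesis unfolding integral_complex_of_real hermite_orthonormal by simp
qed

text \<open>The inner product on \<open>L2\<close> is real, so a complex coefficient shows only
  through a real part; the choice \<open>c = hcoeff v n\<close> recovers its squared
  modulus.\<close>

lemma inner_scaleC_hermite: "v \<bullet> (c *\<^sub>C hermite_L2 n) = Re (hcoeff v n * cnj c)"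
proof -
  have "v \<bullet> (c *\<^sub>C hermite_L2 n) = L2_of (rep_L2 v) \<bullet> L2_of (\<lambda>x. c * hermite_c n x)"
    by (simp add: L2_of_rep L2_of_scaleC sq_int_hermite hermite_L2_def)
  also have "\<dots> = (LBINT x. Re (cnj c * (rep_L2 v x * hermite_c n x)))"
    by (subst inner_L2_of)
      (auto simp: sq_int_rep sq_int_cmult sq_int_hermite inner_complex_def algebra_simps)
  also have "\<dots> = Re (LBINT x. cnj c * (rep_L2 v x * hermite_c n x))"
    by (rule integral_Re) (intro integrable_mult_right sq_int_mult sq_int_rep sq_int_hermite)
  also have "\<dots> = Re (hcoeff v n * cnj c)"
    unfolding integral_mult_right_zero by (simp add: hcoeff_def pairing_def mult.commute)
  finally show ?thesis .
qed

section \<open>Bessel, Parseval and the Hermite expansion\<close>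

lemma norm_hermite_sum:
  assumes "finite F"
  shows "(norm (\<Sum>n\<in>F. a n *\<^sub>C hermite_L2 n))\<^sup>2 = (\<Sum>n\<in>F. (cmod (a n))\<^sup>2)"
proof -
  let ?x = "\<Sum>n\<in>F. a n *\<^sub>C hermite_L2 n"
  have c: "hcoeff ?x n = a n" if "n \<in> F" for n
    using assms that by (simp add: hcoeff_sum hcoeff_hermite_L2)
  have "(norm ?x)\<^sup>2 = (\<Sum>n\<in>F. ?x \<bullet> (a n *\<^sub>C hermite_L2 n))"
    by (simp add: power2_norm_eq_inner inner_sum_right)
  also have "\<dots> = (\<Sum>n\<in>F. (cmod (a n))\<^sup>2)"
    by (intro sum.cong refl) (simp add: inner_scaleC_hermite c complex_mult_cnj cmod_power2)
  finally show ?thesis .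
qed

lemma bessel:
  assumes "finite F"
  shows "(\<Sum>n\<in>F. (cmod (hcoeff v n))\<^sup>2) \<le> (norm v)\<^sup>2"
proof -
  let ?p = "\<Sum>n\<in>F. hcoeff v n *\<^sub>C hermite_L2 n"
  have p: "(norm ?p)\<^sup>2 = (\<Sum>n\<in>F. (cmod (hcoeff v n))\<^sup>2)" by (rule norm_hermite_sum[OF assms])
  have "v \<bullet> ?p = (\<Sum>n\<in>F. (cmod (hcoeff v n))\<^sup>2)"
    by (simp add: inner_sum_right inner_scaleC_hermite complex_mult_cnj cmod_power2)
  moreover have "0 \<le> (norm (v - ?p))\<^sup>2" by simp
  ultimately show ?thesis
    using p by (simp add: power2_norm_eq_inner inner_diff_left inner_diff_right inner_commute)
qed

lemma summable_hcoeff: "summable (\<lambda>n. (cmod (hcoeff v n))\<^sup>2)"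
  by (rule bounded_imp_summable[where B = "(norm v)\<^sup>2"]) (use bessel[of "{.._}" v] in auto)

lemma hcoeff_suminf:
  assumes "summable (\<lambda>n. a n *\<^sub>C hermite_L2 n)"
  shows "hcoeff (\<Sum>n. a n *\<^sub>C hermite_L2 n) k = a k"
proof -
  have "hcoeff (\<Sum>n. a n *\<^sub>C hermite_L2 n) k = (\<Sum>n. hcoeff (a n *\<^sub>C hermite_L2 n) k)"
    by (rule bounded_linear.suminf[OF bounded_linear_hcoeff assms])
  also have "\<dots> = (\<Sum>n\<in>{k}. hcoeff (a n *\<^sub>C hermite_L2 n) k)"
    by (rule suminf_finite) (auto simp: hcoeff_hermite_L2)
  finally show ?thesis by (simp add: hcoeff_hermite_L2)
qed

text \<open>Bridges the spectral domains, defined by convergence of vectors, to weighted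
  square-summability. One direction is Bessel for the sum, the other the Cauchy criterion with
  orthonormality.\<close>

lemma summable_hermite_iff:
  "summable (\<lambda>n. a n *\<^sub>C hermite_L2 n) \<longleftrightarrow> summable (\<lambda>n. (cmod (a n))\<^sup>2)"
proof
  assume s: "summable (\<lambda>n. a n *\<^sub>C hermite_L2 n)"
  show "summable (\<lambda>n. (cmod (a n))\<^sup>2)"
    using summable_hcoeff[of "\<Sum>n. a n *\<^sub>C hermite_L2 n"] by (simp add: hcoeff_suminf[OF s])
next
  assume s: "summable (\<lambda>n. (cmod (a n))\<^sup>2)"
  show "summable (\<lambda>n. a n *\<^sub>C hermite_L2 n)"
    unfolding summable_Cauchy
  proof (intro allI impI)
    fix e :: real assume "e > 0"
    then obtain N where N: "\<And>m n. m \<ge> N \<Longrightarrow> norm (\<Sum>k=m..<n. (cmod (a k))\<^sup>2) < e\<^sup>2"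
      using s unfolding summable_Cauchy by (meson zero_less_power)
    have "norm (\<Sum>k=m..<n. a k *\<^sub>C hermite_L2 k) < e" if "m \<ge> N" for m n
    proof -
      have "(norm (\<Sum>k=m..<n. a k *\<^sub>C hermite_L2 k))\<^sup>2 < e\<^sup>2"
        using N[OF that, of n] by (simp add: norm_hermite_sum sum_nonneg)
      then show ?thesis using \<open>e > 0\<close> by (simp add: power_less_imp_less_base)
    qed
    then show "\<exists>N. \<forall>m\<ge>N. \<forall>n. norm (\<Sum>k=m..<n. a k *\<^sub>C hermite_L2 k) < e" by blast
  qed
qed

lemma hermite_expansion: "(\<lambda>n. hcoeff v n *\<^sub>C hermite_L2 n) sums v"
proof -
  have "(\<Sum>n. hcoeff v n *\<^sub>C hermite_L2 n) = v"
    by (rule hcoeff_eqI) (simp add: hcoeff_suminf summable_hermite_iff summable_hcoeff)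
  then show ?thesis
    using summable_hermite_iff[of "hcoeff v"] summable_hcoeff[of v] by (simp add: sums_iff)
qed

lemma parseval: "(\<lambda>n. (cmod (hcoeff v n))\<^sup>2) sums (norm v)\<^sup>2"
proof -
  have "(\<lambda>N. (norm (\<Sum>n<N. hcoeff v n *\<^sub>C hermite_L2 n))\<^sup>2) \<longlonglongrightarrow> (norm v)\<^sup>2"
    using hermite_expansion[of v] unfolding sums_def by (intro tendsto_intros)
  then show ?thesis by (simp add: sums_def norm_hermite_sum)
qed

lemma spectral_term_eq: "spectral_term m v = (\<lambda>n. (m n * hcoeff v n) *\<^sub>C hermite_L2 n)"
  by (simp add: fun_eq_iff spectral_term_def hcoeff_def)

lemma spectral_domain_iff:
  "v \<in> spectral_domain m \<longleftrightarrow> summable (\<lambda>n. (cmod (m n * hcoeff v n))\<^sup>2)"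
  unfolding spectral_domain_def mem_Collect_eq summable_hermite_iff[symmetric]
  by (simp add: spectral_term_eq)

lemma hcoeff_spectral_op:
  assumes "v \<in> spectral_domain m"
  shows "hcoeff (spectral_op m v) n = m n * hcoeff v n"
  using hcoeff_suminf[of "\<lambda>n. m n * hcoeff v n" n] assms
  by (simp add: spectral_domain_def spectral_op_def spectral_term_eq)

lemma spectral_domain_bounded:
  assumes "\<And>n. cmod (m n) \<le> 1"
  shows "v \<in> spectral_domain m"
  unfolding spectral_domain_iff
proof (rule summable_comparison_test'[OF summable_hcoeff[of v]])
  fix n
  have "cmod (m n) * cmod (hcoeff v n) \<le> 1 * cmod (hcoeff v n)"
    by (intro mult_right_mono assms) simp
  then show "norm ((cmod (m n * hcoeff v n))\<^sup>2) \<le> (cmod (hcoeff v n))\<^sup>2"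
    by (simp add: norm_mult power_mono)
qed

subsection \<open>The propagator\<close>

lemma hcoeff_propagator [simp]:
  "hcoeff (propagator t v) n = exp (\<i> * of_real (t * (2 * real n + 1))) * hcoeff v n"
  unfolding propagator_def
  by (intro hcoeff_spectral_op spectral_domain_bounded) (simp del: of_real_mult)

lemma norm_propagator [simp]: "norm (propagator t v) = norm v"
proof (rule power2_eq_imp_eq)
  show "(norm (propagator t v))\<^sup>2 = (norm v)\<^sup>2"
    using parseval[of "propagator t v"] parseval[of v]
    by (simp add: norm_mult sums_unique2 del: of_real_mult)
qed simp_all

lemma propagator_diff: "propagator t (v - w) = propagator t v - propagator t w"
  by (rule hcoeff_eqI) (simp add: ring_distribs)

lemma propagator_propagator: "propagator s (propagator t v) = propagator (s + t) v"
proof (rule hcoeff_eqI)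
  fix n
  have "exp (\<i> * of_real (s * (2 * real n + 1))) * exp (\<i> * of_real (t * (2 * real n + 1)))
      = exp (\<i> * of_real ((s + t) * (2 * real n + 1)))"
    by (simp add: exp_add[symmetric] algebra_simps)
  then show "hcoeff (propagator s (propagator t v)) n = hcoeff (propagator (s + t) v) n"
    unfolding hcoeff_propagator by (simp only: mult.assoc[symmetric])
qed

lemma propagator_0 [simp]: "propagator 0 v = v"
  by (rule hcoeff_eqI) simp

text \<open>Finite Hermite sums move by explicit exponentials, and because every
  \<open>propagator t\<close> is an isometry they approximate the orbit of \<open>v\<close>
  uniformly in \<open>t\<close>.\<close>

lemma continuous_propagator: "continuous_on UNIV (\<lambda>t. propagator t v)"
proof (rule uniform_limit_theorem[OF always_eventually])
  let ?S = "\<lambda>N. \<Sum>n<N. hcoeff v n *\<^sub>C hermite_L2 n"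
  have eq: "propagator t (?S N)
      = (\<Sum>n<N. (exp (\<i> * of_real (t * (2 * real n + 1))) * hcoeff v n) *\<^sub>C hermite_L2 n)" for t N
  proof (rule hcoeff_eqI)
    fix k
    show "hcoeff (propagator t (?S N)) k
        = hcoeff (\<Sum>n<N. (exp (\<i> * of_real (t * (2 * real n + 1))) * hcoeff v n) *\<^sub>C hermite_L2 n) k"
      unfolding hcoeff_propagator hcoeff_sum hcoeff_scaleC sum_distrib_left
      by (intro sum.cong refl) (simp add: hcoeff_hermite_L2)
  qed
  show "\<forall>N. continuous_on UNIV (\<lambda>t. propagator t (?S N))"
    unfolding eq
    by (intro allI continuous_on_sum bounded_linear.continuous_on[OF bounded_linear_scaleC_left]
        continuous_intros)
  show "uniform_limit UNIV (\<lambda>N t. propagator t (?S N)) (\<lambda>t. propagator t v) sequentially"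
  proof (rule uniform_limitI)
    fix e :: real assume "e > 0"
    then have "\<forall>\<^sub>F N in sequentially. dist (?S N) v < e"
      using hermite_expansion[of v] unfolding sums_def by (rule tendstoD[rotated])
    then show "\<forall>\<^sub>F N in sequentially. \<forall>t\<in>UNIV. dist (propagator t (?S N)) (propagator t v) < e"
      by (simp add: dist_norm propagator_diff[symmetric])
  qed
qed simp

subsection \<open>Sobolev spaces\<close>

lemma cmod_sobolev_mult: "cmod (sobolev_mult s n) = (2 * real n + 1) powr (s / 2)"
  by (simp add: sobolev_mult_def)

lemma sobolev_mult_sq: "(cmod (sobolev_mult s n))\<^sup>2 = (2 * real n + 1) powr s"
  unfolding cmod_sobolev_mult power2_eq_square by (simp flip: powr_add)

lemma sobolev_iff: "v \<in> sobolev s \<longleftrightarrow> summable (\<lambda>n. (2 * real n + 1) powr s * (cmod (hcoeff v n))\<^sup>2)"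
  unfolding sobolev_def spectral_domain_iff norm_mult power_mult_distrib sobolev_mult_sq ..

definition sob_lift :: "real \<Rightarrow> L2 \<Rightarrow> L2" where "sob_lift s = spectral_op (sobolev_mult s)"

lemma hcoeff_sob_lift: "v \<in> sobolev s \<Longrightarrow> hcoeff (sob_lift s v) n = sobolev_mult s n * hcoeff v n"
  unfolding sob_lift_def by (rule hcoeff_spectral_op) (simp add: sobolev_def)

lemma sobolev_norm_lift: "sobolev_norm s v = norm (sob_lift s v)"
  by (simp add: sobolev_norm_def sob_lift_def)

lemma sobolev_norm_nonneg [simp]: "sobolev_norm s v \<ge> 0"
  by (simp add: sobolev_norm_def)

lemma sobolev_norm_sums:
  assumes "v \<in> sobolev s"
  shows "(\<lambda>n. (2 * real n + 1) powr s * (cmod (hcoeff v n))\<^sup>2) sums (sobolev_norm s v)\<^sup>2"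
  using parseval[of "sob_lift s v"] assms
  by (simp add: hcoeff_sob_lift norm_mult power_mult_distrib sobolev_mult_sq sobolev_norm_lift)

lemma sobolev_add:
  assumes "v \<in> sobolev s" "w \<in> sobolev s"
  shows "v + w \<in> sobolev s"
proof -
  have "summable (\<lambda>n. (cmod (hcoeff (sob_lift s v + sob_lift s w) n))\<^sup>2)" by (rule summable_hcoeff)
  then show ?thesis
    using assms by (simp add: hcoeff_sob_lift sobolev_def spectral_domain_iff ring_distribs)
qed

lemma sobolev_scaleC:
  assumes "v \<in> sobolev s"
  shows "c *\<^sub>C v \<in> sobolev s"
proof -
  have "summable (\<lambda>n. (cmod (hcoeff (c *\<^sub>C sob_lift s v) n))\<^sup>2)" by (rule summable_hcoeff)
  then show ?thesis
    using assms by (simp add: hcoeff_sob_lift sobolev_def spectral_domain_iff mult_ac)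
qed

lemma sobolev_diff: "v \<in> sobolev s \<Longrightarrow> w \<in> sobolev s \<Longrightarrow> v - w \<in> sobolev s"
  using sobolev_add[of v s "- 1 *\<^sub>C w"] sobolev_scaleC[of w s "- 1"] scaleC_of_real[of "- 1" w]
  by simp

text \<open>The norm sees only moduli of Hermite coefficients; this settles the propagator and
  conjugation at once.\<close>

lemma sobolev_cmod_eq:
  assumes "\<And>n. cmod (hcoeff w n) = cmod (hcoeff v n)" and "v \<in> sobolev s"
  shows "w \<in> sobolev s" "sobolev_norm s w = sobolev_norm s v"
proof -
  show w: "w \<in> sobolev s" using assms by (simp add: sobolev_iff)
  have "(sobolev_norm s w)\<^sup>2 = (sobolev_norm s v)\<^sup>2"
    using sums_unique2[OF sobolev_norm_sums[OF w]] sobolev_norm_sums[OF assms(2)] assms(1) by simp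
  then show "sobolev_norm s w = sobolev_norm s v" by (rule power2_eq_imp_eq) simp_all
qed

lemma sobolev_propagator:
  assumes "v \<in> sobolev s"
  shows "propagator t v \<in> sobolev s" "sobolev_norm s (propagator t v) = sobolev_norm s v"
  using sobolev_cmod_eq[OF _ assms, of "propagator t v"]
  by (simp_all add: norm_mult del: of_real_mult)

lemma sob_lift_add: "v \<in> sobolev s \<Longrightarrow> w \<in> sobolev s \<Longrightarrow> sob_lift s (v + w) = sob_lift s v + sob_lift s w"
  by (rule hcoeff_eqI) (simp add: hcoeff_sob_lift sobolev_add ring_distribs)

lemma sob_lift_diff: "v \<in> sobolev s \<Longrightarrow> w \<in> sobolev s \<Longrightarrow> sob_lift s (v - w) = sob_lift s v - sob_lift s w"
  by (rule hcoeff_eqI) (simp add: hcoeff_sob_lift sobolev_diff ring_distribs)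

lemma sob_lift_propagator: "v \<in> sobolev s \<Longrightarrow> sob_lift s (propagator t v) = propagator t (sob_lift s v)"
  by (rule hcoeff_eqI) (simp add: hcoeff_sob_lift sobolev_propagator mult_ac)

lemma sobolev_norm_triangle:
  "v \<in> sobolev s \<Longrightarrow> w \<in> sobolev s \<Longrightarrow> sobolev_norm s (v + w) \<le> sobolev_norm s v + sobolev_norm s w"
  by (simp add: sobolev_norm_lift sob_lift_add norm_triangle_ineq)

text \<open>The inverse of \<open>sob_lift s\<close>. For \<open>s \<ge> 0\<close> it is defined on
  all of \<open>L2\<close>, so it parametrises the Sobolev space, a mere set, by a Banach space
  type.\<close>

definition sob_drop :: "real \<Rightarrow> L2 \<Rightarrow> L2" where "sob_drop s = spectral_op (sobolev_mult (- s))"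

lemma sobolev_mult_inverse: "sobolev_mult s n * sobolev_mult (- s) n = 1"
  unfolding sobolev_mult_def of_real_mult[symmetric] by (simp flip: powr_add)

lemma hcoeff_sob_drop:
  assumes "s \<ge> 0"
  shows "hcoeff (sob_drop s y) n = sobolev_mult (- s) n * hcoeff y n"
  unfolding sob_drop_def
proof (intro hcoeff_spectral_op spectral_domain_bounded)
  fix n
  show "cmod (sobolev_mult (- s) n) \<le> 1"
    unfolding cmod_sobolev_mult using assms powr_mono[of "- s / 2" 0 "2 * real n + 1"] by simp
qed

lemma sob_drop_mem: "s \<ge> 0 \<Longrightarrow> sob_drop s y \<in> sobolev s"
  using summable_hcoeff[of y]
  by (simp add: sobolev_def spectral_domain_iff hcoeff_sob_drop mult.assoc[symmetric] sobolev_mult_inverse)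

lemma sob_lift_drop: "s \<ge> 0 \<Longrightarrow> sob_lift s (sob_drop s y) = y"
  by (rule hcoeff_eqI)
    (simp add: hcoeff_sob_lift sob_drop_mem hcoeff_sob_drop mult.assoc[symmetric] sobolev_mult_inverse)

lemma sob_drop_lift: "s \<ge> 0 \<Longrightarrow> v \<in> sobolev s \<Longrightarrow> sob_drop s (sob_lift s v) = v"
  by (rule hcoeff_eqI)
    (simp add: hcoeff_sob_lift hcoeff_sob_drop mult.assoc[symmetric] sobolev_mult_inverse
      mult.commute[of "sobolev_mult (- s) _"])

subsection \<open>Conjugation and reflection\<close>

definition conj_L2 :: "L2 \<Rightarrow> L2" where "conj_L2 v = L2_of (\<lambda>x. cnj (rep_L2 v x))"

definition reflect_L2 :: "L2 \<Rightarrow> L2" where "reflect_L2 v = L2_of (\<lambda>x. rep_L2 v (- x))"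

lemma rep_conj_L2: "AE x in lborel. rep_L2 (conj_L2 v) x = cnj (rep_L2 v x)"
  unfolding conj_L2_def by (rule rep_L2_of[OF sq_int_cnj[OF sq_int_rep]])

lemma hcoeff_conj_L2: "hcoeff (conj_L2 v) n = cnj (hcoeff v n)"
proof -
  have "hcoeff (conj_L2 v) n = (LBINT x. cnj (rep_L2 v x * hermite_c n x))"
    by (simp add: conj_L2_def hcoeff_L2_of sq_int_cnj sq_int_rep)
  also have "\<dots> = cnj (hcoeff v n)" by (simp only: Bochner_Integration.integral_cnj hcoeff_def pairing_def)
  finally show ?thesis .
qed

lemma sq_int_reflect:
  assumes "sq_int f"
  shows "sq_int (\<lambda>x. f (- x))"
proof -
  have "integrable lborel (\<lambda>x. (cmod (f (0 + - 1 * x)))\<^sup>2)"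
    by (rule lborel_integrable_real_affine) (use assms in \<open>auto simp: sq_int_def\<close>)
  moreover have "(\<lambda>x. f (- x)) \<in> borel_measurable borel"
    using sq_int_measurable[OF assms] by simp
  ultimately show ?thesis by (simp add: sq_int_def)
qed

lemma AE_reflect:
  assumes "AE x in lborel. P x"
  shows "AE x in lborel. P (- x :: real)"
proof (rule AE_distrD[of uminus lborel borel P])
  show "AE x in distr lborel borel uminus. P x" unfolding lborel_distr_uminus by (rule assms)
qed simp

lemma rep_reflect_L2: "AE x in lborel. rep_L2 (reflect_L2 v) x = rep_L2 v (- x)"
  unfolding reflect_L2_def by (rule rep_L2_of[OF sq_int_reflect[OF sq_int_rep]])

lemma hcoeff_reflect_L2: "hcoeff (reflect_L2 v) n = (- 1) ^ n * hcoeff v n"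
proof -
  have "hcoeff (reflect_L2 v) n = (LBINT x. rep_L2 v (- x) * hermite_c n x)"
    by (simp add: reflect_L2_def hcoeff_L2_of sq_int_reflect sq_int_rep)
  also have "\<dots> = (LBINT x. (- 1) ^ n * (rep_L2 v (0 + - 1 * x) * hermite_c n (0 + - 1 * x)))"
  proof (intro Bochner_Integration.integral_cong refl)
    fix x
    have "(- 1) ^ n * ((- 1) ^ n * z) = (z :: complex)" for z
      by (simp add: mult.assoc[symmetric] power_mult_distrib[symmetric])
    then show "rep_L2 v (- x) * hermite_c n x
        = (- 1) ^ n * (rep_L2 v (0 + - 1 * x) * hermite_c n (0 + - 1 * x))"
      by (simp add: hermite_fun_reflect mult_ac)
  qed
  also have "\<dots> = (- 1) ^ n * (LBINT x. rep_L2 v (0 + - 1 * x) * hermite_c n (0 + - 1 * x))"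
    by (rule integral_mult_right_zero)
  also have "(LBINT x. rep_L2 v (0 + - 1 * x) * hermite_c n (0 + - 1 * x)) = hcoeff v n"
    using lborel_integral_real_affine[of "- 1" "\<lambda>x. rep_L2 v x * hermite_c n x" 0]
    by (simp add: hcoeff_def pairing_def)
  finally show ?thesis .
qed

text \<open>All eigenvalues are odd: a quarter turn taken \<open>2 * n + 1\<close> times is
  \<open>\<i> * (- 1) ^ n\<close>, and \<open>(- 1) ^ n\<close> is the parity of the n-th Hermite
  function.\<close>

lemma propagator_half_pi: "propagator (pi / 2) v = \<i> *\<^sub>C reflect_L2 v"
proof (rule hcoeff_eqI)
  fix n
  have "exp (\<i> * of_real (pi / 2 * (2 * real n + 1))) = exp (of_nat n * (\<i> * of_real pi)) * exp (\<i> * of_real (pi / 2))"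
    by (simp flip: exp_add add: field_simps)
  also have "\<dots> = (- 1) ^ n * \<i>"
    by (simp only: exp_of_nat_mult exp_pi_i exp_pi_i' cis_conv_exp[symmetric] cis_pi_half cis_pi)
  finally show "hcoeff (propagator (pi / 2) v) n = hcoeff (\<i> *\<^sub>C reflect_L2 v) n"
    by (simp add: hcoeff_reflect_L2)
qed

section \<open>Products of finite Hermite sums\<close>

definition herm_sum :: "(nat \<Rightarrow> complex) \<Rightarrow> nat \<Rightarrow> real \<Rightarrow> complex" where
  "herm_sum a m x = (\<Sum>i<m. a i * hermite_c i x)"

definition ell2 :: "(nat \<Rightarrow> complex) \<Rightarrow> nat \<Rightarrow> real" where
  "ell2 a m = L2_set (\<lambda>i. cmod (a i)) {..<m}"

text \<open>The operators \<open>x + d/dx\<close> and \<open>x - d/dx\<close> in Hermite coefficients.\<close>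

definition lower :: "(nat \<Rightarrow> complex) \<Rightarrow> nat \<Rightarrow> complex" where
  "lower a i = of_real (sqrt (2 * (real i + 1))) * a (Suc i)"

definition raise :: "(nat \<Rightarrow> complex) \<Rightarrow> nat \<Rightarrow> complex" where
  "raise a i = of_real (sqrt (2 * real i)) * a (i - 1)"

lemma rapid_herm_sum: "rapid (herm_sum a m)"
  unfolding herm_sum_def by (intro rapid_sum rapid_cmult rapid_hermite)

lemma ell2_nonneg [simp]: "ell2 a m \<ge> 0"
  by (simp add: ell2_def L2_set_nonneg)

lemma ell2_sq: "(ell2 a m)\<^sup>2 = (\<Sum>i<m. (cmod (a i))\<^sup>2)"
  by (simp add: ell2_def L2_set_def sum_nonneg)

lemma L2_of_herm_sum: "L2_of (herm_sum a m) = (\<Sum>i<m. a i *\<^sub>C hermite_L2 i)"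
proof (induction m)
  case 0
  then show ?case by (simp add: herm_sum_def[abs_def] L2_of_zero)
next
  case (Suc m)
  have "herm_sum a (Suc m) = (\<lambda>x. herm_sum a m x + a m * hermite_c m x)"
    by (simp add: fun_eq_iff herm_sum_def)
  then show ?case
    using Suc by (simp add: L2_of_add rapid_sq_int rapid_herm_sum sq_int_cmult sq_int_hermite
        L2_of_scaleC hermite_L2_def)
qed

lemma norm_herm_sum: "norm (L2_of (herm_sum a m)) = ell2 a m"
proof -
  have "(norm (L2_of (herm_sum a m)))\<^sup>2 = (ell2 a m)\<^sup>2"
    by (simp add: L2_of_herm_sum norm_hermite_sum ell2_sq)
  then show ?thesis by (rule power2_eq_imp_eq) simp_all
qed

lemma sum_shift_down:
  fixes g :: "nat \<Rightarrow> 'a :: comm_monoid_add"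
  assumes "g 0 = 0" "g m = 0"
  shows "(\<Sum>i<m. g i) = (\<Sum>i<m. g (Suc i))"
proof (cases m)
  case (Suc k)
  have "(\<Sum>i<Suc k. g i) = (\<Sum>i<k. g (Suc i))"
    unfolding sum.lessThan_Suc_shift by (simp add: assms)
  then show ?thesis using assms Suc by simp
qed simp

lemma sum_mult_half:
  fixes a :: "nat \<Rightarrow> complex"
  shows "(\<Sum>i\<in>I. a i * ((f i + g i) / 2)) = ((\<Sum>i\<in>I. a i * f i) + (\<Sum>i\<in>I. a i * g i)) / 2"
    "(\<Sum>i\<in>I. a i * ((f i - g i) / 2)) = ((\<Sum>i\<in>I. a i * f i) - (\<Sum>i\<in>I. a i * g i)) / 2"
  by (simp_all add: ring_distribs add_divide_distrib diff_divide_distrib sum.distrib sum_subtractf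
      sum_divide_distrib)

text \<open>The entry of \<open>lower a\<close> at \<open>m - 1\<close> reads \<open>a m\<close>,
  which the support hypothesis makes zero. Raising needs one more index instead, hence
  \<open>Suc m\<close> in \<open>herm_sum_raise\<close>.\<close>

lemma herm_sum_lower:
  assumes "\<And>i. i \<ge> m \<Longrightarrow> a i = 0"
  shows "herm_sum (lower a) m x = (\<Sum>i<m. a i * cdown i x)"
  by (subst sum_shift_down) (simp_all add: assms herm_sum_def lower_def add.commute mult_ac)

lemma herm_sum_raise:
  "herm_sum (raise a) (Suc m) x = (\<Sum>i<m. a i * cup i x)"
  unfolding herm_sum_def by (subst sum.lessThan_Suc_shift) (simp add: raise_def mult_ac add.commute)

lemma herm_sum_x:
  assumes "\<And>i. i \<ge> m \<Longrightarrow> a i = 0"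
  shows "of_real x * herm_sum a m x = (herm_sum (lower a) m x + herm_sum (raise a) (Suc m) x) / 2"
proof -
  have e: "of_real x * hermite_c i x = (cdown i x
      + cup i x) / 2" for i
    unfolding of_real_mult[symmetric] hermite_fun_x by simp
  have "of_real x * herm_sum a m x = (\<Sum>i<m. a i * (of_real x * hermite_c i x))"
    by (simp add: herm_sum_def sum_distrib_left mult_ac)
  also have "\<dots> = (herm_sum (lower a) m x + herm_sum (raise a) (Suc m) x) / 2"
    unfolding e herm_sum_raise by (subst herm_sum_lower, erule assms, rule sum_mult_half)
  finally show ?thesis .
qed

lemma herm_sum_deriv:
  assumes "\<And>i. i \<ge> m \<Longrightarrow> a i = 0"
  shows "(herm_sum a m has_vector_derivative
    (herm_sum (lower a) m x - herm_sum (raise a) (Suc m) x) / 2) (at x)"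
proof -
  have "((\<lambda>x. \<Sum>i<m. a i * hermite_c i x) has_vector_derivative
      (\<Sum>i<m. a i * ((cdown i x
      - cup i x) / 2))) (at x)"
    by (intro has_vector_derivative_sum has_vector_derivative_mult_right hermite_c_deriv)
  also have "(\<Sum>i<m. a i * ((cdown i x
      - cup i x) / 2))
      = (herm_sum (lower a) m x - herm_sum (raise a) (Suc m) x) / 2"
    unfolding herm_sum_raise by (subst herm_sum_lower, erule assms, rule sum_mult_half)
  finally show ?thesis by (simp add: herm_sum_def[abs_def])
qed

lemma ell2_lower:
  assumes "\<And>i. i \<ge> m \<Longrightarrow> a i = 0"
  shows "ell2 (lower a) m \<le> sqrt (2 * real m) * ell2 a m"
proof -
  have "(ell2 (lower a) m)\<^sup>2 = (\<Sum>i<m. (2 * (real (Suc i))) * (cmod (a (Suc i)))\<^sup>2)"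
    by (simp add: ell2_sq lower_def norm_mult power_mult_distrib add.commute)
  also have "\<dots> = (\<Sum>i<m. 2 * real i * (cmod (a i))\<^sup>2)"
    by (subst sum_shift_down[of "\<lambda>i. 2 * real i * (cmod (a i))\<^sup>2"]) (simp_all add: assms)
  also have "\<dots> \<le> (\<Sum>i<m. 2 * real m * (cmod (a i))\<^sup>2)"
    by (intro sum_mono mult_right_mono) auto
  also have "\<dots> = (sqrt (2 * real m) * ell2 a m)\<^sup>2"
    by (simp add: power_mult_distrib ell2_sq sum_distrib_left)
  finally show ?thesis by (rule power2_le_imp_le) simp
qed

lemma ell2_raise: "ell2 (raise a) (Suc m) \<le> sqrt (2 * real m) * ell2 a m"
proof -
  have "(ell2 (raise a) (Suc m))\<^sup>2 = (\<Sum>i<m. (2 * (real (Suc i))) * (cmod (a i))\<^sup>2)"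
    unfolding ell2_sq by (subst sum.lessThan_Suc_shift) (simp add: raise_def norm_mult power_mult_distrib)
  also have "\<dots> \<le> (\<Sum>i<m. 2 * real m * (cmod (a i))\<^sup>2)"
    by (intro sum_mono mult_right_mono) auto
  also have "\<dots> = (sqrt (2 * real m) * ell2 a m)\<^sup>2"
    by (simp add: power_mult_distrib ell2_sq sum_distrib_left)
  finally show ?thesis by (rule power2_le_imp_le) simp
qed

text \<open>The one-dimensional Gagliardo-Nirenberg inequality, applied to a function whose derivative
  costs a factor \<open>sqrt (2 m)\<close>.\<close>

lemma herm_sum_sup:
  assumes supp: "\<And>i. i \<ge> m \<Longrightarrow> a i = 0"
  shows "cmod (herm_sum a m x) \<le> 2 * sqrt (sqrt (real m)) * ell2 a m"
proof (rule power2_le_imp_le)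
  define f where "f = herm_sum a m"
  define f' where "f' = (\<lambda>x. (1 / 2) * (herm_sum (lower a) m x - herm_sum (raise a) (Suc m) x))"
  have f: "rapid f" and f': "rapid f'" unfolding f_def f'_def
    by (intro rapid_herm_sum rapid_cmult rapid_diff)+
  have d: "(f has_vector_derivative f' x) (at x)" for x
    unfolding f_def f'_def using herm_sum_deriv[of m a x, OF supp] by simp
  have nf': "norm (L2_of f') \<le> sqrt (2 * real m) * ell2 a m"
  proof -
    have "norm (L2_of f') = (1 / 2) * norm (L2_of (herm_sum (lower a) m) - L2_of (herm_sum (raise a) (Suc m)))"
      unfolding f'_def
      by (subst L2_of_scaleC, intro sq_int_diff rapid_sq_int rapid_herm_sum)
        (simp add: norm_scaleC L2_of_diff rapid_sq_int rapid_herm_sum)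
    also have "\<dots> \<le> (1 / 2) * (norm (L2_of (herm_sum (lower a) m)) + norm (L2_of (herm_sum (raise a) (Suc m))))"
      by (intro mult_left_mono norm_triangle_ineq4) simp
    also have "\<dots> \<le> sqrt (2 * real m) * ell2 a m"
      using ell2_lower[of m a, OF supp] ell2_raise[of a m] by (simp add: norm_herm_sum)
    finally show ?thesis .
  qed
  \<comment> \<open>The derivative of the squared modulus of \<open>f\<close>; its integral is at
    most twice the product of the norms of \<open>f\<close> and \<open>f'\<close>.\<close>
  let ?F' = "\<lambda>x. f x * cnj (f' x) + f' x * cnj (f x)"
  have "cmod (f x * cnj (f x)) \<le> (LBINT x. cmod (?F' x))"
  proof (rule rapid_norm_le_integral)
    show "((\<lambda>x. f x * cnj (f x)) has_vector_derivative ?F' x) (at x)" for x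
      by (intro has_vector_derivative_mult bounded_linear.has_vector_derivative[OF bounded_linear_cnj] d)
  qed (intro rapid_mult rapid_add rapid_cnj f f')+
  also have "\<dots> \<le> (LBINT x. 2 * (cmod (f x) * cmod (f' x)))"
  proof (rule integral_mono)
    show "integrable lborel (\<lambda>x. cmod (?F' x))"
      by (intro integrable_norm rapid_integrable rapid_mult rapid_add rapid_cnj f f')
    show "integrable lborel (\<lambda>x. 2 * (cmod (f x) * cmod (f' x)))"
      by (intro integrable_mult_right LBINT_cmod_mult_le rapid_sq_int f f')
    show "cmod (?F' x) \<le> 2 * (cmod (f x) * cmod (f' x))" for x
      using norm_triangle_ineq[of "f x * cnj (f' x)" "f' x * cnj (f x)"] by (simp add: norm_mult mult_ac)
  qed
  also have "\<dots> = 2 * (LBINT x. cmod (f x) * cmod (f' x))" by simp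
  also have "\<dots> \<le> 2 * (norm (L2_of f) * norm (L2_of f'))"
    by (intro mult_left_mono LBINT_cmod_mult_le rapid_sq_int f f') simp
  also have "\<dots> \<le> 2 * (ell2 a m * (sqrt (2 * real m) * ell2 a m))"
    by (intro mult_left_mono mult_mono nf') (simp_all add: f_def norm_herm_sum)
  also have "\<dots> = 2 * sqrt 2 * (sqrt (real m) * (ell2 a m)\<^sup>2)"
    by (simp add: real_sqrt_mult power2_eq_square mult_ac)
  \<comment> \<open>Rounding \<open>2 * sqrt 2\<close> up to 4 makes the right side the square of
    the claimed bound.\<close>
  also have "\<dots> \<le> 4 * (sqrt (real m) * (ell2 a m)\<^sup>2)"
    using real_sqrt_le_mono[of 2 4] by (intro mult_right_mono) simp_all
  finally show "(cmod (herm_sum a m x))\<^sup>2 \<le> (2 * sqrt (sqrt (real m)) * ell2 a m)\<^sup>2"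
    by (simp add: norm_mult power2_eq_square[of "cmod _"] f_def power_mult_distrib)
qed simp

section \<open>Hermite coefficients of products and their decay\<close>

definition prod_coeff :: "(real \<Rightarrow> complex) \<Rightarrow> (real \<Rightarrow> complex) \<Rightarrow> nat \<Rightarrow> complex" where
  "prod_coeff f g l = (LBINT x. f x * g x * hermite_c l x)"

abbreviation pnorm :: "(real \<Rightarrow> complex) \<Rightarrow> (real \<Rightarrow> complex) \<Rightarrow> nat set \<Rightarrow> real" where
  "pnorm f g S \<equiv> L2_set (\<lambda>l. cmod (prod_coeff f g l)) S"

lemma prod_coeff_commute: "prod_coeff f g = prod_coeff g f"
  by (simp add: prod_coeff_def fun_eq_iff mult.commute)

lemma prod_coeff_hcoeff:
  assumes "rapid f" "rapid g"
  shows "prod_coeff f g l = hcoeff (L2_of (\<lambda>x. f x * g x)) l"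
  unfolding prod_coeff_def by (intro hcoeff_L2_of[symmetric] rapid_sq_int rapid_mult assms)

lemma prod_coeff_sum:
  assumes "\<And>i. i \<in> I \<Longrightarrow> rapid (f i)" "\<And>j. j \<in> J \<Longrightarrow> rapid (g j)"
  shows "prod_coeff (\<lambda>x. \<Sum>i\<in>I. f i x) (\<lambda>x. \<Sum>j\<in>J. g j x) l = (\<Sum>i\<in>I. \<Sum>j\<in>J. prod_coeff (f i) (g j) l)"
proof -
  have int: "integrable lborel (\<lambda>x. f i x * g j x * hermite_c l x)" if "i \<in> I" "j \<in> J" for i j
    by (intro rapid_integrable rapid_mult rapid_hermite assms that)
  have "prod_coeff (\<lambda>x. \<Sum>i\<in>I. f i x) (\<lambda>x. \<Sum>j\<in>J. g j x) l
      = (LBINT x. (\<Sum>i\<in>I. \<Sum>j\<in>J. f i x * g j x * hermite_c l x))"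
    unfolding prod_coeff_def sum_product by (simp only: sum_distrib_right)
  also have "\<dots> = (\<Sum>i\<in>I. LBINT x. (\<Sum>j\<in>J. f i x * g j x * hermite_c l x))"
    by (intro Bochner_Integration.integral_sum Bochner_Integration.integrable_sum int)
  also have "\<dots> = (\<Sum>i\<in>I. \<Sum>j\<in>J. prod_coeff (f i) (g j) l)"
    unfolding prod_coeff_def by (intro sum.cong refl Bochner_Integration.integral_sum int)
  finally show ?thesis .
qed

text \<open>The first factor goes into the sup norm and the second into \<open>L2\<close>; Bessel
  discards the modes outside \<open>S\<close>.\<close>

lemma prod_coeff_base:
  assumes supp: "\<And>i. i \<ge> m \<Longrightarrow> a i = 0" and "finite S"
  shows "pnorm (herm_sum a m) (herm_sum b p) S
    \<le> 2 * sqrt (sqrt (real m)) * ell2 a m * ell2 b p"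
proof -
  let ?B = "2 * sqrt (sqrt (real m)) * ell2 a m"
  have B: "cmod (herm_sum a m x) \<le> ?B" for x by (rule herm_sum_sup[OF supp])
  let ?v = "L2_of (\<lambda>x. herm_sum a m x * herm_sum b p x)"
  have "pnorm (herm_sum a m) (herm_sum b p) S = sqrt (\<Sum>l\<in>S. (cmod (hcoeff ?v l))\<^sup>2)"
    by (simp add: L2_set_def prod_coeff_hcoeff rapid_herm_sum)
  also have "\<dots> \<le> norm ?v"
    using bessel[OF assms(2), of ?v] by (simp add: real_le_lsqrt sum_nonneg)
  also have "\<dots> \<le> ?B * norm (L2_of (herm_sum b p))"
    by (rule norm_L2_bounded_mult)
      (use B rapid_measurable[OF rapid_herm_sum] in \<open>simp_all add: rapid_sq_int rapid_herm_sum\<close>)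
  finally show ?thesis by (simp add: norm_herm_sum)
qed

text \<open>The left side tests against \<open>(x - d/dx)\<close> of the l-th Hermite function; by
  parts, \<open>x + d/dx\<close> falls on the product. The \<open>x\<close> is given entirely to the
  first factor, which is then only lowered, while the second is differentiated. Hence the length
  \<open>m\<close> of the coarser factor never grows under iteration.\<close>

lemma prod_coeff_Suc:
  assumes a: "\<And>i. i \<ge> m \<Longrightarrow> a i = 0" and b: "\<And>i. i \<ge> p \<Longrightarrow> b i = 0"
  shows "of_real (sqrt (2 * (real l + 1))) * prod_coeff (herm_sum a m) (herm_sum b p) (Suc l)
    = prod_coeff (herm_sum (lower a) m) (herm_sum b p) l
      + prod_coeff (herm_sum a m) (herm_sum (lower b) p) l / 2
      - prod_coeff (herm_sum a m) (herm_sum (raise b) (Suc p)) l / 2"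
proof -
  define f g h where "f = herm_sum a m" and "g = herm_sum b p" and "h = hermite_c l"
  define fl fr gl gr where "fl = herm_sum (lower a) m" and "fr = herm_sum (raise a) (Suc m)"
    and "gl = herm_sum (lower b) p" and "gr = herm_sum (raise b) (Suc p)"
  define hl hr where "hl = (\<lambda>x. cdown l x)"
    and "hr = (\<lambda>x. cup l x)"
  note defs = f_def g_def h_def fl_def fr_def gl_def gr_def hl_def hr_def
  have r: "rapid f" "rapid g" "rapid h" "rapid fl" "rapid fr" "rapid gl" "rapid gr" "rapid hl" "rapid hr"
    unfolding defs by (intro rapid_herm_sum rapid_cmult rapid_hermite)+
  have xf: "of_real x * f x = (fl x + fr x) / 2" for x unfolding defs by (rule herm_sum_x[OF a])
  have xh: "of_real x * h x = (hl x + hr x) / 2" for x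
    unfolding defs of_real_mult[symmetric] hermite_fun_x by simp
  let ?E = "\<lambda>x. fl x * g x * h x + (1 / 2) * (f x * gl x * h x) - (1 / 2) * (f x * gr x * h x) - f x * g x * hr x"
  have "(LBINT x. ?E x) = 0"
  proof (rule rapid_FTC)
    show "rapid (\<lambda>x. f x * g x * h x)" "rapid ?E"
      by (intro rapid_mult rapid_add rapid_diff rapid_cmult r)+
    fix x
    have "((\<lambda>x. f x * g x * h x) has_vector_derivative
        (f x * g x) * ((hl x - hr x) / 2) + (f x * ((gl x - gr x) / 2) + ((fl x - fr x) / 2) * g x) * h x) (at x)"
      unfolding defs by (intro has_vector_derivative_mult herm_sum_deriv hermite_c_deriv a b)
    \<comment> \<open>The last bracket is \<open>x * f * h\<close> written in two ways, so it
      vanishes.\<close>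
    also have "(f x * g x) * ((hl x - hr x) / 2) + (f x * ((gl x - gr x) / 2) + ((fl x - fr x) / 2) * g x) * h x
        = ?E x + g x * ((f x * ((hl x + hr x) / 2)) - ((fl x + fr x) / 2) * h x)"
      by (simp add: field_simps)
    also have "\<dots> = ?E x" unfolding xf[symmetric] xh[symmetric] by (simp add: mult_ac)
    finally show "((\<lambda>x. f x * g x * h x) has_vector_derivative ?E x) (at x)" .
  qed
  moreover have i: "integrable lborel (\<lambda>x. fl x * g x * h x)" "integrable lborel (\<lambda>x. f x * gl x * h x)"
    "integrable lborel (\<lambda>x. f x * gr x * h x)" "integrable lborel (\<lambda>x. f x * g x * hr x)"
    by (intro rapid_integrable rapid_mult r)+
  moreover have "(LBINT x. f x * g x * hr x)
      = of_real (sqrt (2 * (real l + 1))) * prod_coeff f g (Suc l)"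
  proof -
    have "(LBINT x. f x * g x * hr x)
        = (LBINT x. of_real (sqrt (2 * (real l + 1))) * (f x * g x * hermite_c (Suc l) x))"
      by (simp add: hr_def mult_ac)
    then show ?thesis unfolding integral_mult_right_zero prod_coeff_def .
  qed
  ultimately show ?thesis
    by (simp add: prod_coeff_def h_def flip: f_def g_def fl_def fr_def gl_def gr_def)
qed

text \<open>Modes in \<open>S\<close> lie above \<open>K\<close>, so dividing the recursion by its
  square root gains at least \<open>1 / sqrt (2 * (K + 1))\<close>, at the price of shifting all
  modes down by one.\<close>

lemma prod_coeff_step:
  assumes a: "\<And>i. i \<ge> m \<Longrightarrow> a i = 0" and b: "\<And>i. i \<ge> p \<Longrightarrow> b i = 0"
    and S: "finite S" "S \<subseteq> {Suc K..}"
  defines "T \<equiv> (\<lambda>l. l - 1) ` S"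
  shows "pnorm (herm_sum a m) (herm_sum b p) S
    \<le> (1 / sqrt (2 * (real K + 1))) *
      (pnorm (herm_sum (lower a) m) (herm_sum b p) T
       + pnorm (herm_sum a m) (herm_sum (lower b) p) T / 2
       + pnorm (herm_sum a m) (herm_sum (raise b) (Suc p)) T / 2)"
proof -
  define P where "P = (\<lambda>l. cmod (prod_coeff (herm_sum a m) (herm_sum b p) l))"
  define X1 where "X1 = (\<lambda>l. cmod (prod_coeff (herm_sum (lower a) m) (herm_sum b p) l))"
  define X2 where "X2 = (\<lambda>l. cmod (prod_coeff (herm_sum a m) (herm_sum (lower b) p) l))"
  define X3 where "X3 = (\<lambda>l. cmod (prod_coeff (herm_sum a m) (herm_sum (raise b) (Suc p)) l))"
  let ?c = "1 / sqrt (2 * (real K + 1))"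
  have inj: "inj_on (\<lambda>l. l - 1) S"
  proof (rule inj_onI)
    fix x y assume "x \<in> S" "y \<in> S" "x - 1 = y - 1"
    moreover from this have "Suc K \<le> x" "Suc K \<le> y" using S(2) by auto
    ultimately show "x = y" by simp
  qed
  let ?X = "\<lambda>l. X1 l + X2 l / 2 + X3 l / 2"
  have "L2_set P S = L2_set (\<lambda>l. P (Suc l)) T"
  proof -
    have "(\<Sum>l\<in>T. (P (Suc l))\<^sup>2) = (\<Sum>l\<in>S. (P (Suc (l - 1)))\<^sup>2)"
      unfolding T_def by (subst sum.reindex[OF inj]) simp
    also have "\<dots> = (\<Sum>l\<in>S. (P l)\<^sup>2)"
      using S(2) by (intro sum.cong refl) fastforce
    finally show ?thesis by (simp add: L2_set_def)
  qed
  also have "\<dots> \<le> L2_set (\<lambda>l. ?c * ?X l) T"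
  proof (rule L2_set_mono)
    fix l assume "l \<in> T"
    then have l: "K \<le> l" using S(2) unfolding T_def by fastforce
    let ?s = "sqrt (2 * (real l + 1))"
    have "?s * P (Suc l) = cmod (of_real ?s * prod_coeff (herm_sum a m) (herm_sum b p) (Suc l))"
      by (simp add: P_def norm_mult)
    also have "of_real ?s * prod_coeff (herm_sum a m) (herm_sum b p) (Suc l)
        = prod_coeff (herm_sum (lower a) m) (herm_sum b p) l
          + prod_coeff (herm_sum a m) (herm_sum (lower b) p) l / 2
          - prod_coeff (herm_sum a m) (herm_sum (raise b) (Suc p)) l / 2"
      by (rule prod_coeff_Suc) (use a b in auto)
    also have "cmod \<dots> \<le> ?X l"
      unfolding X1_def X2_def X3_def
      by (rule order_trans[OF norm_triangle_ineq4] order_trans[OF add_right_mono[OF norm_triangle_ineq]])+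
        (simp add: norm_divide)
    finally have le: "P (Suc l) \<le> (1 / ?s) * ?X l"
      by (simp add: field_simps)
    have "1 / ?s \<le> ?c" using l by (intro divide_left_mono) simp_all
    then have "(1 / ?s) * ?X l \<le> ?c * ?X l"
      by (rule mult_right_mono) (simp add: X1_def X2_def X3_def)
    with le show "P (Suc l) \<le> ?c * ?X l" by (rule order_trans)
  qed (simp add: P_def)
  also have "\<dots> = ?c * L2_set ?X T"
    by (rule L2_set_right_distrib[symmetric]) simp
  also have "\<dots> \<le> ?c * (L2_set X1 T + L2_set X2 T / 2 + L2_set X3 T / 2)"
  proof (rule mult_left_mono)
    have h: "L2_set (\<lambda>l. f l / 2) T = L2_set f T / 2" for f :: "nat \<Rightarrow> real"
      using L2_set_right_distrib[of "1 / 2" f T] by simp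
    have "L2_set ?X T
        \<le> L2_set (\<lambda>l. X1 l + X2 l / 2) T + L2_set (\<lambda>l. X3 l / 2) T"
      by (rule L2_set_triangle_ineq)
    also have "L2_set (\<lambda>l. X1 l + X2 l / 2) T \<le> L2_set X1 T + L2_set (\<lambda>l. X2 l / 2) T"
      by (rule L2_set_triangle_ineq)
    finally show "L2_set ?X T
        \<le> L2_set X1 T + L2_set X2 T / 2 + L2_set X3 T / 2"
      by (simp add: h)
  qed simp
  finally show ?thesis by (simp add: P_def X1_def X2_def X3_def)
qed

text \<open>A predicate on the constant alone, so that \<open>C\<close> precedes all data: the
  induction on \<open>N\<close> applies the bound to altered coefficients, to \<open>Suc p\<close>
  and to a lower \<open>K\<close>.\<close>

definition tail_const :: "nat \<Rightarrow> real \<Rightarrow> bool" where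
  "tail_const N C \<longleftrightarrow> C \<ge> 0 \<and> (\<forall>a m b p K S.
    (\<forall>i\<ge>m. a i = 0) \<longrightarrow> (\<forall>i\<ge>p. b i = 0) \<longrightarrow> 1 \<le> m \<longrightarrow> m \<le> p \<longrightarrow> finite S \<longrightarrow> S \<subseteq> {K..} \<longrightarrow>
    pnorm (herm_sum a m) (herm_sum b p) S
    \<le> C * sqrt (real p / (real K + 1)) ^ N * sqrt (sqrt (real m)) * ell2 a m * ell2 b p)"

lemma tail_constD:
  assumes "tail_const N C" "\<And>i. i \<ge> m \<Longrightarrow> a i = 0" "\<And>i. i \<ge> p \<Longrightarrow> b i = 0"
    "1 \<le> m" "m \<le> p" "finite S" "S \<subseteq> {K..}"
  shows "pnorm (herm_sum a m) (herm_sum b p) S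
    \<le> C * sqrt (real p / (real K + 1)) ^ N * sqrt (sqrt (real m)) * ell2 a m * ell2 b p"
  using assms unfolding tail_const_def by blast

text \<open>The annihilation operator \<open>x + d/dx\<close> is a first-order operator, so it acts on a product by the
  Leibniz rule; each application moves one index down and costs at most \<open>sqrt (2 p)\<close> while gaining
  \<open>1 / sqrt (2 K)\<close>.\<close>

lemma prod_coeff_tail: "\<exists>C. tail_const N C"
proof (induction N)
  case 0
  show ?case by (rule exI[of _ 2]) (auto simp: tail_const_def intro!: prod_coeff_base)
next
  case (Suc N)
  then obtain C where tc: "tail_const N C" by blast
  note C = tail_constD[OF tc]
  have "C \<ge> 0" using tc by (simp add: tail_const_def)
  \<comment> \<open>In the new constant \<open>2 ^ N\<close> and one factor 2 come from comparing
    shifted ratios with \<open>2 * r\<close>, another factor 2 from the three terms of the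
    recursion; the summand 2 covers \<open>K = 0\<close>.\<close>
  have "pnorm (herm_sum a m) (herm_sum b p) S
      \<le> (4 * 2 ^ N * C + 2) * sqrt (real p / (real K + 1)) ^ Suc N * sqrt (sqrt (real m)) * ell2 a m * ell2 b p"
    if a: "\<And>i. i \<ge> m \<Longrightarrow> a i = 0" and b: "\<And>i. i \<ge> p \<Longrightarrow> b i = 0" and mp: "1 \<le> m" "m \<le> p"
      and S: "finite S" "S \<subseteq> {K..}" for a m b p K S
  proof -
    define r where "r = sqrt (real p / (real K + 1))"
    define M where "M = sqrt (sqrt (real m)) * (ell2 a m * ell2 b p)"
    have r0: "r \<ge> 0" and M0: "M \<ge> 0" by (simp_all add: r_def M_def)
    have "pnorm (herm_sum a m) (herm_sum b p) S
      \<le> (4 * 2 ^ N * C + 2) * r ^ Suc N * M"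
    proof (cases K)
      case 0
      \<comment> \<open>No descent is possible, but as \<open>p \<ge> 1\<close> the decay factor is
        at least 1 and the sup norm estimate suffices.\<close>
      have "1 \<le> r" using mp by (simp add: r_def 0)
      then have "1 \<le> r ^ Suc N" by (rule one_le_power)
      then have "2 * 1 * M \<le> (4 * 2 ^ N * C + 2) * r ^ Suc N * M"
        using \<open>C \<ge> 0\<close> M0 by (intro mult_mono) auto
      then show ?thesis using prod_coeff_base[of m a S b p, OF a S(1)] by (simp add: M_def mult_ac)
    next
      case (Suc k)
      define T where "T = (\<lambda>l. l - 1) ` S"
      have T: "finite T" "T \<subseteq> {k..}" using S Suc unfolding T_def by fastforce+
      \<comment> \<open>Lowering \<open>K\<close> by one, even together with raising
        \<open>p\<close> by one, at most quadruples the ratio under the root, because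
        \<open>p \<ge> 1\<close>.\<close>
      have r1: "sqrt (real p / (real k + 1)) \<le> 2 * r" and r2: "sqrt (real (Suc p) / (real k + 1)) \<le> 2 * r"
      proof -
        have e: "2 * r = sqrt (4 * (real p / (real k + 2)))"
          by (simp only: real_sqrt_mult r_def Suc) (simp add: add.commute)
        have "(real p + 1) * (real k + 2) \<le> (2 * real p) * (2 * (real k + 1))"
          using mp by (intro mult_mono) auto
        then have "real (Suc p) / (real k + 1) \<le> 4 * (real p / (real k + 2))"
          by (simp add: field_simps)
        then show "sqrt (real (Suc p) / (real k + 1)) \<le> 2 * r" unfolding e by (rule real_sqrt_le_mono)
        moreover have "sqrt (real p / (real k + 1)) \<le> sqrt (real (Suc p) / (real k + 1))"
          by (intro real_sqrt_le_mono divide_right_mono) auto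
        ultimately show "sqrt (real p / (real k + 1)) \<le> 2 * r" by (rule order_trans[rotated])
      qed
      define Z where "Z = C * (2 * r) ^ N * (sqrt (2 * real p) * M)"
      have bound: "C * q ^ N * sqrt (sqrt (real m)) * ea * eb \<le> Z"
        if "0 \<le> q" "q \<le> 2 * r" "0 \<le> ea" "0 \<le> eb" "ea * eb \<le> sqrt (2 * real p) * (ell2 a m * ell2 b p)" for q ea eb
      proof -
        have "C * q ^ N * sqrt (sqrt (real m)) * ea * eb = (C * q ^ N) * (sqrt (sqrt (real m)) * (ea * eb))"
          by (simp add: mult_ac)
        also have "\<dots> \<le> (C * (2 * r) ^ N) * (sqrt (sqrt (real m)) * (sqrt (2 * real p) * (ell2 a m * ell2 b p)))"
          using that \<open>C \<ge> 0\<close> r0 by (intro mult_mono[of "C * q ^ N"] mult_left_mono power_mono) auto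
        finally show ?thesis by (simp add: Z_def M_def mult_ac)
      qed
      have mp': "sqrt (2 * real m) * ell2 a m \<le> sqrt (2 * real p) * ell2 a m"
        using mp by (intro mult_right_mono) auto
      have "pnorm (herm_sum (lower a) m) (herm_sum b p) T \<le> Z"
      proof (rule order_trans[OF C bound])
        have "ell2 (lower a) m \<le> sqrt (2 * real p) * ell2 a m"
          by (rule order_trans[OF ell2_lower mp']) (rule a)
        from mult_right_mono[OF this, of "ell2 b p"]
        show "ell2 (lower a) m * ell2 b p \<le> sqrt (2 * real p) * (ell2 a m * ell2 b p)"
          by (simp add: mult.assoc)
      qed (use a b mp T r1 in \<open>auto simp: lower_def\<close>)
      moreover have "pnorm (herm_sum a m) (herm_sum (lower b) p) T \<le> Z"
      proof (rule order_trans[OF C bound])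
        have "ell2 (lower b) p \<le> sqrt (2 * real p) * ell2 b p"
          by (rule ell2_lower) (rule b)
        from mult_left_mono[OF this, of "ell2 a m"]
        show "ell2 a m * ell2 (lower b) p \<le> sqrt (2 * real p) * (ell2 a m * ell2 b p)"
          by (simp add: mult_ac)
      qed (use a b mp T r1 in \<open>auto simp: lower_def\<close>)
      moreover have "pnorm (herm_sum a m) (herm_sum (raise b) (Suc p)) T \<le> Z"
      proof (rule order_trans[OF C bound])
        from mult_left_mono[OF ell2_raise[of b p], of "ell2 a m"]
        show "ell2 a m * ell2 (raise b) (Suc p) \<le> sqrt (2 * real p) * (ell2 a m * ell2 b p)"
          by (simp add: mult_ac)
        show "raise b i = 0" if "Suc p \<le> i" for i using b[of "i - 1"] that by (simp add: raise_def)
      qed (use a mp T r2 in auto)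
      ultimately have "pnorm (herm_sum a m) (herm_sum b p) S
          \<le> (1 / sqrt (2 * (real k + 1))) * (Z + Z / 2 + Z / 2)"
        using S(2) unfolding Suc
        by (intro order_trans[OF prod_coeff_step[of m a p b S k, OF a b S(1)]] mult_left_mono add_mono
            divide_right_mono) (auto simp: T_def)
      also have "\<dots> = 2 * (C * (2 * r) ^ N * M) * (sqrt (2 * real p) / sqrt (2 * (real k + 1)))"
        by (simp add: Z_def)
      also have "sqrt (2 * real p) / sqrt (2 * (real k + 1)) = sqrt (real p / (real k + 1))"
        unfolding real_sqrt_divide[symmetric] by (subst mult_divide_mult_cancel_left) simp_all
      also have "2 * (C * (2 * r) ^ N * M) * sqrt (real p / (real k + 1)) \<le> 2 * (C * (2 * r) ^ N * M) * (2 * r)"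
        using r0 M0 \<open>C \<ge> 0\<close> r1 by (intro mult_left_mono) auto
      also have "\<dots> = 4 * 2 ^ N * C * r ^ Suc N * M" by (simp add: power_mult_distrib)
      also have "\<dots> \<le> (4 * 2 ^ N * C + 2) * r ^ Suc N * M"
        using r0 M0 by (intro mult_right_mono) auto
      finally show ?thesis .
    qed
    then show ?thesis by (simp add: r_def M_def mult_ac)
  qed
  then show ?case
    using \<open>C \<ge> 0\<close> unfolding tail_const_def by (intro exI[of _ "4 * 2 ^ N * C + 2"]) auto
qed

section \<open>Dyadic decomposition\<close>

text \<open>The shift by one puts mode 0 alone into block 0 and makes the blocks a partition; on
  block \<open>i\<close> the eigenvalue \<open>2 * n + 1\<close> is comparable to
  \<open>2 ^ i\<close>.\<close>

definition dyad :: "nat \<Rightarrow> nat set" where "dyad i = {2 ^ i - 1..<2 ^ Suc i - 1}"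

definition block :: "(nat \<Rightarrow> complex) \<Rightarrow> nat \<Rightarrow> nat \<Rightarrow> complex" where
  "block a i n = (if n \<in> dyad i then a n else 0)"

definition dnorm :: "(nat \<Rightarrow> complex) \<Rightarrow> nat \<Rightarrow> real" where
  "dnorm a i = L2_set (\<lambda>n. cmod (a n)) (dyad i)"

lemma dnorm_nonneg [simp]: "dnorm a i \<ge> 0"
  by (simp add: dnorm_def L2_set_nonneg)

lemma finite_dyad [simp]: "finite (dyad i)"
  by (simp add: dyad_def)

lemma dyad_subset: "dyad i \<subseteq> {..<2 ^ Suc i}"
  by (auto simp: dyad_def)

lemma sum_dyad:
  fixes h :: "nat \<Rightarrow> 'a :: comm_monoid_add"
  shows "(\<Sum>n<2 ^ Suc J - 1. h n) = (\<Sum>i\<le>J. \<Sum>n\<in>dyad i. h n)"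
proof (induction J)
  case 0
  then show ?case by (simp add: dyad_def)
next
  case (Suc J)
  have "2 ^ Suc J - 1 \<le> (2 ^ Suc (Suc J) - 1 :: nat)" by (intro diff_le_mono power_increasing) auto
  then have "(\<Sum>n<2 ^ Suc (Suc J) - 1. h n) = (\<Sum>n<2 ^ Suc J - 1. h n) + (\<Sum>n\<in>dyad (Suc J). h n)"
    unfolding dyad_def lessThan_atLeast0 by (intro sum.atLeastLessThan_concat[symmetric]) auto
  with Suc show ?case by (simp del: power_Suc)
qed

lemma sum_block:
  fixes f :: "complex \<Rightarrow> nat \<Rightarrow> 'a :: comm_monoid_add"
  assumes "\<And>n. f 0 n = 0"
  shows "(\<Sum>n<2 ^ Suc i. f (block a i n) n) = (\<Sum>n\<in>dyad i. f (a n) n)"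
proof (rule sum.mono_neutral_cong_right)
  show "dyad i \<subseteq> {..<2 ^ Suc i}" by (rule dyad_subset)
qed (auto simp: block_def assms)

lemma ell2_block: "ell2 (block a i) (2 ^ Suc i) = dnorm a i"
  unfolding ell2_def dnorm_def L2_set_def
  using sum_block[of "\<lambda>z n. (cmod z)\<^sup>2" a i] by simp

lemma herm_sum_block: "herm_sum (block a i) (2 ^ Suc i) x = (\<Sum>n\<in>dyad i. a n * hermite_c n x)"
  unfolding herm_sum_def using sum_block[of "\<lambda>z n. z * hermite_c n x" a i] by simp

lemma herm_sum_dyadic:
  "herm_sum a (2 ^ Suc J - 1) x = (\<Sum>i\<le>J. herm_sum (block a i) (2 ^ Suc i) x)"
  by (simp only: herm_sum_block) (simp only: herm_sum_def sum_dyad)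

lemma block_0: "n \<ge> 2 ^ Suc i \<Longrightarrow> block a i n = 0"
  using dyad_subset[of i] by (auto simp: block_def)

section \<open>Geometric sums and a discrete Schur test\<close>

lemma sum_geometric_le:
  fixes r :: real
  assumes "0 \<le> r" "r < 1" "finite I"
  shows "(\<Sum>i\<in>I. r ^ i) \<le> 1 / (1 - r)"
proof -
  have "(\<Sum>i\<in>I. r ^ i) \<le> (\<Sum>i. r ^ i)"
    using assms by (intro sum_le_suminf summable_geometric) auto
  then show ?thesis using assms by (simp add: suminf_geometric)
qed

text \<open>The distance of \<open>l\<close> and \<open>j\<close> as a natural number: one of the
  two truncated differences is zero.\<close>

definition gap :: "nat \<Rightarrow> nat \<Rightarrow> nat" where "gap l j = (l - j) + (j - l)"

lemma gap_commute: "gap l j = gap j l"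
  by (simp add: gap_def)

lemma sum_gap_le:
  fixes r :: real
  assumes "0 \<le> r" "r < 1"
  shows "(\<Sum>j\<le>J. r ^ gap l j) \<le> 2 / (1 - r)"
proof -
  have "(\<Sum>j\<le>J. r ^ gap l j) \<le> (\<Sum>j\<in>{..l} \<union> {l<..J}. r ^ gap l j)"
    using assms by (intro sum_mono2) auto
  also have "\<dots> = (\<Sum>j\<in>{..l}. r ^ gap l j) + (\<Sum>j\<in>{l<..J}. r ^ gap l j)"
    by (intro sum.union_disjoint) auto
  also have "(\<Sum>j\<in>{..l}. r ^ gap l j) = (\<Sum>i\<in>(\<lambda>j. l - j) ` {..l}. r ^ i)"
    by (subst sum.reindex) (auto simp: gap_def inj_on_def intro!: sum.cong)
  also have "\<dots> \<le> 1 / (1 - r)" using assms by (intro sum_geometric_le) auto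
  also have "(\<Sum>j\<in>{l<..J}. r ^ gap l j) = (\<Sum>i\<in>(\<lambda>j. j - l) ` {l<..J}. r ^ i)"
    by (subst sum.reindex) (auto simp: gap_def inj_on_def intro!: sum.cong)
  also have "\<dots> \<le> 1 / (1 - r)" using assms by (intro sum_geometric_le) auto
  finally show ?thesis by simp
qed

text \<open>Schur's test: rows and columns of the kernel \<open>r ^ gap l j\<close> both sum to at
  most \<open>2 / (1 - r)\<close>, and Cauchy-Schwarz with half of the kernel on each side uses one
  of each.\<close>

lemma schur_gap:
  fixes r :: real and y :: "nat \<Rightarrow> real"
  assumes r: "0 \<le> r" "r < 1" and y: "\<And>j. 0 \<le> y j"
  shows "(\<Sum>l\<le>L. (\<Sum>j\<le>J. r ^ gap l j * y j)\<^sup>2) \<le> (2 / (1 - r))\<^sup>2 * (\<Sum>j\<le>J. (y j)\<^sup>2)"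
proof -
  define R where "R = 2 / (1 - r)"
  have R: "R \<ge> 0" using r by (simp add: R_def)
  have "(\<Sum>j\<le>J. r ^ gap l j * y j)\<^sup>2 \<le> R * (\<Sum>j\<le>J. r ^ gap l j * (y j)\<^sup>2)" for l
  proof -
    have "(\<Sum>j\<le>J. r ^ gap l j * y j)\<^sup>2 = (\<Sum>j\<le>J. sqrt (r ^ gap l j) * (sqrt (r ^ gap l j) * y j))\<^sup>2"
      using r by (simp add: mult.assoc[symmetric])
    also have "\<dots> \<le> (\<Sum>j\<le>J. (sqrt (r ^ gap l j))\<^sup>2) * (\<Sum>j\<le>J. (sqrt (r ^ gap l j) * y j)\<^sup>2)"
      by (rule Cauchy_Schwarz_ineq_sum)
    also have "\<dots> = (\<Sum>j\<le>J. r ^ gap l j) * (\<Sum>j\<le>J. r ^ gap l j * (y j)\<^sup>2)"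
      using r by (simp add: power_mult_distrib)
    also have "\<dots> \<le> R * (\<Sum>j\<le>J. r ^ gap l j * (y j)\<^sup>2)"
      unfolding R_def using r by (intro mult_right_mono sum_gap_le sum_nonneg) auto
    finally show ?thesis .
  qed
  then have "(\<Sum>l\<le>L. (\<Sum>j\<le>J. r ^ gap l j * y j)\<^sup>2) \<le> (\<Sum>l\<le>L. R * (\<Sum>j\<le>J. r ^ gap l j * (y j)\<^sup>2))"
    by (intro sum_mono)
  also have "\<dots> = R * (\<Sum>j\<le>J. (\<Sum>l\<le>L. r ^ gap j l) * (y j)\<^sup>2)"
    unfolding sum_distrib_left[symmetric] sum_distrib_right
    by (subst sum.swap) (simp add: gap_commute)
  also have "\<dots> \<le> R * (\<Sum>j\<le>J. R * (y j)\<^sup>2)"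
    unfolding R_def using r by (intro mult_left_mono sum_mono mult_right_mono sum_gap_le) auto
  also have "\<dots> = R\<^sup>2 * (\<Sum>j\<le>J. (y j)\<^sup>2)"
    by (simp add: sum_distrib_left power2_eq_square mult.assoc)
  finally show ?thesis unfolding R_def .
qed

section \<open>The algebra property\<close>

lemma dyad_bounds:
  assumes "n \<in> dyad i"
  shows "(2 :: real) ^ i \<le> 2 * real n + 1" "2 * real n + 1 \<le> 4 * 2 ^ i"
proof -
  have "2 ^ i \<le> n + 1" "n + 2 \<le> 2 * 2 ^ i"
    using assms by (auto simp: dyad_def)
  then have "real (2 ^ i) \<le> real (n + 1)" "real (n + 2) \<le> real (2 * 2 ^ i)"
    by (simp_all only: of_nat_le_iff)
  then show "(2 :: real) ^ i \<le> 2 * real n + 1" "2 * real n + 1 \<le> 4 * 2 ^ i" by simp_all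
qed

lemma dyad_powr_bounds:
  assumes "n \<in> dyad i" "s \<ge> 0"
  shows "2 powr (real i * s) \<le> (2 * real n + 1) powr s"
    "(2 * real n + 1) powr s \<le> 4 powr s * 2 powr (real i * s)"
proof -
  have e: "2 powr (real i * s) = (2 ^ i) powr s"
    by (simp add: powr_realpow[symmetric] powr_powr)
  show "2 powr (real i * s) \<le> (2 * real n + 1) powr s"
    unfolding e using assms dyad_bounds by (intro powr_mono2) auto
  have "(2 * real n + 1) powr s \<le> (4 * 2 ^ i) powr s"
    using assms dyad_bounds by (intro powr_mono2) auto
  then show "(2 * real n + 1) powr s \<le> 4 powr s * 2 powr (real i * s)"
    unfolding e by (simp add: powr_mult)
qed

text \<open>The share of block \<open>i\<close> in the Sobolev norm, with the eigenvalue replaced by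
  \<open>2 ^ i\<close>; this changes the squared weight by at most the factor
  \<open>4 powr s\<close>.\<close>

abbreviation wnorm :: "real \<Rightarrow> (nat \<Rightarrow> complex) \<Rightarrow> nat \<Rightarrow> real" where
  "wnorm s c i \<equiv> 2 powr (real i * s / 2) * dnorm c i"

lemma wnorm_sq: "(wnorm s c i)\<^sup>2 = (\<Sum>n\<in>dyad i. 2 powr (real i * s) * (cmod (c n))\<^sup>2)"
proof -
  have "(2 powr (x / 2))\<^sup>2 = 2 powr x" for x :: real
    by (simp add: power2_eq_square flip: powr_add)
  then show ?thesis
    by (simp add: power_mult_distrib dnorm_def L2_set_def sum_nonneg sum_distrib_left)
qed

abbreviation wsum :: "real \<Rightarrow> (nat \<Rightarrow> complex) \<Rightarrow> nat \<Rightarrow> real" where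
  "wsum s c m \<equiv> \<Sum>n<m. (2 * real n + 1) powr s * (cmod (c n))\<^sup>2"

lemma le_sum_wnorm:
  assumes "s \<ge> 0"
  shows "wsum s c (2 ^ Suc L - 1)
    \<le> 4 powr s * (\<Sum>l\<le>L. (wnorm s c l)\<^sup>2)"
  unfolding sum_dyad wnorm_sq sum_distrib_left mult.assoc[symmetric]
  by (intro sum_mono mult_right_mono dyad_powr_bounds assms) auto

lemma sum_wnorm_le_sobolev:
  assumes "s \<ge> 0" "v \<in> sobolev s"
  shows "(\<Sum>i\<le>J. (wnorm s (hcoeff v) i)\<^sup>2) \<le> (sobolev_norm s v)\<^sup>2"
proof -
  have "(\<Sum>i\<le>J. (wnorm s (hcoeff v) i)\<^sup>2) \<le> wsum s (hcoeff v) (2 ^ Suc J - 1)"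
    unfolding sum_dyad wnorm_sq
    by (intro sum_mono mult_right_mono dyad_powr_bounds assms) auto
  also have "\<dots> \<le> (\<Sum>n. (2 * real n + 1) powr s * (cmod (hcoeff v n))\<^sup>2)"
    using assms(2) by (intro sum_le_suminf) (auto simp: sobolev_iff)
  also have "\<dots> = (sobolev_norm s v)\<^sup>2"
    by (rule sums_unique[symmetric, OF sobolev_norm_sums[OF assms(2)]])
  finally show ?thesis .
qed

lemma wnorm_le_sobolev:
  assumes "s \<ge> 0" "v \<in> sobolev s"
  shows "wnorm s (hcoeff v) i \<le> sobolev_norm s v"
proof (rule power2_le_imp_le)
  have "(wnorm s (hcoeff v) i)\<^sup>2 \<le> (\<Sum>i\<le>i. (wnorm s (hcoeff v) i)\<^sup>2)"
    by (rule member_le_sum) auto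
  also have "\<dots> \<le> (sobolev_norm s v)\<^sup>2" by (rule sum_wnorm_le_sobolev[OF assms])
  finally show "(wnorm s (hcoeff v) i)\<^sup>2 \<le> (sobolev_norm s v)\<^sup>2" .
qed simp

section \<open>Products of two dyadic blocks\<close>

lemma sqrt_sqrt_two_power: "sqrt (sqrt (real (2 ^ Suc i))) = 2 powr ((real i + 1) / 4)"
proof -
  have "sqrt (sqrt (real (2 ^ Suc i))) = ((2 powr real (Suc i)) powr (1 / 2)) powr (1 / 2)"
    by (simp add: powr_half_sqrt powr_realpow del: of_nat_Suc)
  also have "\<dots> = 2 powr ((real i + 1) / 4)"
    unfolding powr_powr by (simp add: field_simps)
  finally show ?thesis .
qed

lemma sqrt_two_power_ratio:
  "sqrt (real (2 ^ Suc j) / 2 ^ l) ^ N = 2 powr (real N * (real j + 1 - real l) / 2)"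
proof -
  have "real (2 ^ Suc j) / 2 ^ l = 2 powr (real (Suc j) - real l)"
    unfolding powr_diff by (simp add: powr_realpow del: of_nat_Suc)
  then have "sqrt (real (2 ^ Suc j) / 2 ^ l) ^ N = ((2 powr (real (Suc j) - real l)) powr (1 / 2)) powr real N"
    by (simp add: powr_half_sqrt powr_realpow)
  also have "\<dots> = 2 powr (real N * (real j + 1 - real l) / 2)"
    unfolding powr_powr by (simp add: field_simps)
  finally show ?thesis .
qed

abbreviation hblock :: "(nat \<Rightarrow> complex) \<Rightarrow> nat \<Rightarrow> real \<Rightarrow> complex" where
  "hblock a i \<equiv> herm_sum (block a i) (2 ^ Suc i)"

lemma powr_power_two: "(2 powr x) ^ n = 2 powr (x * real n)"
  by (simp add: powr_powr flip: powr_realpow)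

text \<open>The sup norm of the coarser block costs \<open>2 powr (i / 4)\<close> and its weight
  returns \<open>2 powr (- i * s / 2)\<close>. For output blocks \<open>l \<le> j\<close> the decay
  in the gap is the smaller weight itself; for \<open>l > j\<close> it is the tail estimate.\<close>

lemma block_product:
  fixes s :: real
  assumes s: "s \<ge> 0"
  shows "\<exists>C\<ge>0. \<forall>a b i j l. i \<le> j \<longrightarrow>
    wnorm s (prod_coeff (hblock a i) (hblock b j)) l
    \<le> C * ((2 powr (1 / 4 - s / 2)) ^ i * wnorm s a i * ((2 powr (- min (s / 2) (1 / 2))) ^ gap l j * wnorm s b j))"
proof -
  \<comment> \<open>The decay rate available on both sides: \<open>s / 2\<close> from the weight
    below \<open>j\<close>, and \<open>(N - s) / 2 \<ge> 1 / 2\<close> from the tail above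
    \<open>j\<close>.\<close>
  define d0 where "d0 = min (s / 2) (1 / 2)"
  define N where "N = nat \<lceil>s\<rceil> + 1"
  have N: "real N \<ge> s + 1" unfolding N_def using s by linarith
  obtain C1 C2 where tc: "tail_const 0 C1" "tail_const N C2" using prod_coeff_tail by blast
  note C1 = tc(1)[unfolded tail_const_def, THEN conjunct1] tail_constD[OF tc(1)]
  note C2 = tc(2)[unfolded tail_const_def, THEN conjunct1] tail_constD[OF tc(2)]
  \<comment> \<open>The exponents \<open>N / 2\<close> and \<open>1 / 4\<close> pay for the lengths
    \<open>2 ^ Suc j\<close> and \<open>2 ^ Suc i\<close> of the sums, which are twice the dyadic
    scales.\<close>
  define C where "C = (C1 + C2) * 2 powr (real N / 2 + 1 / 4)"
  have "wnorm s (prod_coeff (hblock a i) (hblock b j)) l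
    \<le> C * ((2 powr (1 / 4 - s / 2)) ^ i * wnorm s a i * ((2 powr (- d0)) ^ gap l j * wnorm s b j))"
    if ij: "i \<le> j" for a b i j l
  proof -
    let ?Q = "prod_coeff (hblock a i) (hblock b j)"
    define D where "D = dnorm a i * dnorm b j"
    have D: "D \<ge> 0" by (simp add: D_def)
    have S: "finite (dyad l)" "dyad l \<subseteq> {2 ^ l - 1..}" by (auto simp: dyad_def)
    have K: "real (2 ^ l - 1) + 1 = 2 ^ l" by (simp add: of_nat_diff)
    have m: "1 \<le> (2 :: nat) ^ Suc i" "(2 :: nat) ^ Suc i \<le> 2 ^ Suc j"
      using ij by (simp, intro power_increasing) auto
    let ?x = "real i / 4 - d0 * real (gap l j) + real j * s / 2"
    have R: "(2 powr (1 / 4 - s / 2)) ^ i * wnorm s a i * ((2 powr (- d0)) ^ gap l j * wnorm s b j)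
        = 2 powr ?x * D"
      unfolding D_def powr_power_two by (simp add: algebra_simps flip: powr_add)
    have main: "wnorm s ?Q l
        \<le> C * (2 powr ?x * D)"
      if d: "dnorm ?Q l \<le> C' * 2 powr t * (2 powr ((real i + 1) / 4) * D)"
        and C': "0 \<le> C'" "C' \<le> C1 + C2"
        and t: "real l * s / 2 + t \<le> real N / 2 - d0 * real (gap l j) + real j * s / 2" for C' t
    proof -
      have "wnorm s ?Q l
          \<le> 2 powr (real l * s / 2) * (C' * 2 powr t * (2 powr ((real i + 1) / 4) * D))"
        by (intro mult_left_mono d) simp
      also have "\<dots> = C' * (2 powr (real l * s / 2 + t + (real i + 1) / 4) * D)"
        by (simp add: powr_add mult_ac)
      also have "\<dots> \<le> (C1 + C2) * (2 powr ((real N / 2 + 1 / 4) + ?x) * D)"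
        using C' D t by (intro mult_mono mult_right_mono powr_mono) (auto simp: field_simps)
      also have "\<dots> = C * (2 powr ?x * D)"
        unfolding C_def powr_add[of 2 "real N / 2 + 1 / 4"] by (simp add: mult_ac)
      finally show ?thesis .
    qed
    show ?thesis
    proof (cases "l \<le> j")
      case True
      have "dnorm ?Q l
          \<le> C1 * sqrt (real (2 ^ Suc j) / (real (2 ^ l - 1) + 1)) ^ 0 * sqrt (sqrt (real (2 ^ Suc i)))
            * ell2 (block a i) (2 ^ Suc i) * ell2 (block b j) (2 ^ Suc j)"
        unfolding dnorm_def by (rule C1(2)[OF block_0 block_0 m S])
      then have d: "dnorm ?Q l \<le> C1 * 2 powr 0 * (2 powr ((real i + 1) / 4) * D)"
        unfolding sqrt_sqrt_two_power ell2_block D_def by (simp add: mult_ac)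
      have "d0 * (real j - real l) \<le> s / 2 * (real j - real l)"
        using True by (intro mult_right_mono) (auto simp: d0_def)
      then have "real l * s / 2 + 0 \<le> real N / 2 - d0 * real (gap l j) + real j * s / 2"
        using True by (simp add: gap_def of_nat_diff algebra_simps)
      with main[OF d] C1(1) C2(1) show ?thesis unfolding R by simp
    next
      case False
      have "dnorm ?Q l
          \<le> C2 * sqrt (real (2 ^ Suc j) / (real (2 ^ l - 1) + 1)) ^ N * sqrt (sqrt (real (2 ^ Suc i)))
            * ell2 (block a i) (2 ^ Suc i) * ell2 (block b j) (2 ^ Suc j)"
        unfolding dnorm_def by (rule C2(2)[OF block_0 block_0 m S])
      then have d: "dnorm ?Q l
          \<le> C2 * 2 powr (real N * (real j + 1 - real l) / 2) * (2 powr ((real i + 1) / 4) * D)"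
        unfolding K sqrt_two_power_ratio sqrt_sqrt_two_power ell2_block D_def by (simp add: mult_ac)
      have "(real l - real j) * (s / 2 + d0) \<le> (real l - real j) * (real N / 2)"
        using False N by (intro mult_left_mono) (auto simp: d0_def)
      then have "real l * s / 2 + real N * (real j + 1 - real l) / 2
          \<le> real N / 2 - d0 * real (gap l j) + real j * s / 2"
        using False by (simp add: gap_def of_nat_diff field_simps)
      with main[OF d] C1(1) C2(1) show ?thesis unfolding R by simp
    qed
  qed
  moreover have "C \<ge> 0" using C1(1) C2(1) by (simp add: C_def)
  ultimately show ?thesis unfolding d0_def by blast
qed

lemma L2_set_sum_le:
  "L2_set (\<lambda>n. cmod (\<Sum>i\<in>I. f i n)) A \<le> (\<Sum>i\<in>I. L2_set (\<lambda>n. cmod (f i n)) A)"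
proof (induction I rule: infinite_finite_induct)
  case (insert i I)
  have "L2_set (\<lambda>n. cmod (\<Sum>i\<in>insert i I. f i n)) A
      \<le> L2_set (\<lambda>n. cmod (f i n) + cmod (\<Sum>i\<in>I. f i n)) A"
    using insert by (intro L2_set_mono) (auto intro: norm_triangle_ineq)
  also have "\<dots> \<le> L2_set (\<lambda>n. cmod (f i n)) A + L2_set (\<lambda>n. cmod (\<Sum>i\<in>I. f i n)) A"
    by (rule L2_set_triangle_ineq)
  finally show ?case using insert by simp
qed (simp_all add: L2_set_def)

abbreviation htrunc :: "L2 \<Rightarrow> nat \<Rightarrow> real \<Rightarrow> complex" where
  "htrunc v J \<equiv> herm_sum (hcoeff v) (2 ^ Suc J - 1)"

text \<open>Each pair of blocks is estimated with the coarser factor in \<open>L\<^sup>\<infinity>\<close>, where \<open>s > 1/2\<close> makes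
  the blocks geometrically summable, and the finer one in the weighted \<open>L\<^sup>2\<close> norm.\<close>

lemma product_trunc:
  fixes s :: real
  assumes s: "s > 1 / 2"
  shows "\<exists>C\<ge>0. \<forall>v\<in>sobolev s. \<forall>w\<in>sobolev s. \<forall>J L.
    (\<Sum>l\<le>L. (wnorm s (prod_coeff (htrunc v J) (htrunc w J)) l)\<^sup>2)
    \<le> (C * sobolev_norm s v * sobolev_norm s w)\<^sup>2"
proof -
  define g where "g = (2 :: real) powr (1 / 4 - s / 2)"
  define r where "r = (2 :: real) powr (- min (s / 2) (1 / 2))"
  have g: "0 \<le> g" "g < 1" unfolding g_def using s by (auto intro!: powr_less_one)
  have r: "0 \<le> r" "r < 1" unfolding r_def using s by (auto intro!: powr_less_one)
  define G where "G = 1 / (1 - g)"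
  define R where "R = 2 / (1 - r)"
  have GR: "G \<ge> 0" "R \<ge> 0" using g r by (auto simp: G_def R_def)
  have s0: "s \<ge> 0" using s by simp
  obtain C where C0: "C \<ge> 0" and C: "\<forall>a b i j l. i \<le> j \<longrightarrow>
      wnorm s (prod_coeff (hblock a i) (hblock b j)) l
      \<le> C * (g ^ i * wnorm s a i * (r ^ gap l j * wnorm s b j))"
    using block_product[OF s0] unfolding g_def r_def by blast
  note C = C[rule_format]
  have "(\<Sum>l\<le>L. (wnorm s (prod_coeff (htrunc v J) (htrunc w J)) l)\<^sup>2)
      \<le> ((2 * C * G * R) * sobolev_norm s v * sobolev_norm s w)\<^sup>2"
    if v: "v \<in> sobolev s" and w: "w \<in> sobolev s" for v w J L
  proof -
    let ?Q = "prod_coeff (htrunc v J) (htrunc w J)"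
    define x where "x = wnorm s (hcoeff v)"
    define y where "y = wnorm s (hcoeff w)"
    define X where "X = sobolev_norm s v"
    define Y where "Y = sobolev_norm s w"
    have X0: "X \<ge> 0" and Y0: "Y \<ge> 0" by (simp_all add: X_def Y_def)
    have xX: "x i \<le> X" and yY: "y i \<le> Y" and x0: "x i \<ge> 0" and y0: "y i \<ge> 0" for i
      unfolding x_def y_def X_def Y_def using wnorm_le_sobolev[OF s0] v w by auto
    define A where "A = (\<lambda>l. \<Sum>j\<le>J. r ^ gap l j * y j)"
    define B where "B = (\<lambda>l. \<Sum>i\<le>J. r ^ gap l i * x i)"
    have A0: "A l \<ge> 0" and B0: "B l \<ge> 0" for l
      unfolding A_def B_def using r x0 y0 by (auto intro!: sum_nonneg)
    let ?P = "\<lambda>i j. prod_coeff (hblock (hcoeff v) i) (hblock (hcoeff w) j)"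
    \<comment> \<open>One summand for each choice of the coarser block; both are nonnegative, so the
      sum bounds either case. The coarser block is estimated by the whole norm, its index sums
      geometrically, and only the finer index is left for Schur's test.\<close>
    let ?T = "\<lambda>i j l. g ^ i * X * (r ^ gap l j * y j) + g ^ j * Y * (r ^ gap l i * x i)"
    have term_le: "wnorm s (?P i j) l \<le> C * ?T i j l" for i j l
    proof (cases "i \<le> j")
      case True
      have "wnorm s (?P i j) l \<le> C * (g ^ i * x i * (r ^ gap l j * y j))"
        unfolding x_def y_def by (rule C[OF True])
      also have "\<dots> \<le> C * ?T i j l"
        using C0 g r x0 y0 xX Y0
        by (intro mult_left_mono add_increasing2 mult_right_mono) auto
      finally show ?thesis .
    next
      case False
      have "wnorm s (?P i j) l \<le> C * (g ^ j * y j * (r ^ gap l i * x i))"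
        unfolding x_def y_def prod_coeff_commute[of "hblock (hcoeff v) i"]
        using False by (intro C) simp
      also have "\<dots> \<le> C * ?T i j l"
        using C0 g r x0 y0 yY X0
        by (intro mult_left_mono add_increasing mult_right_mono) auto
      finally show ?thesis .
    qed
    have gs: "(\<Sum>i\<le>J. g ^ i) \<le> G" unfolding G_def using g by (intro sum_geometric_le) auto
    have "wnorm s ?Q l \<le> C * G * (X * A l + Y * B l)" for l
    proof -
      have split: "htrunc u J = (\<lambda>x. \<Sum>i\<le>J. hblock (hcoeff u) i x)" for u
        by (rule ext) (rule herm_sum_dyadic)
      have "?Q n = (\<Sum>i\<le>J. \<Sum>j\<le>J. ?P i j n)" for n
        unfolding split by (rule prod_coeff_sum) (rule rapid_herm_sum)+
      then have "dnorm ?Q l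
          \<le> (\<Sum>i\<le>J. L2_set (\<lambda>n. cmod (\<Sum>j\<le>J. ?P i j n)) (dyad l))"
        unfolding dnorm_def by (simp only: L2_set_sum_le)
      also have "\<dots> \<le> (\<Sum>i\<le>J. \<Sum>j\<le>J. dnorm (?P i j) l)"
        unfolding dnorm_def by (intro sum_mono L2_set_sum_le)
      finally have "wnorm s ?Q l \<le> (\<Sum>i\<le>J. \<Sum>j\<le>J. wnorm s (?P i j) l)"
        unfolding sum_distrib_left[symmetric] by (intro mult_left_mono) simp_all
      also have "\<dots> \<le> (\<Sum>i\<le>J. \<Sum>j\<le>J. C * ?T i j l)"
        by (intro sum_mono term_le)
      also have "\<dots> = C * ((\<Sum>i\<le>J. \<Sum>j\<le>J. g ^ i * X * (r ^ gap l j * y j))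
          + (\<Sum>i\<le>J. \<Sum>j\<le>J. g ^ j * Y * (r ^ gap l i * x i)))"
        by (simp only: sum_distrib_left[symmetric] sum.distrib)
      also have "(\<Sum>i\<le>J. \<Sum>j\<le>J. g ^ i * X * (r ^ gap l j * y j)) = (\<Sum>i\<le>J. g ^ i) * (X * A l)"
        unfolding A_def sum_distrib_left[of X] sum_product by (simp only: mult.assoc)
      also have "(\<Sum>i\<le>J. \<Sum>j\<le>J. g ^ j * Y * (r ^ gap l i * x i)) = (\<Sum>j\<le>J. g ^ j) * (Y * B l)"
        unfolding B_def sum_distrib_left[of Y] sum_product by (subst sum.swap) (simp only: mult.assoc)
      also have "C * ((\<Sum>i\<le>J. g ^ i) * (X * A l) + (\<Sum>j\<le>J. g ^ j) * (Y * B l))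
          \<le> C * (G * (X * A l) + G * (Y * B l))"
        using C0 X0 Y0 A0 B0 gs by (intro mult_left_mono add_mono mult_right_mono) auto
      finally show ?thesis by (simp add: algebra_simps)
    qed
    then have "(\<Sum>l\<le>L. (wnorm s ?Q l)\<^sup>2)
        \<le> (\<Sum>l\<le>L. (C * G * (X * A l + Y * B l))\<^sup>2)"
      by (intro sum_mono power_mono) auto
    also have "\<dots> \<le> (\<Sum>l\<le>L. 2 * (C * G)\<^sup>2 * (X\<^sup>2 * (A l)\<^sup>2 + Y\<^sup>2 * (B l)\<^sup>2))"
    proof (rule sum_mono)
      fix l
      have "0 \<le> (X * A l - Y * B l)\<^sup>2" by simp
      then have "(X * A l + Y * B l)\<^sup>2 \<le> 2 * (X\<^sup>2 * (A l)\<^sup>2 + Y\<^sup>2 * (B l)\<^sup>2)"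
        by (simp add: power2_eq_square algebra_simps)
      then have "(C * G)\<^sup>2 * (X * A l + Y * B l)\<^sup>2 \<le> (C * G)\<^sup>2 * (2 * (X\<^sup>2 * (A l)\<^sup>2 + Y\<^sup>2 * (B l)\<^sup>2))"
        by (rule mult_left_mono) simp
      then show "(C * G * (X * A l + Y * B l))\<^sup>2 \<le> 2 * (C * G)\<^sup>2 * (X\<^sup>2 * (A l)\<^sup>2 + Y\<^sup>2 * (B l)\<^sup>2)"
        unfolding power_mult_distrib[of "C * G"] by (simp only: mult.left_commute[of _ 2] mult.assoc[of 2])
    qed
    also have "\<dots> = 2 * (C * G)\<^sup>2 * (X\<^sup>2 * (\<Sum>l\<le>L. (A l)\<^sup>2) + Y\<^sup>2 * (\<Sum>l\<le>L. (B l)\<^sup>2))"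
      by (simp only: sum_distrib_left[symmetric] sum.distrib)
    also have "\<dots> \<le> 2 * (C * G)\<^sup>2 * (X\<^sup>2 * (R\<^sup>2 * Y\<^sup>2) + Y\<^sup>2 * (R\<^sup>2 * X\<^sup>2))"
    proof (intro mult_left_mono add_mono)
      have "(\<Sum>l\<le>L. (A l)\<^sup>2) \<le> R\<^sup>2 * (\<Sum>j\<le>J. (y j)\<^sup>2)"
        unfolding A_def R_def by (rule schur_gap[OF r y0])
      also have "\<dots> \<le> R\<^sup>2 * Y\<^sup>2"
        unfolding y_def Y_def by (intro mult_left_mono sum_wnorm_le_sobolev s0 w) simp
      finally show "(\<Sum>l\<le>L. (A l)\<^sup>2) \<le> R\<^sup>2 * Y\<^sup>2" .
      have "(\<Sum>l\<le>L. (B l)\<^sup>2) \<le> R\<^sup>2 * (\<Sum>j\<le>J. (x j)\<^sup>2)"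
        unfolding B_def R_def by (rule schur_gap[OF r x0])
      also have "\<dots> \<le> R\<^sup>2 * X\<^sup>2"
        unfolding x_def X_def by (intro mult_left_mono sum_wnorm_le_sobolev s0 v) simp
      finally show "(\<Sum>l\<le>L. (B l)\<^sup>2) \<le> R\<^sup>2 * X\<^sup>2" .
    qed simp_all
    also have "\<dots> = ((2 * C * G * R) * X * Y)\<^sup>2"
      by (simp add: power_mult_distrib)
    finally show ?thesis by (simp add: X_def Y_def)
  qed
  then show ?thesis using C0 GR by (intro exI[of _ "2 * C * G * R"]) auto
qed

text \<open>Sobolev embedding into bounded functions: block \<open>i\<close> contributes a multiple
  of \<open>g ^ i\<close>, and \<open>g < 1\<close> is exactly \<open>s > 1 / 2\<close>. The bound
  is uniform in the truncation.\<close>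

lemma htrunc_sup:
  fixes s :: real
  assumes s: "s > 1 / 2"
  shows "\<exists>C\<ge>0. \<forall>v\<in>sobolev s. \<forall>J x. cmod (htrunc v J x) \<le> C * sobolev_norm s v"
proof -
  define g where "g = (2 :: real) powr (1 / 4 - s / 2)"
  have g: "0 \<le> g" "g < 1" unfolding g_def using s by (auto intro!: powr_less_one)
  let ?k = "2 * 2 powr (1 / 4) :: real"
  define C where "C = ?k * (1 / (1 - g))"
  have "cmod (htrunc v J x) \<le> C * sobolev_norm s v" if v: "v \<in> sobolev s" for v J x
  proof -
    have blk: "cmod (hblock (hcoeff v) i x) \<le> ?k * sobolev_norm s v * g ^ i" for i
    proof -
      have "cmod (hblock (hcoeff v) i x) \<le> 2 * 2 powr ((real i + 1) / 4) * dnorm (hcoeff v) i"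
        using herm_sum_sup[of "2 ^ Suc i" "block (hcoeff v) i" x, OF block_0]
        unfolding sqrt_sqrt_two_power ell2_block .
      also have "\<dots> = ?k * g ^ i * wnorm s (hcoeff v) i"
      proof -
        have "2 powr ((real i + 1) / 4) = 2 powr (1 / 4) * (g ^ i * 2 powr (real i * s / 2))"
          unfolding g_def powr_power_two by (simp add: field_simps flip: powr_add)
        then show ?thesis by simp
      qed
      also have "\<dots> \<le> ?k * g ^ i * sobolev_norm s v"
        using g s v by (intro mult_left_mono wnorm_le_sobolev) auto
      finally show ?thesis by (simp add: mult_ac)
    qed
    have "cmod (htrunc v J x) \<le> (\<Sum>i\<le>J. ?k * sobolev_norm s v * g ^ i)"
      unfolding herm_sum_dyadic by (rule order_trans[OF norm_sum sum_mono[OF blk]])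
    also have "\<dots> = ?k * sobolev_norm s v * (\<Sum>i\<le>J. g ^ i)"
      by (simp only: sum_distrib_left)
    also have "\<dots> \<le> ?k * sobolev_norm s v * (1 / (1 - g))"
      using g by (intro mult_left_mono sum_geometric_le) auto
    finally show ?thesis by (simp add: C_def mult_ac)
  qed
  moreover have "C \<ge> 0" using g by (simp add: C_def)
  ultimately show ?thesis by blast
qed

section \<open>From truncations to the whole Sobolev space\<close>

lemma htrunc_tendsto: "(\<lambda>J. L2_of (htrunc v J)) \<longlonglongrightarrow> v"
proof -
  have "strict_mono (\<lambda>J. 2 ^ Suc J - 1 :: nat)"
    by (rule strict_monoI_Suc) (simp add: less_diff_conv)
  then show ?thesis
    using LIMSEQ_subseq_LIMSEQ[OF hermite_expansion[of v, unfolded sums_def]]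
    by (auto simp: L2_of_herm_sum comp_def)
qed

lemma sobolev_AE_bounded:
  assumes "\<And>J x. cmod (htrunc v J x) \<le> B"
  shows "AE x in lborel. cmod (rep_L2 v x) \<le> B"
proof -
  obtain r where "strict_mono r" "AE x in lborel. (\<lambda>n. htrunc v (r n) x) \<longlonglongrightarrow> rep_L2 v x"
    by (rule L2_tendsto_AE_subseq[OF htrunc_tendsto rapid_sq_int[OF rapid_herm_sum]])
  from this(2) show ?thesis
    by eventually_elim (rule tendsto_upperbound[OF tendsto_norm], use assms in auto)
qed

text \<open>The product estimate is known for truncations. Uniform sup bounds make the truncated
  products converge in \<open>L2\<close> to the true product, so each Hermite coefficient converges
  and every finite weighted sum inherits the bound.\<close>

lemma algebra_const_exists:
  fixes s :: real
  assumes s: "s > 1 / 2"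
  shows "\<exists>A>0. algebra_const s A"
proof -
  obtain B where B: "B \<ge> 0" "\<And>v J x. v \<in> sobolev s \<Longrightarrow> cmod (htrunc v J x) \<le> B * sobolev_norm s v"
    using htrunc_sup[OF s] by metis
  obtain C where C0: "C \<ge> 0" and C: "\<forall>v\<in>sobolev s. \<forall>w\<in>sobolev s. \<forall>J L.
      (\<Sum>l\<le>L. (wnorm s (prod_coeff (htrunc v J) (htrunc w J)) l)\<^sup>2)
      \<le> (C * sobolev_norm s v * sobolev_norm s w)\<^sup>2"
    using product_trunc[OF s] by blast
  note C = C0 C[rule_format]
  \<comment> \<open>\<open>2 powr s\<close> is the root of the weight comparison
    \<open>4 powr s\<close>; the summand 1 keeps \<open>A\<close> positive when
    \<open>C = 0\<close>.\<close>
  define A where "A = 2 powr s * C + 1"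
  have s0: "s \<ge> 0" using s by simp
  have "algebra_const s A"
    unfolding algebra_const_def
  proof (intro ballI)
    fix v w assume v: "v \<in> sobolev s" and w: "w \<in> sobolev s"
    let ?f = "rep_L2 v" and ?g = "rep_L2 w"
    define X Y where "X = sobolev_norm s v" and "Y = sobolev_norm s w"
    have XY: "X \<ge> 0" "Y \<ge> 0" by (simp_all add: X_def Y_def)
    have fB: "AE x in lborel. cmod (?f x) \<le> B * X" unfolding X_def by (rule sobolev_AE_bounded[OF B(2)[OF v]])
    have gB: "AE x in lborel. cmod (?g x) \<le> B * Y" unfolding Y_def by (rule sobolev_AE_bounded[OF B(2)[OF w]])
    note fm = sq_int_measurable[OF sq_int_rep]
    note tr = rapid_sq_int[OF rapid_herm_sum]
    have sq: "sq_int (\<lambda>x. ?f x * ?g x)" by (rule sq_int_bounded_mult[OF fm sq_int_rep fB])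
    define p where "p = L2_of (\<lambda>x. ?f x * ?g x)"
    let ?F = "\<lambda>J. L2_of (\<lambda>x. htrunc v J x * htrunc w J x)"
    let ?h = "\<lambda>J. B * X * norm (L2_of (htrunc w J) - w) + B * Y * norm (L2_of (htrunc v J) - v)"
    have lim: "?F \<longlonglongrightarrow> p"
    proof (rule LIM_zero_cancel, rule Lim_null_comparison)
      have n: "(\<lambda>J. norm (L2_of (htrunc u J) - u)) \<longlonglongrightarrow> 0" for u
        using htrunc_tendsto[of u] by (simp add: LIM_zero tendsto_norm_zero)
      show "?h \<longlonglongrightarrow> 0"
        by (rule tendsto_eq_intros n refl)+ simp
      show "\<forall>\<^sub>F J in sequentially. norm (?F J - p) \<le> ?h J"
      proof (intro always_eventually allI)
        fix J
        \<comment> \<open>The error telescopes: \<open>?a\<close> is controlled by the sup bound of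
          the truncation of \<open>v\<close>, \<open>?b\<close> by that of the limit
          \<open>w\<close>.\<close>
        let ?a = "\<lambda>x. htrunc v J x * (htrunc w J x - ?g x)"
        let ?b = "\<lambda>x. ?g x * (htrunc v J x - ?f x)"
        have bm: "AE x in lborel. cmod (htrunc v J x) \<le> B * X" using B(2)[OF v] by (simp add: X_def)
        have dw: "sq_int (\<lambda>x. htrunc w J x - ?g x)" and dv: "sq_int (\<lambda>x. htrunc v J x - ?f x)"
          by (intro sq_int_diff tr sq_int_rep)+
        have a: "sq_int ?a" by (rule sq_int_bounded_mult[OF sq_int_measurable[OF tr] dw bm])
        have b: "sq_int ?b" by (rule sq_int_bounded_mult[OF fm dv gB])
        have "?F J - p
            = L2_of (\<lambda>x. htrunc v J x * htrunc w J x - ?f x * ?g x)"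
          unfolding p_def by (intro L2_of_diff[symmetric] rapid_sq_int rapid_mult rapid_herm_sum sq)
        also have "(\<lambda>x. htrunc v J x * htrunc w J x - ?f x * ?g x) = (\<lambda>x. ?a x + ?b x)"
          by (rule ext) (simp add: algebra_simps)
        also have "L2_of \<dots> = L2_of ?a + L2_of ?b" by (rule L2_of_add[OF a b])
        finally have "norm (?F J - p) \<le> norm (L2_of ?a) + norm (L2_of ?b)"
          by (simp add: norm_triangle_ineq)
        also have "\<dots> \<le> B * X * norm (L2_of (\<lambda>x. htrunc w J x - ?g x))
            + B * Y * norm (L2_of (\<lambda>x. htrunc v J x - ?f x))"
          using B(1) XY
          by (intro add_mono norm_L2_bounded_mult[OF sq_int_measurable[OF tr] dw bm]
              norm_L2_bounded_mult[OF fm dv gB]) auto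
        finally show "norm (?F J - p) \<le> ?h J"
          by (simp add: L2_of_diff tr sq_int_rep L2_of_rep)
      qed
    qed
    let ?Q = "\<lambda>J. prod_coeff (htrunc v J) (htrunc w J)"
    have lc: "(\<lambda>J. ?Q J n) \<longlonglongrightarrow> hcoeff p n" for n
      using bounded_linear.tendsto[OF bounded_linear_hcoeff lim, of n]
      by (simp add: prod_coeff_hcoeff rapid_herm_sum)
    have part: "wsum s (hcoeff p) m \<le> 4 powr s * (C * X * Y)\<^sup>2" for m
    proof (rule tendsto_upperbound)
      show "(\<lambda>J. wsum s (?Q J) m)
          \<longlonglongrightarrow> wsum s (hcoeff p) m"
        by (intro tendsto_intros lc)
      have "wsum s (?Q J) m
          \<le> 4 powr s * (C * X * Y)\<^sup>2" for J
      proof -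
        \<comment> \<open>Any cut-off \<open>m\<close> lies within the first \<open>m + 1\<close>
          dyadic blocks, so arbitrary partial sums reduce to dyadic ones.\<close>
        have "m \<le> 2 ^ m - 1 + 1" using less_exp[of m] by simp
        also have "\<dots> \<le> 2 ^ Suc m - 1" by simp
        finally have "wsum s (?Q J) m
            \<le> wsum s (?Q J) (2 ^ Suc m - 1)"
          by (intro sum_mono2) auto
        also have "\<dots> \<le> 4 powr s * (\<Sum>l\<le>m. (wnorm s (?Q J) l)\<^sup>2)"
          by (rule le_sum_wnorm[OF s0])
        also have "\<dots> \<le> 4 powr s * (C * X * Y)\<^sup>2"
          unfolding X_def Y_def by (intro mult_left_mono C(2) v w) simp
        finally show ?thesis .
      qed
      then show "\<forall>\<^sub>F J in sequentially.
          wsum s (?Q J) m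
          \<le> 4 powr s * (C * X * Y)\<^sup>2" by simp
    qed simp
    have p: "p \<in> sobolev s"
      unfolding sobolev_iff by (rule bounded_imp_summable[OF _ part[of "Suc _", unfolded lessThan_Suc_atMost]]) simp
    have "(sobolev_norm s p)\<^sup>2 \<le> 4 powr s * (C * X * Y)\<^sup>2"
      using sobolev_norm_sums[OF p] part by (intro LIMSEQ_le_const2) (auto simp: sums_def)
    also have "(4 :: real) powr s = (2 powr s)\<^sup>2"
      by (simp add: power2_eq_square flip: powr_mult)
    finally have "(sobolev_norm s p)\<^sup>2 \<le> (2 powr s * C * X * Y)\<^sup>2"
      by (simp add: power_mult_distrib mult_ac)
    then have "sobolev_norm s p \<le> 2 powr s * C * X * Y"
      by (rule power2_le_imp_le) (intro mult_nonneg_nonneg XY C0 powr_ge_zero)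
    also have "\<dots> \<le> A * X * Y"
      unfolding A_def using XY by (intro mult_right_mono) auto
    finally show "sq_int (\<lambda>x. ?f x * ?g x) \<and> L2_of (\<lambda>x. ?f x * ?g x) \<in> sobolev s \<and>
        sobolev_norm s (L2_of (\<lambda>x. ?f x * ?g x)) \<le> A * sobolev_norm s v * sobolev_norm s w"
      using sq p by (simp add: p_def X_def Y_def)
  qed
  moreover have "A > 0" using C(1) by (simp add: A_def add_nonneg_pos)
  ultimately show ?thesis by blast
qed

section \<open>The nonlinearity\<close>

definition mul_L2 :: "L2 \<Rightarrow> L2 \<Rightarrow> L2" where
  "mul_L2 v w = L2_of (\<lambda>x. rep_L2 v x * rep_L2 w x)"

lemma
  assumes "algebra_const s A" "v \<in> sobolev s" "w \<in> sobolev s"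
  shows rep_mul_L2: "AE x in lborel. rep_L2 (mul_L2 v w) x = rep_L2 v x * rep_L2 w x"
    and mul_L2_mem: "mul_L2 v w \<in> sobolev s"
    and mul_L2_norm: "sobolev_norm s (mul_L2 v w) \<le> A * sobolev_norm s v * sobolev_norm s w"
  using assms unfolding algebra_const_def mul_L2_def by (auto intro: rep_L2_of)

lemma mul_L2_diff_left:
  assumes alg: "algebra_const s A" and "u \<in> sobolev s" "v \<in> sobolev s" "w \<in> sobolev s"
  shows "mul_L2 (u - v) w = mul_L2 u w - mul_L2 v w"
proof (rule L2_eqI)
  show "AE x in lborel. rep_L2 (mul_L2 (u - v) w) x = rep_L2 (mul_L2 u w - mul_L2 v w) x"
    using rep_mul_L2[OF alg sobolev_diff[OF assms(2,3)] assms(4)] rep_mul_L2[OF alg assms(2,4)]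
      rep_mul_L2[OF alg assms(3,4)] rep_diff[of u v] rep_diff[of "mul_L2 u w" "mul_L2 v w"]
    by eventually_elim (simp add: left_diff_distrib)
qed

lemma mul_L2_commute: "mul_L2 v w = mul_L2 w v"
  by (simp add: mul_L2_def mult.commute)

lemma mul_L2_diff_right:
  assumes alg: "algebra_const s A" and "u \<in> sobolev s" "v \<in> sobolev s" "w \<in> sobolev s"
  shows "mul_L2 w (u - v) = mul_L2 w u - mul_L2 w v"
  using mul_L2_diff_left[OF assms] by (simp add: mul_L2_commute)

lemma sobolev_conj_L2:
  assumes "v \<in> sobolev s"
  shows "conj_L2 v \<in> sobolev s" "sobolev_norm s (conj_L2 v) = sobolev_norm s v"
  using sobolev_cmod_eq[OF _ assms, of "conj_L2 v"] by (simp_all add: hcoeff_conj_L2)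

lemma conj_L2_diff: "conj_L2 (v - w) = conj_L2 v - conj_L2 w"
  by (rule hcoeff_eqI) (simp add: hcoeff_conj_L2)

abbreviation nlfun :: "nat \<Rightarrow> L2 \<Rightarrow> real \<Rightarrow> complex" where
  "nlfun k v x \<equiv> of_real (cmod (rep_L2 v x) ^ (2 * k)) * rep_L2 v x"

lemma nlfun_measurable: "nlfun k v \<in> borel_measurable lborel"
proof -
  have [measurable]: "rep_L2 v \<in> borel_measurable borel" using sq_int_measurable[OF sq_int_rep] by simp
  show ?thesis by measurable
qed

text \<open>Agreement a.e. with an element of \<open>L2\<close> first yields square integrability of
  the power, so \<open>L2_of\<close> does not fall back on its default value 0.\<close>

lemma nonlin_eqI:
  assumes "AE x in lborel. nlfun k v x = rep_L2 w x"
  shows "sq_int (nlfun k v)" "nonlin k v = w"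
proof -
  show sq: "sq_int (nlfun k v)" 
    by (rule sq_int_dominated[OF nlfun_measurable sq_int_rep, of _ _ 1 w])
      (use assms in eventually_elim, simp)
  show "nonlin k v = w"
    unfolding nonlin_def using L2_of_cong[OF sq sq_int_rep assms] by (simp add: L2_of_rep)
qed

lemma nonlin_0 [simp]: "nonlin 0 v = v"
  by (rule nonlin_eqI) simp

lemma
  assumes alg: "algebra_const s A" and v: "v \<in> sobolev s"
  shows nonlin_mem: "nonlin k v \<in> sobolev s"
    and nonlin_sq_int: "sq_int (nlfun k v)"
    and nonlin_Suc: "nonlin (Suc k) v = mul_L2 (mul_L2 v (conj_L2 v)) (nonlin k v)"
proof -
  note c = sobolev_conj_L2(1)[OF v]
  note vc = mul_L2_mem[OF alg v c]
  have step: "AE x in lborel. nlfun (Suc k) v x = rep_L2 (mul_L2 (mul_L2 v (conj_L2 v)) (nonlin k v)) x"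
    if "nonlin k v \<in> sobolev s" "sq_int (nlfun k v)" for k
    using rep_mul_L2[OF alg vc that(1)] rep_mul_L2[OF alg v c] rep_conj_L2[of v]
      rep_L2_of[OF that(2), folded nonlin_def]
  proof eventually_elim
    case (elim x)
    have "rep_L2 v x * cnj (rep_L2 v x) = of_real ((cmod (rep_L2 v x))\<^sup>2)"
      by (rule complex_norm_square[symmetric])
    with elim show ?case by (simp add: power2_eq_square mult_ac)
  qed
  \<comment> \<open>Membership and square integrability are proved jointly, since
    \<open>step\<close> needs both to identify the next power with a product of Sobolev
    functions.\<close>
  have both: "nonlin k v \<in> sobolev s \<and> sq_int (nlfun k v)" for k
  proof (induction k)
    case 0
    then show ?case by (simp add: v sq_int_rep)
  next
    case (Suc k)
    have "nonlin (Suc k) v = mul_L2 (mul_L2 v (conj_L2 v)) (nonlin k v)"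
      by (rule nonlin_eqI(2)[OF step]) (use Suc in auto)
    moreover have "sq_int (nlfun (Suc k) v)"
      by (rule nonlin_eqI(1)[OF step]) (use Suc in auto)
    ultimately show ?case using mul_L2_mem[OF alg vc, of "nonlin k v"] Suc by metis
  qed
  show "nonlin k v \<in> sobolev s" "sq_int (nlfun k v)" using both by auto
  show "nonlin (Suc k) v = mul_L2 (mul_L2 v (conj_L2 v)) (nonlin k v)"
    by (rule nonlin_eqI(2)[OF step]) (use both in auto)
qed

text \<open>The power is built by \<open>2 * k\<close> multiplications, each costing one factor
  \<open>A\<close>.\<close>

lemma nonlin_norm:
  assumes alg: "algebra_const s A" and v: "v \<in> sobolev s" and A: "A \<ge> 0"
    and le: "sobolev_norm s v \<le> R"
  shows "sobolev_norm s (nonlin k v) \<le> A ^ (2 * k) * R ^ (2 * k + 1)"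
proof (induction k)
  case 0
  then show ?case by (simp add: le)
next
  case (Suc k)
  note c = sobolev_conj_L2[OF v]
  note vc = mul_L2_mem[OF alg v c(1)]
  have R: "R \<ge> 0" using sobolev_norm_nonneg[of s v] le by linarith
  have 1: "sobolev_norm s (mul_L2 v (conj_L2 v)) \<le> A * R * R"
    using mul_L2_norm[OF alg v c(1)] A R le
    by (elim order_trans) (auto simp: c(2) intro!: mult_mono)
  have "sobolev_norm s (nonlin (Suc k) v)
      \<le> A * sobolev_norm s (mul_L2 v (conj_L2 v)) * sobolev_norm s (nonlin k v)"
    unfolding nonlin_Suc[OF alg v] by (rule mul_L2_norm[OF alg vc nonlin_mem[OF alg v]])
  also have "\<dots> \<le> A * (A * R * R) * (A ^ (2 * k) * R ^ (2 * k + 1))"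
    using A R by (intro mult_mono 1 Suc order_refl) auto
  also have "\<dots> = A ^ (2 * Suc k) * R ^ (2 * Suc k + 1)" by (simp add: mult_ac)
  finally show ?case .
qed

text \<open>Factors are replaced one at a time. Each step adds two terms, for \<open>v\<close> and
  for its conjugate, and so raises \<open>2 * k + 1\<close> by two.\<close>

lemma nonlin_lipschitz:
  assumes alg: "algebra_const s A" and A: "A \<ge> 0" and v: "v \<in> sobolev s" and w: "w \<in> sobolev s"
    and le: "sobolev_norm s v \<le> R" "sobolev_norm s w \<le> R"
  shows "sobolev_norm s (nonlin k v - nonlin k w)
    \<le> (2 * real k + 1) * A ^ (2 * k) * R ^ (2 * k) * sobolev_norm s (v - w)"
proof (induction k)
  case 0
  then show ?case by simp
next
  case (Suc k)
  let ?n = "sobolev_norm s" and ?v = "conj_L2 v" and ?w = "conj_L2 w"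
  define d where "d = ?n (v - w)"
  have R: "R \<ge> 0" using sobolev_norm_nonneg[of s v] le by linarith
  note cv = sobolev_conj_L2[OF v] and cw = sobolev_conj_L2[OF w]
  note vw = sobolev_diff[OF v w]
  have cd: "?v - ?w \<in> sobolev s" "?n (?v - ?w) = d"
    using sobolev_conj_L2[OF vw] by (simp_all add: conj_L2_diff d_def)
  note nv = nonlin_mem[OF alg v, of k] and nw = nonlin_mem[OF alg w, of k]
  note nd = sobolev_diff[OF nv nw]
  have m: "mul_L2 a b \<in> sobolev s" if "a \<in> sobolev s" "b \<in> sobolev s" for a b
    using mul_L2_mem[OF alg that] .
  have mn: "?n (mul_L2 a b) \<le> A * x * y" if "a \<in> sobolev s" "b \<in> sobolev s" "?n a \<le> x" "?n b \<le> y" for a b x y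
  proof -
    have "?n (mul_L2 a b) \<le> A * ?n a * ?n b" by (rule mul_L2_norm[OF alg that(1,2)])
    also have "\<dots> \<le> A * x * y"
      using A that order_trans[OF sobolev_norm_nonneg that(3)] by (intro mult_mono) auto
    finally show ?thesis .
  qed
  define M where "M = A ^ (2 * k) * R ^ (2 * k + 1)"
  have N: "?n (nonlin k v) \<le> M" unfolding M_def by (rule nonlin_norm[OF alg v A le(1)])
  have "nonlin (Suc k) v - nonlin (Suc k) w
      = mul_L2 (mul_L2 (v - w) ?v) (nonlin k v) + mul_L2 (mul_L2 w (?v - ?w)) (nonlin k v)
        + mul_L2 (mul_L2 w ?w) (nonlin k v - nonlin k w)"
    unfolding nonlin_Suc[OF alg v] nonlin_Suc[OF alg w]
    by (simp add: mul_L2_diff_left[OF alg] mul_L2_diff_right[OF alg] m v w vw cv cw cd nv nw nd)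
  also have "?n \<dots> \<le> ?n (mul_L2 (mul_L2 (v - w) ?v) (nonlin k v))
      + ?n (mul_L2 (mul_L2 w (?v - ?w)) (nonlin k v)) + ?n (mul_L2 (mul_L2 w ?w) (nonlin k v - nonlin k w))"
    by (intro order_trans[OF sobolev_norm_triangle] add_right_mono sobolev_norm_triangle sobolev_add
        m v w vw cv cw cd nv nw nd)
  also have "\<dots> \<le> A * (A * d * R) * M + A * (A * R * d) * M
      + A * (A * R * R) * ((2 * real k + 1) * A ^ (2 * k) * R ^ (2 * k) * d)"
    using Suc le by (intro add_mono mn m v w vw cv(1) cw(1) cd(1) nv nw nd N) (simp_all add: cv cw cd d_def)
  also have "\<dots> = (2 * real (Suc k) + 1) * A ^ (2 * Suc k) * R ^ (2 * Suc k) * d"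
    by (simp add: M_def algebra_simps)
  finally show ?case by (simp add: d_def)
qed

text \<open>The modulus does not see the factor \<open>\<i>\<close>, and reflection preserves null
  sets, so the pointwise power commutes with both.\<close>

lemma nonlin_half_period:
  assumes alg: "algebra_const s A" and v: "v \<in> sobolev s"
  shows "nonlin k (propagator (pi / 2) v) = propagator (pi / 2) (nonlin k v)"
proof (rule nonlin_eqI)
  show "AE x in lborel. nlfun k (propagator (pi / 2) v) x = rep_L2 (propagator (pi / 2) (nonlin k v)) x"
    unfolding propagator_half_pi
    using rep_scaleC[of \<i> "reflect_L2 v"] rep_scaleC[of \<i> "reflect_L2 (nonlin k v)"]
      rep_reflect_L2[of v] rep_reflect_L2[of "nonlin k v"]
      AE_reflect[OF rep_L2_of[OF nonlin_sq_int[OF alg v, of k], folded nonlin_def]]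
    by eventually_elim (simp add: norm_mult)
qed

section \<open>Averaging of periodic equations in Banach spaces\<close>

lemmas hk_combine = Henstock_Kurzweil_Integration.integral_combine
lemmas hk_diff = Henstock_Kurzweil_Integration.integral_diff
lemmas hk_idiff = Henstock_Kurzweil_Integration.integrable_diff

lemma continuous_on_majorant:
  fixes f :: "'a :: topological_space \<Rightarrow> 'b :: real_normed_vector"
  assumes "\<And>t q. t \<in> S \<Longrightarrow> q \<in> S \<Longrightarrow> norm (f q - f t) \<le> h t q"
    and "\<And>t. t \<in> S \<Longrightarrow> (h t \<longlongrightarrow> 0) (at t within S)"
  shows "continuous_on S f"
  unfolding continuous_on_def
proof
  fix t assume t: "t \<in> S"
  have "\<forall>\<^sub>F q in at t within S. norm (f q - f t) \<le> h t q"
    unfolding eventually_at_filter using assms(1)[OF t] by (intro always_eventually) auto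
  then show "(f \<longlongrightarrow> f t) (at t within S)"
    using assms(2)[OF t] by (rule LIM_zero_cancel[OF Lim_null_comparison])
qed

lemma continuous_on_lipschitz_comp:
  fixes f :: "'a :: topological_space \<Rightarrow> 'b :: real_normed_vector"
  assumes v: "continuous_on S v"
    and le: "\<And>t q. t \<in> S \<Longrightarrow> q \<in> S \<Longrightarrow> norm (f q - f t) \<le> L * norm (v q - v t :: 'c :: real_normed_vector)"
  shows "continuous_on S f"
proof (rule continuous_on_majorant[OF le])
  fix t assume "t \<in> S"
  then have "(v \<longlongrightarrow> v t) (at t within S)" using v by (simp add: continuous_on_def)
  then show "((\<lambda>q. L * norm (v q - v t)) \<longlongrightarrow> 0) (at t within S)"
    by (intro tendsto_mult_right_zero tendsto_norm_zero LIM_zero)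
qed

section \<open>Gronwall's inequality and elementary integrals\<close>

lemma gronwall:
  fixes f :: "real \<Rightarrow> real"
  assumes f: "continuous_on {0..t} f" and t: "t \<ge> 0"
    and le: "\<And>q. q \<in> {0..t} \<Longrightarrow> f q \<le> a + L * integral {0..q} f" and L: "L \<ge> 0"
  shows "f t \<le> a * exp (L * t)"
proof -
  define I where "I = (\<lambda>q. integral {0..q} f)"
  \<comment> \<open>The integrating factor times the majorant: the hypothesis \<open>le\<close> says
    exactly that its derivative is nonpositive.\<close>
  define G where "G = (\<lambda>q. exp (- L * q) * (a + L * I q))"
  have Id: "(I has_real_derivative f q) (at q within {0..t})" if "q \<in> {0..t}" for q
    unfolding I_def by (rule integral_has_real_derivative[OF f that])
  have "G t \<le> G 0"
  proof (rule DERIV_nonpos_imp_decreasing_open[OF t])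
    have "continuous_on {0..t} I" using Id by (rule DERIV_continuous_on)
    then show "continuous_on {0..t} G" unfolding G_def by (intro continuous_intros)
    fix q assume q: "0 < q" "q < t"
    then have "(I has_real_derivative f q) (at q)"
      using Id[of q] by (simp add: at_within_Icc_at)
    then have "(G has_real_derivative exp (- L * q) * (L * (f q - (a + L * I q)))) (at q)"
      unfolding G_def by (auto intro!: derivative_eq_intros simp: algebra_simps)
    moreover have "exp (- L * q) * (L * (f q - (a + L * I q))) \<le> 0"
      using le[of q] q L by (intro mult_nonneg_nonpos) (auto simp: I_def)
    ultimately show "\<exists>y. (G has_real_derivative y) (at q) \<and> y \<le> 0" by blast
  qed
  then have "exp (- L * t) * (a + L * I t) \<le> a" by (simp add: G_def I_def)
  then have le': "exp (L * t) * (exp (- L * t) * (a + L * I t)) \<le> exp (L * t) * a"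
    by (rule mult_left_mono) simp
  have e: "exp (L * t) * (exp (- L * t) * z) = z" for z
    by (simp add: mult.assoc[symmetric] flip: exp_add)
  from le'[unfolded e] have "a + L * I t \<le> a * exp (L * t)" by (simp only: mult.commute)
  then show ?thesis using le[of t] t by (simp add: I_def)
qed

lemma integral_abs_midpoint:
  fixes a b :: real
  assumes "a \<le> b"
  shows "((\<lambda>q. \<bar>q - (a + b) / 2\<bar>) has_integral (b - a)\<^sup>2 / 4) {a..b}"
proof -
  let ?c = "(a + b) / 2"
  have d: "((\<lambda>q. s * (q - ?c)\<^sup>2 / 2) has_vector_derivative s * (q - ?c)) (at q within A)" for s q A
    unfolding has_real_derivative_iff_has_vector_derivative[symmetric]
    by (auto intro!: derivative_eq_intros)
  have "((\<lambda>q. - 1 * (q - ?c)) has_integral (- 1 * (?c - ?c)\<^sup>2 / 2 - - 1 * (a - ?c)\<^sup>2 / 2)) {a..?c}"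
    by (rule fundamental_theorem_of_calculus) (use assms d[of "- 1"] in auto)
  then have 1: "((\<lambda>q. \<bar>q - ?c\<bar>) has_integral (a - ?c)\<^sup>2 / 2) {a..?c}"
    by (rule has_integral_eq_rhs[OF has_integral_eq[rotated]]) auto
  have "((\<lambda>q. 1 * (q - ?c)) has_integral (1 * (b - ?c)\<^sup>2 / 2 - 1 * (?c - ?c)\<^sup>2 / 2)) {?c..b}"
    by (rule fundamental_theorem_of_calculus) (use assms d[of 1] in auto)
  then have 2: "((\<lambda>q. \<bar>q - ?c\<bar>) has_integral (b - ?c)\<^sup>2 / 2) {?c..b}"
    by (rule has_integral_eq_rhs[OF has_integral_eq[rotated]]) auto
  have "((\<lambda>q. \<bar>q - ?c\<bar>) has_integral (a - ?c)\<^sup>2 / 2 + (b - ?c)\<^sup>2 / 2) {a..b}"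
    using assms by (intro has_integral_combine[OF _ _ 1 2]) auto
  then show ?thesis by (rule has_integral_eq_rhs) (simp add: power2_eq_square field_simps)
qed

lemma integral_periodic:
  fixes f :: "real \<Rightarrow> 'a :: banach"
  assumes f: "continuous_on UNIV f" and per: "\<And>x. f (x + P) = f x" and P: "P \<ge> 0"
  shows "integral {a..a + P} f = integral {b..b + P} f"
proof -
  have cont: "continuous_on S f" for S using f continuous_on_subset by blast
  have int: "f integrable_on {x..y}" for x y by (rule integrable_continuous_interval[OF cont])
  have "integral {a..a + P} f = integral {b..b + P} f" if "a \<le> b" for a b
  proof -
    have "((\<lambda>x. f (1 *\<^sub>R x + P)) has_integral (1 / \<bar>1\<bar> ^ DIM(real)) *\<^sub>R integral {a + P..b + P} f)
        ((\<lambda>x. (1 / 1) *\<^sub>R x + - ((1 / 1) *\<^sub>R P)) ` cbox (a + P) (b + P))"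
      using int by (intro has_integral_affinity) (auto intro: integrable_integral)
    then have "(f has_integral integral {a + P..b + P} f) {a..b}"
      by (simp add: per)
    then have "integral {a..b} f = integral {a + P..b + P} f" by (rule integral_unique)
    moreover have "integral {a..b} f + integral {b..b + P} f = integral {a..b + P} f"
      using that P by (intro hk_combine int) auto
    moreover have "integral {a..a + P} f + integral {a + P..b + P} f = integral {a..b + P} f"
      using that P by (intro hk_combine int) auto
    ultimately show ?thesis by (metis add.commute add_left_cancel)
  qed
  then show ?thesis by (metis linear)
qed

text \<open>Bounds are asked only on the ball of radius \<open>R\<close>, where both curves stay:
  the power nonlinearity comes with a Lipschitz bound that depends on \<open>R\<close>.\<close>

locale periodic_field =
  fixes F :: "real \<Rightarrow> 'a :: banach \<Rightarrow> 'a" and P L M R :: real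
  assumes P: "P > 0" and L: "L \<ge> 0" and M: "M \<ge> 0"
    and cont: "\<And>y. norm y \<le> R \<Longrightarrow> continuous_on UNIV (\<lambda>t. F t y)"
    and lip: "\<And>t x y. norm x \<le> R \<Longrightarrow> norm y \<le> R \<Longrightarrow> norm (F t x - F t y) \<le> L * norm (x - y)"
    and bnd: "\<And>t y. norm y \<le> R \<Longrightarrow> norm (F t y) \<le> M"
    and per: "\<And>t y. norm y \<le> R \<Longrightarrow> F (t + P) y = F t y"
begin

text \<open>For \<open>P = pi / 2\<close> this is the integral over
  \<open>{- pi / 4..pi / 4}\<close> with the factor \<open>2 / pi\<close> of the resonant
  equation.\<close>

definition Av :: "'a \<Rightarrow> 'a" where
  "Av y = (1 / P) *\<^sub>R integral {- P / 2..P / 2} (\<lambda>r. F r y)"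

lemma F_int: "norm y \<le> R \<Longrightarrow> (\<lambda>t. F t y) integrable_on {a..b}"
  by (rule integrable_continuous_interval[OF continuous_on_subset[OF cont]]) auto

lemma F_cont:
  assumes v: "continuous_on {0..T} v" "\<And>t. t \<in> {0..T} \<Longrightarrow> norm (v t) \<le> R"
  shows "continuous_on {0..T} (\<lambda>t. F t (v t))"
proof (rule continuous_on_majorant)
  fix t assume t: "t \<in> {0..T}"
  have "(v \<longlongrightarrow> v t) (at t within {0..T})" "((\<lambda>q. F q (v t)) \<longlongrightarrow> F t (v t)) (at t within {0..T})"
    using v(1) continuous_on_subset[OF cont[OF v(2)[OF t]], of "{0..T}"] t
    by (auto simp: continuous_on_def)
  then show "((\<lambda>q. L * norm (v q - v t) + norm (F q (v t) - F t (v t))) \<longlongrightarrow> 0) (at t within {0..T})"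
    by (auto intro!: tendsto_eq_intros)
  fix q assume "q \<in> {0..T}"
  then have "norm (F q (v q) - F q (v t)) \<le> L * norm (v q - v t)" by (intro lip v t)
  then show "norm (F q (v q) - F t (v t)) \<le> L * norm (v q - v t) + norm (F q (v t) - F t (v t))"
    using norm_triangle_ineq[of "F q (v q) - F q (v t)" "F q (v t) - F t (v t)"] by simp
qed

lemma Av_period:
  assumes "norm y \<le> R"
  shows "integral {a..a + P} (\<lambda>t. F t y) = P *\<^sub>R Av y"
  using integral_periodic[OF cont[OF assms] per[OF assms], of a "- P / 2"] P by (simp add: Av_def)

lemma Av_lip:
  assumes x: "norm x \<le> R" and y: "norm y \<le> R"
  shows "norm (Av x - Av y) \<le> L * norm (x - y)"
proof -
  have "Av x - Av y = (1 / P) *\<^sub>R integral {- P / 2..P / 2} (\<lambda>r. F r x - F r y)"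
    unfolding Av_def hk_diff[OF F_int[OF x] F_int[OF y]]
    by (simp add: scaleR_diff_right)
  moreover have "norm (integral {- P / 2..P / 2} (\<lambda>r. F r x - F r y)) \<le> L * norm (x - y) * (P / 2 - - P / 2)"
    using P by (intro integral_bound lip x y continuous_intros continuous_on_subset[OF cont]) auto
  ultimately show ?thesis using P by (simp add: field_simps)
qed

lemma Av_bnd:
  assumes y: "norm y \<le> R"
  shows "norm (Av y) \<le> M"
proof -
  have "norm (integral {- P / 2..P / 2} (\<lambda>r. F r y)) \<le> M * (P / 2 - - P / 2)"
    using P by (intro integral_bound bnd y continuous_on_subset[OF cont]) auto
  then show ?thesis using P by (simp add: Av_def field_simps)
qed

lemma Av_cont:
  assumes v: "continuous_on {0..T} v" "\<And>t. t \<in> {0..T} \<Longrightarrow> norm (v t) \<le> R"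
  shows "continuous_on {0..T} (\<lambda>t. Av (v t))"
  using v(1) by (rule continuous_on_lipschitz_comp[where L = L]) (intro Av_lip v(2))

end

text \<open>Averaging without differentiating in the phase variable: on each period the slow solution is
  frozen at the midpoint of the interval, where the drift \<open>|q - c|\<close> has mean \<open>P / 4\<close>. The
  oscillating part integrates to zero over full periods and to at most \<open>P M / 2\<close> over the last,
  incomplete one.\<close>

locale averaged_curve = periodic_field F P L M R
  for F :: "real \<Rightarrow> 'a :: banach \<Rightarrow> 'a" and P L M R :: real +
  fixes T :: real and w :: "real \<Rightarrow> 'a"
  assumes w_cont: "continuous_on {0..T} w" and w_bnd: "\<And>t. t \<in> {0..T} \<Longrightarrow> norm (w t) \<le> R"
    and w_eq: "\<And>t. t \<in> {0..T} \<Longrightarrow> w t = w 0 + integral {0..t} (\<lambda>q. Av (w q))"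
begin

lemmas w_Av_cont = Av_cont[OF w_cont w_bnd]

lemma w_lipschitz:
  assumes "a \<in> {0..T}" "b \<in> {0..T}"
  shows "norm (w a - w b) \<le> M * \<bar>a - b\<bar>"
proof -
  have "norm (w b - w a) \<le> M * (b - a)" if ab: "a \<in> {0..T}" "b \<in> {0..T}" "a \<le> b" for a b
  proof -
    have i: "(\<lambda>q. Av (w q)) integrable_on {x..y}" if "0 \<le> x" "y \<le> T" for x y
      by (rule integrable_continuous_interval[OF continuous_on_subset[OF w_Av_cont]]) (use that in auto)
    have "integral {0..a} (\<lambda>q. Av (w q)) + integral {a..b} (\<lambda>q. Av (w q)) = integral {0..b} (\<lambda>q. Av (w q))"
      using ab by (intro hk_combine i) auto
    then have "w b - w a = integral {a..b} (\<lambda>q. Av (w q))"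
      using w_eq[OF ab(1)] w_eq[OF ab(2)] by (simp add: algebra_simps)
    moreover have "norm (integral {a..b} (\<lambda>q. Av (w q))) \<le> M * (b - a)"
      using ab by (intro integral_bound Av_bnd w_bnd continuous_on_subset[OF w_Av_cont]) auto
    ultimately show ?thesis by simp
  qed
  from this[of a b] this[of b a] assms show ?thesis
    by (cases "a \<le> b") (auto simp: norm_minus_commute)
qed

definition D :: "real \<Rightarrow> 'a" where "D q = F q (w q) - Av (w q)"

lemma D_cont: "continuous_on {0..T} D"
  unfolding D_def by (intro continuous_intros F_cont w_Av_cont w_cont w_bnd)

lemma D_int: "0 \<le> a \<Longrightarrow> b \<le> T \<Longrightarrow> D integrable_on {a..b}"
  by (rule integrable_continuous_interval[OF continuous_on_subset[OF D_cont]]) auto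

lemma D_freeze:
  assumes ab: "0 \<le> a" "a \<le> b" "b \<le> T"
  defines "y \<equiv> w ((a + b) / 2)"
  shows "norm (integral {a..b} D) \<le> norm (integral {a..b} (\<lambda>q. F q y - Av y)) + L * M * (b - a)\<^sup>2 / 2"
proof -
  let ?c = "(a + b) / 2" and ?g = "\<lambda>q. F q y - Av y"
  have c: "?c \<in> {0..T}" using ab by auto
  have y: "norm y \<le> R" unfolding y_def by (rule w_bnd[OF c])
  have i: "?g integrable_on {a..b}"
    by (intro hk_idiff F_int y) auto
  \<comment> \<open>\<open>F q\<close> and \<open>Av\<close> are both Lipschitz with constant
    \<open>L\<close> and \<open>w\<close> moves at speed at most \<open>M\<close>, whence
    \<open>2 * L * M\<close> times the distance to the midpoint.\<close>
  have "norm (integral {a..b} (\<lambda>q. D q - (F q y - Av y)))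
      \<le> integral {a..b} (\<lambda>q. 2 * L * M * \<bar>q - ?c\<bar>)"
  proof (rule integral_norm_bound_integral)
    show "(\<lambda>q. D q - (F q y - Av y)) integrable_on {a..b}"
      by (intro hk_idiff D_int i ab)
    show "(\<lambda>q. 2 * L * M * \<bar>q - ?c\<bar>) integrable_on {a..b}"
      by (intro integrable_continuous_interval continuous_intros)
    fix q assume "q \<in> {a..b}"
    then have t: "q \<in> {0..T}" using ab by auto
    have "norm (F q (w q) - F q y) \<le> L * norm (w q - y)" "norm (Av (w q) - Av y) \<le> L * norm (w q - y)"
      by (intro lip Av_lip y w_bnd t)+
    then have "norm ((F q (w q) - F q y) - (Av (w q) - Av y)) \<le> 2 * L * norm (w q - y)"
      using norm_triangle_ineq4[of "F q (w q) - F q y" "Av (w q) - Av y"] by linarith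
    moreover have "D q - (F q y - Av y) = (F q (w q) - F q y) - (Av (w q) - Av y)"
      by (simp add: D_def)
    ultimately have "norm (D q - (F q y - Av y)) \<le> 2 * L * norm (w q - y)"
      by (simp only:)
    also have "\<dots> \<le> 2 * L * (M * \<bar>q - ?c\<bar>)"
      unfolding y_def using L by (intro mult_left_mono w_lipschitz t c) auto
    finally show "norm (D q - (F q y - Av y)) \<le> 2 * L * M * \<bar>q - ?c\<bar>" by (simp add: mult_ac)
  qed
  also have "\<dots> = 2 * L * M * ((b - a)\<^sup>2 / 4)"
    by (rule integral_unique, rule has_integral_mult_right, rule integral_abs_midpoint, rule ab)
  finally have "norm (integral {a..b} D - integral {a..b} ?g) \<le> L * M * (b - a)\<^sup>2 / 2"
    by (simp add: hk_diff[OF D_int[OF ab(1,3)] i])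
  then show ?thesis using norm_triangle_sub[of "integral {a..b} D" "integral {a..b} ?g"] by linarith
qed

lemma oscillation:
  assumes y: "norm y \<le> R" and ab: "a \<le> b" "b \<le> a + P"
  shows "norm (integral {a..b} (\<lambda>q. F q y - Av y)) \<le> M * P / 2"
proof -
  let ?f = "\<lambda>q. F q y"
  define h where "h = (b - a) / P"
  have h: "0 \<le> h" "h \<le> 1" "b - a = h * P" using ab P by (auto simp: h_def field_simps)
  have split: "integral {a..b} ?f + integral {b..a + P} ?f = P *\<^sub>R Av y"
    unfolding Av_period[OF y, of a, symmetric]
    using ab by (intro hk_combine F_int[OF y]) auto
  have "integral {a..b} (\<lambda>q. F q y - Av y) = integral {a..b} ?f - (b - a) *\<^sub>R Av y"
    using ab by (subst hk_diff) (auto intro: F_int y)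
  \<comment> \<open>Subtracting the mean mixes the piece and its complement in the period with
    weights \<open>1 - h\<close> and \<open>h\<close>. Each contributes at most
    \<open>M * P * h * (1 - h)\<close>, hence a quarter of \<open>M * P\<close>; estimating
    integrand and mean separately would give up to \<open>2 * M * P\<close>.\<close>
  also have "(b - a) *\<^sub>R Av y = h *\<^sub>R (integral {a..b} ?f + integral {b..a + P} ?f)"
    unfolding split by (simp add: h)
  also have "integral {a..b} ?f - \<dots> = (1 - h) *\<^sub>R integral {a..b} ?f - h *\<^sub>R integral {b..a + P} ?f"
    by (simp add: algebra_simps)
  also have "norm \<dots> \<le> (1 - h) * norm (integral {a..b} ?f) + h * norm (integral {b..a + P} ?f)"
    using h by (intro order_trans[OF norm_triangle_ineq4]) simp
  also have "\<dots> \<le> (1 - h) * (M * (b - a)) + h * (M * (a + P - b))"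
    using h ab by (intro add_mono mult_left_mono integral_bound bnd y continuous_on_subset[OF cont]) auto
  also have "\<dots> = M * P * (2 * h * (1 - h))"
  proof -
    have "a + P - b = (1 - h) * P" using h(3) by (simp add: algebra_simps)
    then show ?thesis by (simp only: h(3)) (simp add: algebra_simps)
  qed
  also have "\<dots> \<le> M * P * (1 / 2)"
  proof (rule mult_left_mono)
    have "0 \<le> (2 * h - 1)\<^sup>2" by simp
    then show "2 * h * (1 - h) \<le> 1 / 2" by (simp add: power2_eq_square algebra_simps)
  qed (use M P in auto)
  finally show ?thesis by simp
qed

lemma D_full_periods:
  "real j * P \<le> T \<Longrightarrow> norm (integral {0..real j * P} D) \<le> L * M * (real j * P) * (P / 2)"
proof (induction j)
  case 0
  then show ?case by simp
next
  case (Suc j)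
  let ?a = "real j * P"
  have b: "real (Suc j) * P = ?a + P" by (simp add: algebra_simps)
  have le: "0 \<le> ?a" "?a \<le> ?a + P" "?a + P \<le> T" using Suc.prems P unfolding b by auto
  define y where "y = w ((?a + (?a + P)) / 2)"
  have "(c + d) / 2 \<in> {0..T}" if "0 \<le> c" "c \<le> d" "d \<le> T" for c d using that by auto
  then have y: "norm y \<le> R" unfolding y_def using le by (intro w_bnd)
  have "integral {?a..?a + P} (\<lambda>q. F q y - Av y) = 0"
    using P by (subst hk_diff) (auto intro: F_int y simp: Av_period y)
  then have 1: "norm (integral {?a..?a + P} D) \<le> L * M * P\<^sup>2 / 2"
    using D_freeze[OF le] by (simp add: y_def)
  have "integral {0..?a} D + integral {?a..?a + P} D = integral {0..?a + P} D"
    using le by (intro hk_combine D_int) auto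
  then have "norm (integral {0..?a + P} D) \<le> norm (integral {0..?a} D) + norm (integral {?a..?a + P} D)"
    using norm_triangle_ineq by metis
  also have "\<dots> \<le> L * M * ?a * (P / 2) + L * M * P\<^sup>2 / 2" using Suc le 1 by (intro add_mono) auto
  finally show ?case unfolding b by (simp add: power2_eq_square algebra_simps)
qed

lemma D_integral:
  assumes t: "t \<in> {0..T}"
  shows "norm (integral {0..t} D) \<le> (t * (L * M) + M) * (P / 2)"
proof -
  define j where "j = nat \<lfloor>t / P\<rfloor>"
  have "real j \<le> t / P" "t / P < real j + 1"
  proof -
    have "0 \<le> t / P" using t P by simp
    then have "real j = of_int \<lfloor>t / P\<rfloor>" by (simp add: j_def)
    then show "real j \<le> t / P" "t / P < real j + 1" by linarith+
  qed
  then have j: "real j * P \<le> t" "t \<le> real j * P + P" using P by (simp_all add: field_simps)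
  let ?a = "real j * P"
  have le: "0 \<le> ?a" "?a \<le> t" "t \<le> T" using j t P by auto
  \<comment> \<open>One factor is bounded by the period, so the drift error of the last piece
    becomes linear in its length and joins that of the full periods.\<close>
  have "(t - ?a)\<^sup>2 \<le> (t - ?a) * P"
    unfolding power2_eq_square using j by (intro mult_left_mono) auto
  then have sq: "L * M * (t - ?a)\<^sup>2 / 2 \<le> L * M * ((t - ?a) * P) / 2"
    using L M by (intro divide_right_mono mult_left_mono) auto
  have mid: "(c + d) / 2 \<in> {0..T}" if "0 \<le> c" "c \<le> d" "d \<le> T" for c d using that by auto
  have "norm (integral {?a..t} (\<lambda>q. F q (w ((?a + t) / 2)) - Av (w ((?a + t) / 2)))) \<le> M * P / 2"
    using le j by (intro oscillation w_bnd mid) auto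
  then have "norm (integral {?a..t} D) \<le> M * P / 2 + L * M * ((t - ?a) * P) / 2"
    using D_freeze[OF le] sq by linarith
  moreover have "norm (integral {0..?a} D) \<le> L * M * ?a * (P / 2)"
    using le by (intro D_full_periods) auto
  moreover have "integral {0..?a} D + integral {?a..t} D = integral {0..t} D"
    using le by (intro hk_combine D_int) auto
  then have "norm (integral {0..t} D) \<le> norm (integral {0..?a} D) + norm (integral {?a..t} D)"
    using norm_triangle_ineq by metis
  ultimately have "norm (integral {0..t} D)
      \<le> L * M * ?a * (P / 2) + (M * P / 2 + L * M * ((t - ?a) * P) / 2)" by linarith
  also have "\<dots> = (t * (L * M) + M) * (P / 2)" by (simp add: field_simps)
  finally show ?thesis .
qed

theorem averaging:
  assumes P2: "P \<le> 2" and v_cont: "continuous_on {0..T} v" and v_bnd: "\<And>t. t \<in> {0..T} \<Longrightarrow> norm (v t) \<le> R"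
    and v_eq: "\<And>t. t \<in> {0..T} \<Longrightarrow> v t = w 0 + integral {0..t} (\<lambda>q. F q (v q))"
    and t: "t \<in> {0..T}"
  shows "norm (v t - w t) \<le> (t * (L * M) + M) * exp (L * t)"
proof (rule gronwall)
  have sub: "{0..q} \<subseteq> {0..T}" if "q \<in> {0..t}" for q using t that by auto
  show "continuous_on {0..t} (\<lambda>q. norm (v q - w q))"
    using sub[of t] t
    by (intro continuous_intros continuous_on_subset[OF v_cont] continuous_on_subset[OF w_cont]) auto
  fix q assume q: "q \<in> {0..t}"
  then have qT: "q \<in> {0..T}" using t by auto
  have iv: "(\<lambda>q. F q (v q)) integrable_on {0..q}" and iw: "(\<lambda>q. F q (w q)) integrable_on {0..q}"
    and ia: "(\<lambda>q. Av (w q)) integrable_on {0..q}"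
    by (intro integrable_continuous_interval continuous_on_subset[OF F_cont sub[OF q]]
        continuous_on_subset[OF w_Av_cont sub[OF q]] v_cont v_bnd w_cont w_bnd; assumption)+
  have "v q - w q = integral {0..q} (\<lambda>q. F q (v q)) - integral {0..q} (\<lambda>q. Av (w q))"
    using v_eq[OF qT] w_eq[OF qT] by simp
  also have "\<dots> = integral {0..q} (\<lambda>q. F q (v q) - F q (w q)) + integral {0..q} D"
    unfolding D_def hk_diff[OF iv iw]
      hk_diff[OF iw ia] by simp
  also have "norm \<dots> \<le> norm (integral {0..q} (\<lambda>q. F q (v q) - F q (w q))) + norm (integral {0..q} D)"
    by (rule norm_triangle_ineq)
  also have "norm (integral {0..q} (\<lambda>q. F q (v q) - F q (w q))) \<le> integral {0..q} (\<lambda>q. L * norm (v q - w q))"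
  proof (rule integral_norm_bound_integral)
    show "(\<lambda>q. L * norm (v q - w q)) integrable_on {0..q}"
      by (intro integrable_continuous_interval continuous_intros
          continuous_on_subset[OF v_cont sub[OF q]] continuous_on_subset[OF w_cont sub[OF q]])
  qed (use sub[OF q] in \<open>auto intro!: lip v_bnd w_bnd hk_idiff iv iw\<close>)
  also have "integral {0..q} (\<lambda>q. L * norm (v q - w q)) = L * integral {0..q} (\<lambda>q. norm (v q - w q))"
    by simp
  also have "norm (integral {0..q} D) \<le> (q * (L * M) + M) * (P / 2)" by (rule D_integral[OF qT])
  \<comment> \<open>\<open>P \<le> 2\<close> absorbs the half period and gives both terms the
    constant 1. The bound is taken at the final time because \<open>gronwall\<close> wants a
    constant.\<close>
  also have "\<dots> \<le> (t * (L * M) + M) * 1"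
    using P P2 L M q by (intro mult_mono add_mono mult_right_mono) auto
  finally show "norm (v q - w q) \<le> t * (L * M) + M + L * integral {0..q} (\<lambda>q. norm (v q - w q))"
    by simp
qed (use t L in auto)

end

section \<open>Comparison of the two equations in the interaction picture\<close>

text \<open>The propagator is only strongly continuous in time; isometry moves the change of
  \<open>z\<close> out first, which leaves the orbit of the fixed vector \<open>z t\<close>.\<close>

lemma continuous_propagator_curve:
  assumes p: "continuous_on S p" and z: "continuous_on S z"
  shows "continuous_on S (\<lambda>t. propagator (p t) (z t))"
proof (rule continuous_on_majorant)
  fix t assume t: "t \<in> S"
  have "continuous_on S (\<lambda>q. propagator (p q) (z t))"
    by (rule continuous_on_compose2[OF continuous_propagator p]) simp
  then have "((\<lambda>q. propagator (p q) (z t)) \<longlongrightarrow> propagator (p t) (z t)) (at t within S)"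
    "(z \<longlongrightarrow> z t) (at t within S)"
    using z t by (auto simp: continuous_on_def)
  then show "((\<lambda>q. norm (z q - z t) + norm (propagator (p q) (z t) - propagator (p t) (z t))) \<longlongrightarrow> 0) (at t within S)"
    by (auto intro!: tendsto_eq_intros)
  show "norm (propagator (p q) (z q) - propagator (p t) (z t))
      \<le> norm (z q - z t) + norm (propagator (p q) (z t) - propagator (p t) (z t))" for q
    using norm_triangle_ineq[of "propagator (p q) (z q - z t)" "propagator (p q) (z t) - propagator (p t) (z t)"]
    by (simp add: propagator_diff) (simp flip: propagator_diff)
qed

lemma sobolev_continuous_lift:
  assumes u: "sobolev_continuous s I u"
  shows "continuous_on I (\<lambda>t. sob_lift s (u t))"
proof (rule continuous_on_majorant)
  fix t assume t: "t \<in> I"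
  show "((\<lambda>q. sobolev_norm s (u q - u t)) \<longlongrightarrow> 0) (at t within I)"
    using u t by (simp add: sobolev_continuous_def)
  fix q assume "q \<in> I"
  then have "u q \<in> sobolev s" "u t \<in> sobolev s" using u t by (simp_all add: sobolev_continuous_def)
  then show "norm (sob_lift s (u q) - sob_lift s (u t)) \<le> sobolev_norm s (u q - u t)"
    by (simp add: sobolev_norm_lift sob_lift_diff)
qed

text \<open>Only the Hermite coefficients of \<open>y\<close> need derivatives, which is all that
  the weak formulation provides. The scalar fundamental theorem applies to each mode, and
  completeness restores the vector identity.\<close>

lemma L2_integral_eqI:
  assumes G: "G integrable_on {a..b}" and "a \<le> b"
    and d: "\<And>n t. t \<in> {a..b} \<Longrightarrow>
      ((\<lambda>q. hcoeff (y q) n) has_vector_derivative hcoeff (G t) n) (at t within {a..b})"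
  shows "y b = y a + integral {a..b} G"
proof (rule hcoeff_eqI)
  fix n
  have "((\<lambda>q. hcoeff (G q) n) has_integral hcoeff (y b) n - hcoeff (y a) n) {a..b}"
    by (rule fundamental_theorem_of_calculus[OF \<open>a \<le> b\<close> d])
  moreover have "((\<lambda>q. hcoeff (G q) n) has_integral hcoeff (integral {a..b} G) n) {a..b}"
    using has_integral_linear[OF integrable_integral[OF G] bounded_linear_hcoeff[of n]]
    by (simp add: comp_def)
  ultimately have "hcoeff (y b) n - hcoeff (y a) n = hcoeff (integral {a..b} G) n"
    by (rule has_integral_unique)
  then show "hcoeff (y b) n = hcoeff (y a + integral {a..b} G) n" by (simp add: algebra_simps)
qed

lemma pairing_harm_osc_hermite: "pairing v (harm_osc (hermite_fun n)) = (2 * of_nat n + 1) * hcoeff v n"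
proof -
  have "pairing v (harm_osc (hermite_fun n))
      = (LBINT x. (2 * of_nat n + 1) * (rep_L2 v x * complex_of_real (hermite_fun n x)))"
    unfolding pairing_def harm_osc_hermite_fun by (simp add: mult_ac)
  then show ?thesis unfolding integral_mult_right_zero by (simp add: hcoeff_def pairing_def)
qed

section \<open>Both equations lifted to \<open>L2\<close>\<close>

locale trapped_nls =
  fixes s A R :: real and k :: nat
  assumes s: "s \<ge> 0" and alg: "algebra_const s A" and A: "A > 0" and R: "R \<ge> 0"
begin

definition Nt :: "L2 \<Rightarrow> L2" where "Nt y = sob_lift s (nonlin k (sob_drop s y))"

text \<open>With \<open>u = exp(itH) v\<close> the linear part drops out of
  \<open>i u_t + H u = |u|^(2k) u\<close>; dividing \<open>i v_t\<close> by \<open>\<i>\<close>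
  produces the factor \<open>- \<i>\<close>.\<close>

definition field :: "real \<Rightarrow> L2 \<Rightarrow> L2" where
  "field t y = (- \<i>) *\<^sub>C propagator (- t) (Nt (propagator t y))"

abbreviation "Lc \<equiv> (2 * real k + 1) * A ^ (2 * k) * R ^ (2 * k)"
abbreviation "Mc \<equiv> A ^ (2 * k) * R ^ (2 * k + 1)"

lemma sobolev_norm_drop: "sobolev_norm s (sob_drop s y) = norm y"
  by (simp add: sobolev_norm_lift sob_lift_drop s)

lemma sob_drop_diff: "sob_drop s x - sob_drop s y = sob_drop s (x - y)"
  by (rule hcoeff_eqI) (simp add: hcoeff_sob_drop s right_diff_distrib)

lemma sob_drop_propagator: "sob_drop s (propagator t y) = propagator t (sob_drop s y)"
  by (rule hcoeff_eqI) (simp add: hcoeff_sob_drop s mult_ac)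

lemma nonlin_drop_mem: "nonlin k (sob_drop s y) \<in> sobolev s"
  by (intro nonlin_mem[OF alg] sob_drop_mem s)

lemma Nt_norm: "norm y \<le> R \<Longrightarrow> norm (Nt y) \<le> Mc"
  unfolding Nt_def sobolev_norm_lift[symmetric]
  using A by (intro nonlin_norm[OF alg sob_drop_mem]) (simp_all add: s sobolev_norm_drop)

lemma Nt_lipschitz: "norm x \<le> R \<Longrightarrow> norm y \<le> R \<Longrightarrow> norm (Nt x - Nt y) \<le> Lc * norm (x - y)"
  using nonlin_lipschitz[OF alg less_imp_le[OF A] sob_drop_mem[OF s] sob_drop_mem[OF s], of x R y k]
  unfolding Nt_def sob_lift_diff[OF nonlin_drop_mem nonlin_drop_mem, symmetric]
  by (simp add: sob_drop_diff sobolev_norm_drop flip: sobolev_norm_lift)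

lemma Nt_half_period: "Nt (propagator (pi / 2) y) = propagator (pi / 2) (Nt y)"
  by (simp add: Nt_def sob_drop_propagator nonlin_half_period[OF alg sob_drop_mem[OF s]]
      sob_lift_propagator nonlin_drop_mem)

sublocale periodic_field field "pi / 2" Lc Mc R
proof
  show "0 < pi / 2" "Lc \<ge> 0" "Mc \<ge> 0" using A R by simp_all
  fix y :: L2 assume y: "norm y \<le> R"
  have "continuous_on UNIV (\<lambda>t. Nt (propagator t y))"
    using continuous_propagator[of y] by (rule continuous_on_lipschitz_comp[where L = Lc]) (use y in \<open>simp add: Nt_lipschitz\<close>)
  then show "continuous_on UNIV (\<lambda>t. field t y)"
    unfolding field_def
    by (intro bounded_linear.continuous_on[OF bounded_linear_scaleC] continuous_propagator_curve
        continuous_intros)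
  fix t
  show "norm (field t y) \<le> Mc"
    using Nt_norm[of "propagator t y"] y by (simp add: field_def norm_scaleC)
  show "field (t + pi / 2) y = field t y"
  proof -
    have e: "propagator (t + pi / 2) y = propagator (pi / 2) (propagator t y)"
      by (simp add: propagator_propagator add.commute)
    show ?thesis unfolding field_def e Nt_half_period by (simp add: propagator_propagator)
  qed
next
  fix t and x y :: L2 assume xy: "norm x \<le> R" "norm y \<le> R"
  have "norm (field t x - field t y) = norm (Nt (propagator t x) - Nt (propagator t y))"
    unfolding field_def by (simp add: norm_scaleC flip: scaleC_diff_right propagator_diff)
  also have "\<dots> \<le> Lc * norm (propagator t x - propagator t y)"
    using xy by (intro Nt_lipschitz) simp_all
  finally show "norm (field t x - field t y) \<le> Lc * norm (x - y)"
    by (simp flip: propagator_diff)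
qed

lemma hcoeff_field:
  assumes "v \<in> sobolev s"
  shows "hcoeff (field t (sob_lift s v)) n
    = - \<i> * sobolev_mult s n * hcoeff (propagator (- t) (nonlin k (propagator t v))) n"
proof -
  note p = sobolev_propagator(1)[OF assms, of t]
  show ?thesis
    using nonlin_mem[OF alg p]
    by (simp add: field_def Nt_def sob_lift_propagator[OF assms, symmetric] sob_drop_lift[OF s p]
        hcoeff_sob_lift)
qed

text \<open>Testing with a Hermite function diagonalises \<open>H\<close>, so the distributional
  equation becomes a scalar one for each mode, to be solved with an integrating factor.\<close>

lemma nls_interaction:
  assumes u: "nls_solution k s T u" and bu: "\<And>t. t \<in> {0..T} \<Longrightarrow> sobolev_norm s (u t) \<le> R"
  defines "V \<equiv> \<lambda>t. sob_lift s (propagator (- t) (u t))"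
  shows "continuous_on {0..T} V" "t \<in> {0..T} \<Longrightarrow> norm (V t) \<le> R"
    "t \<in> {0..T} \<Longrightarrow> V t = V 0 + integral {0..t} (\<lambda>q. field q (V q))"
proof -
  have mem: "u t \<in> sobolev s" if "t \<in> {0..T}" for t
    using u that by (simp add: nls_solution_def sobolev_continuous_def)
  have pmem: "propagator (- t) (u t) \<in> sobolev s" if "t \<in> {0..T}" for t
    by (rule sobolev_propagator(1)[OF mem[OF that]])
  have "continuous_on {0..T} (\<lambda>t. propagator (- t) (sob_lift s (u t)))"
    by (intro continuous_propagator_curve continuous_intros sobolev_continuous_lift)
      (use u in \<open>simp add: nls_solution_def\<close>)
  then show c: "continuous_on {0..T} V"
    by (rule continuous_on_eq) (simp add: V_def sob_lift_propagator mem)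
  have b: "norm (V t) \<le> R" if "t \<in> {0..T}" for t
    using bu[OF that] by (simp add: V_def sob_lift_propagator[OF mem[OF that]] sobolev_norm_lift)
  then show "t \<in> {0..T} \<Longrightarrow> norm (V t) \<le> R" .
  show "V t = V 0 + integral {0..t} (\<lambda>q. field q (V q))" if t: "t \<in> {0..T}"
  proof (rule L2_integral_eqI)
    show "(\<lambda>q. field q (V q)) integrable_on {0..t}"
      by (rule integrable_continuous_interval[OF continuous_on_subset[OF F_cont[OF c b]]]) (use t in auto)
    show "0 \<le> t" using t by simp
    fix n q assume q: "q \<in> {0..t}"
    then have qT: "q \<in> {0..T}" using t by auto
    let ?E = "\<lambda>q. exp (\<i> * of_real (- q * (2 * real n + 1)))"
    have "\<exists>d. ((\<lambda>q. pairing (u q) (hermite_fun n)) has_vector_derivative d) (at q within {0..T}) \<and>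
        \<i> * d + pairing (u q) (harm_osc (hermite_fun n)) = pairing (nonlin k (u q)) (hermite_fun n)"
      using u qT schwartz_hermite[of n] unfolding nls_solution_def by blast
    then obtain d where d: "((\<lambda>q. hcoeff (u q) n) has_vector_derivative d) (at q within {0..T})"
      and eq: "\<i> * d + (2 * of_nat n + 1) * hcoeff (u q) n = hcoeff (nonlin k (u q)) n"
      unfolding pairing_harm_osc_hermite hcoeff_def by blast
    have d_eq: "d = \<i> * ((2 * of_nat n + 1) * hcoeff (u q) n) - \<i> * hcoeff (nonlin k (u q)) n"
      unfolding eq[symmetric] by (simp add: algebra_simps)
    have E: "(?E has_vector_derivative (- \<i> * (2 * of_nat n + 1)) * ?E q) (at q within {0..T})"
      using exp_scaleR_has_vector_derivative_right[of "- \<i> * (2 * of_nat n + 1)" q "{0..T}"]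
      by (simp add: scaleR_conv_of_real algebra_simps)
    \<comment> \<open>By the product rule the rotation contributes
      \<open>- \<i> * (2 * n + 1)\<close> times the mode, which cancels the linear part of
      \<open>d\<close>.\<close>
    have "((\<lambda>q. sobolev_mult s n * (?E q * hcoeff (u q) n)) has_vector_derivative
        sobolev_mult s n * (?E q * d + ((- \<i> * (2 * of_nat n + 1)) * ?E q) * hcoeff (u q) n))
        (at q within {0..T})"
      by (intro has_vector_derivative_mult_right has_vector_derivative_mult E d)
    also have "sobolev_mult s n * (?E q * d + ((- \<i> * (2 * of_nat n + 1)) * ?E q) * hcoeff (u q) n)
        = - \<i> * sobolev_mult s n * (?E q * hcoeff (nonlin k (u q)) n)"
      unfolding d_eq by (simp add: algebra_simps)
    also have "\<dots> = hcoeff (field q (V q)) n"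
      unfolding V_def hcoeff_field[OF pmem[OF qT]]
      by (simp add: propagator_propagator)
    finally have "((\<lambda>q. sobolev_mult s n * (?E q * hcoeff (u q) n)) has_vector_derivative
        hcoeff (field q (V q)) n) (at q within {0..t})"
      by (rule has_vector_derivative_within_subset) (use t in auto)
    then show "((\<lambda>q. hcoeff (V q) n) has_vector_derivative hcoeff (field q (V q)) n) (at q within {0..t})"
      by (rule has_vector_derivative_transform[rotated 2])
        (use q t in \<open>auto simp: V_def hcoeff_sob_lift pmem\<close>)
  qed
qed

text \<open>Derivative and integral of the resonant equation exist in \<open>L2\<close> only, and
  \<open>sob_lift s\<close> need not be bounded, so it is not moved through them; on each mode it is
  a scalar factor.\<close>

lemma resonant_interaction:
  assumes w: "resonant_solution k s T w" and bw: "\<And>t. t \<in> {0..T} \<Longrightarrow> sobolev_norm s (w t) \<le> R"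
  defines "W \<equiv> \<lambda>t. sob_lift s (w t)"
  shows "averaged_curve field (pi / 2) Lc Mc R T W"
proof
  have mem: "w t \<in> sobolev s" if "t \<in> {0..T}" for t
    using w that by (simp add: resonant_solution_def sobolev_continuous_def)
  show c: "continuous_on {0..T} W"
    unfolding W_def using w by (intro sobolev_continuous_lift) (simp add: resonant_solution_def)
  show b: "norm (W t) \<le> R" if "t \<in> {0..T}" for t
    using bw[OF that] by (simp add: W_def sobolev_norm_lift)
  show "W t = W 0 + integral {0..t} (\<lambda>q. Av (W q))" if t: "t \<in> {0..T}" for t
  proof (rule L2_integral_eqI)
    show "(\<lambda>q. Av (W q)) integrable_on {0..t}"
      by (rule integrable_continuous_interval[OF continuous_on_subset[OF Av_cont[OF c b]]]) (use t in auto)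
    show "0 \<le> t" using t by simp
    fix n q assume q: "q \<in> {0..t}"
    then have qT: "q \<in> {0..T}" using t by auto
    obtain d J where d: "(w has_vector_derivative d) (at q within {0..T})"
      and J: "((\<lambda>r. propagator (- r) (nonlin k (propagator r (w q)))) has_integral J) {- pi / 4..pi / 4}"
      and eq: "\<i> *\<^sub>C d = (2 / pi) *\<^sub>R J"
      using w qT unfolding resonant_solution_def by blast
    have "hcoeff (\<i> *\<^sub>C d) n = hcoeff ((2 / pi) *\<^sub>R J) n" by (simp only: eq)
    then have e: "\<i> * hcoeff d n = (2 / pi) *\<^sub>R hcoeff J n" by simp
    have "hcoeff d n = - \<i> * (\<i> * hcoeff d n)" by simp
    then have dn: "hcoeff d n = - \<i> * ((2 / pi) *\<^sub>R hcoeff J n)" by (simp only: e)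
    have "((\<lambda>r. (- \<i> * sobolev_mult s n) * hcoeff (propagator (- r) (nonlin k (propagator r (w q)))) n)
        has_integral (- \<i> * sobolev_mult s n) * hcoeff J n) {- pi / 4..pi / 4}"
      using has_integral_linear[OF J bounded_linear_hcoeff[of n]]
      by (intro has_integral_mult_right) (simp add: comp_def)
    moreover have "((\<lambda>r. hcoeff (field r (W q)) n)
        has_integral hcoeff (integral {- pi / 4..pi / 4} (\<lambda>r. field r (W q))) n) {- pi / 4..pi / 4}"
      using has_integral_linear[OF integrable_integral[OF F_int[OF b[OF qT]]] bounded_linear_hcoeff[of n]]
      by (simp add: comp_def)
    ultimately have "(- \<i> * sobolev_mult s n) * hcoeff J n
        = hcoeff (integral {- pi / 4..pi / 4} (\<lambda>r. field r (W q))) n"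
      unfolding W_def hcoeff_field[OF mem[OF qT]] by (rule has_integral_unique)
    then have Avn: "sobolev_mult s n * hcoeff d n = hcoeff (Av (W q)) n"
      unfolding dn Av_def by (simp add: field_simps scaleR_conv_of_real)
    have "((\<lambda>q. sobolev_mult s n * hcoeff (w q) n) has_vector_derivative sobolev_mult s n * hcoeff d n)
        (at q within {0..T})"
      by (intro has_vector_derivative_mult_right bounded_linear.has_vector_derivative[OF bounded_linear_hcoeff d])
    then have "((\<lambda>q. sobolev_mult s n * hcoeff (w q) n) has_vector_derivative hcoeff (Av (W q)) n)
        (at q within {0..t})"
      unfolding Avn by (rule has_vector_derivative_within_subset) (use t in auto)
    then show "((\<lambda>q. hcoeff (W q) n) has_vector_derivative hcoeff (Av (W q)) n) (at q within {0..t})"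
      by (rule has_vector_derivative_transform[rotated 2])
        (use q t in \<open>auto simp: W_def hcoeff_sob_lift mem\<close>)
  qed
qed

lemma resonant_approximation:
  assumes u: "nls_solution k s T u" and w: "resonant_solution k s T w" and init: "u 0 = w 0"
    and bound: "\<And>t. t \<in> {0..T} \<Longrightarrow> sobolev_norm s (u t) \<le> R \<and> sobolev_norm s (w t) \<le> R"
    and t: "t \<in> {0..T}"
  shows "sobolev_norm s (u t - propagator t (w t)) \<le>
    (t * (2 * real k + 1) * A ^ (4 * k) * R ^ (4 * k + 1) + A ^ (2 * k) * R ^ (2 * k + 1))
    * exp ((2 * real k + 1) * t * A ^ (2 * k) * R ^ (2 * k))"
proof -
  define V where "V = (\<lambda>t. sob_lift s (propagator (- t) (u t)))"
  define W where "W = (\<lambda>t. sob_lift s (w t))"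
  interpret averaged_curve field "pi / 2" Lc Mc R T W
    unfolding W_def using bound by (intro resonant_interaction[OF w]) blast
  have bu: "sobolev_norm s (u t) \<le> R" if "t \<in> {0..T}" for t using bound that by blast
  have V: "continuous_on {0..T} V" "\<And>t. t \<in> {0..T} \<Longrightarrow> norm (V t) \<le> R"
    "\<And>t. t \<in> {0..T} \<Longrightarrow> V t = V 0 + integral {0..t} (\<lambda>q. field q (V q))"
    unfolding V_def by ((rule nls_interaction[OF u]; (rule bu)?); assumption)+
  have VW: "V 0 = W 0" by (simp add: V_def W_def init)
  have "norm (V t - W t) \<le> (t * (Lc * Mc) + Mc) * exp (Lc * t)"
  proof (rule averaging[OF _ V(1,2) _ t])
    show "pi / 2 \<le> 2" using pi_less_4 by simp
    show "V t = W 0 + integral {0..t} (\<lambda>q. field q (V q))" if "t \<in> {0..T}" for t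
      using V(3)[OF that] VW by simp
  qed
  also have "t * (Lc * Mc) + Mc
      = t * (2 * real k + 1) * A ^ (4 * k) * R ^ (4 * k + 1) + A ^ (2 * k) * R ^ (2 * k + 1)"
  proof -
    have e: "x ^ (4 * k) = x ^ (2 * k) * x ^ (2 * k)" for x :: real by (simp flip: power_add)
    show ?thesis unfolding power_add e by (simp add: algebra_simps)
  qed
  \<comment> \<open>The difference in the interaction picture is \<open>propagator (- t)\<close> of
    the lifted error, and that operator is an isometry.\<close>
  also have "norm (V t - W t) = sobolev_norm s (u t - propagator t (w t))"
  proof -
    have mem: "u t \<in> sobolev s" "w t \<in> sobolev s"
      using u w t by (simp_all add: nls_solution_def resonant_solution_def sobolev_continuous_def)
    have "V t - W t = propagator (- t) (sob_lift s (u t - propagator t (w t)))"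
      by (simp add: V_def W_def sob_lift_diff sob_lift_propagator mem sobolev_propagator propagator_diff
          propagator_propagator)
    then show ?thesis by (simp add: sobolev_norm_lift)
  qed
  finally show ?thesis by (simp add: mult_ac)
qed

end

theorem theorem2p3:
  fixes k :: nat and s :: real
  assumes "k \<ge> 1" and "s > 1 / 2"
  shows "(\<exists>A>0. algebra_const s A) \<and>
    (\<forall>A>0. algebra_const s A \<longrightarrow>
      (\<forall>u0\<in>sobolev s. \<forall>u w. \<forall>T \<epsilon> :: real.
        nls_solution k s T u \<longrightarrow> resonant_solution k s T w \<longrightarrow> u 0 = u0 \<longrightarrow> w 0 = u0 \<longrightarrow>
        (\<forall>t\<in>{0..T}. sobolev_norm s (u t) \<le> \<epsilon> \<and> sobolev_norm s (w t) \<le> \<epsilon>) \<longrightarrow>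
        (\<forall>t\<in>{0..T}. sobolev_norm s (u t - propagator t (w t)) \<le>
          (t * (2 * real k + 1) * A ^ (4 * k) * \<epsilon> ^ (4 * k + 1) + A ^ (2 * k) * \<epsilon> ^ (2 * k + 1))
          * exp ((2 * real k + 1) * t * A ^ (2 * k) * \<epsilon> ^ (2 * k))))) \<and>
    (\<forall>C>0. \<exists>C'>0.
      \<forall>u0\<in>sobolev s. \<forall>u w. \<forall>T \<epsilon> :: real.
        nls_solution k s T u \<longrightarrow> resonant_solution k s T w \<longrightarrow> u 0 = u0 \<longrightarrow> w 0 = u0 \<longrightarrow>
        (\<forall>t\<in>{0..T}. sobolev_norm s (u t) \<le> \<epsilon> \<and> sobolev_norm s (w t) \<le> \<epsilon>) \<longrightarrow>
        (\<forall>t\<in>{0..T}. t \<le> C / \<epsilon> ^ (2 * k) \<longrightarrow>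
          sobolev_norm s (u t - propagator t (w t)) \<le> C' * \<epsilon> ^ (2 * k + 1)))"
proof -
  have ex: "\<exists>A>0. algebra_const s A" by (rule algebra_const_exists[OF assms(2)])
  \<comment> \<open>No sign is assumed for the bound; a time in the interval makes it dominate a
    norm.\<close>
  have R0: "R \<ge> 0" if "\<forall>t\<in>{0..T}. sobolev_norm s (u t) \<le> R \<and> sobolev_norm s (w t) \<le> R" "t \<in> {0..T}"
    for u w :: "real \<Rightarrow> L2" and T R t :: real
  proof -
    have "sobolev_norm s (u t) \<le> R" using that by blast
    with sobolev_norm_nonneg show ?thesis by (rule order_trans)
  qed
  have main: "sobolev_norm s (u t - propagator t (w t)) \<le>
      (t * (2 * real k + 1) * A ^ (4 * k) * R ^ (4 * k + 1) + A ^ (2 * k) * R ^ (2 * k + 1))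
      * exp ((2 * real k + 1) * t * A ^ (2 * k) * R ^ (2 * k))"
    if "A > 0" "algebra_const s A" "nls_solution k s T u" "resonant_solution k s T w" "u 0 = u0" "w 0 = u0"
      and b: "\<forall>t\<in>{0..T}. sobolev_norm s (u t) \<le> R \<and> sobolev_norm s (w t) \<le> R" and t: "t \<in> {0..T}"
    for A T R t u w u0
  proof -
    interpret trapped_nls s A R k
      using assms(2) that(1,2) R0[OF b t] by unfold_locales simp_all
    show ?thesis by (rule resonant_approximation[OF that(3,4) _ _ t]) (use that b in auto)
  qed
  obtain A where A: "A > 0" "algebra_const s A" using ex by blast
  \<comment> \<open>The value of the explicit bound at \<open>t * R ^ (2 * k) = C\<close>, with
    \<open>R ^ (2 * k + 1)\<close> taken out. As \<open>A\<close> was fixed before the solutions, it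
    depends on \<open>s\<close>, \<open>k\<close> and \<open>C\<close> only.\<close>
  define K where "K = (\<lambda>C. (C * (2 * real k + 1) * A ^ (4 * k) + A ^ (2 * k))
    * exp ((2 * real k + 1) * C * A ^ (2 * k)))"
  have K: "K C > 0" if "C > 0" for C
    unfolding K_def using that A by (intro mult_pos_pos add_nonneg_pos) auto
  have small: "sobolev_norm s (u t - propagator t (w t)) \<le> K C * R ^ (2 * k + 1)"
    if sol: "nls_solution k s T u" "resonant_solution k s T w" "u 0 = u0" "w 0 = u0"
      and b: "\<forall>t\<in>{0..T}. sobolev_norm s (u t) \<le> R \<and> sobolev_norm s (w t) \<le> R" and t: "t \<in> {0..T}"
      and C: "C > 0" and le: "t \<le> C / R ^ (2 * k)"
    for u w u0 T R t C
  proof -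
    note R = R0[OF b t]
    \<comment> \<open>For \<open>R = 0\<close> the quotient in \<open>le\<close> is 0 by convention
      and carries no such information, but the product vanishes because
      \<open>k \<ge> 1\<close>.\<close>
    have te: "t * R ^ (2 * k) \<le> C"
      using assms(1) C le R by (cases "R = 0") (simp_all add: power_0_left field_simps)
    have e: "R ^ (4 * k + 1) = R ^ (2 * k) * R ^ (2 * k + 1)" by (simp flip: power_add)
    have "sobolev_norm s (u t - propagator t (w t)) \<le>
        ((t * R ^ (2 * k)) * (2 * real k + 1) * A ^ (4 * k) + A ^ (2 * k)) * R ^ (2 * k + 1)
        * exp ((2 * real k + 1) * (t * R ^ (2 * k)) * A ^ (2 * k))"
      using main[OF A sol b t] unfolding e by (simp add: algebra_simps)
    also have "\<dots> \<le> (C * (2 * real k + 1) * A ^ (4 * k) + A ^ (2 * k)) * R ^ (2 * k + 1)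
        * exp ((2 * real k + 1) * C * A ^ (2 * k))"
      using te t R A C
      by (intro mult_mono mult_right_mono add_right_mono) (auto intro!: mult_right_mono mult_left_mono)
    finally show ?thesis by (simp add: K_def mult_ac)
  qed
  show ?thesis
    by (intro conjI ex) (blast intro: main, blast intro: K small)
qed

end
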